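(* The $G_2$-Laplacian $\varphi\mapsto\Delta_\varphi\varphi$ is an orientation-preserving bijection of the space of positive $SU(4)$-invariant 3-forms on $S^7=SU(4)/SU(3)$ onto itself, and its set of fixed points is the union of exactly two circles: there are unique $a_0,R_0>0$ such that the fixed points are precisely the forms $\sigma^3a_0^3\,e^1\wedge\omega+R_0^3\cos(\alpha)V_R+R_0^3\sin(\alpha)V_I$ with $\sigma\in\{-1,1\}$, $\alpha\in\mathbb{R}$.
   Context: $SU(3)$ is embedded in $SU(4)$ as the lower-right $3\times3$ block. Let $\xi_1,\xi_2,\xi_3$ be the standard basis of $\mathbb{C}^3$ and $\mathfrak{m}\subset\mathfrak{su}(4)$ spanned by $e_1=\begin{pmatrix}3i&0\\0&-iI_3\end{pmatrix}$, $e_{2j}=\begin{pmatrix}0&-\xi_j^T\\ \xi_j&0\end{pmatrix}$, $e_{2j+1}=\begin{pmatrix}0&i\xi_j^T\\ i\xi_j&0\end{pmatrix}$ ($j=1,2,3$), with dual basis $e^1,\dots,e^7$; $SU(4)$-invariant forms on $S^7$ are identified with $\mathrm{Ad}(SU(3))$-invariant elements of $\Lambda^\bullet\mathfrak{m}^*$. $\omega=e^{23}+e^{45}+e^{67}$, $V_R=e^{246}-e^{257}-e^{347}-e^{356}$, $V_I=e^{346}-e^{357}+e^{247}+e^{256}$. A 3-form $\varphi$ on a 7-dimensional space is positive if there exist a positive definite inner product $g$ and a volume form $\mathrm{dvol}_g$ of $g$ (for one of the two orientations) with $\frac16\iota_X\varphi\wedge\iota_Y\varphi\wedge\varphi=g(X,Y)\mathrm{dvol}_g$;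 this determines $g_\varphi$ and an orientation. $\Delta_\varphi=*_\varphi d*_\varphi d-d*_\varphi d*_\varphi$ is the Hodge Laplacian on 3-forms for $g_\varphi$ and the induced orientation. Orientation-preserving means $\Delta_\varphi\varphi$ induces the same orientation as $\varphi$; a fixed point is $\varphi$ with $\Delta_\varphi\varphi=\varphi$. *)

theory Defs
  imports Complex_Main "HOL-Combinatorics.Permutations"
begin

text \<open>Model. Vectors of m are coordinate functions v :: nat => real w.r.t. the basis
 e_1..e_7 (indices 1..7; v n = 0 for other n). A k-form on m is a function on lists
 of vectors, multilinear and alternating on lists of length k in M7, and 0 elsewhere.
 Alternating forms use the determinant convention, e.g. e^{ij}(e_i,e_j) = 1.\<close>

type_synonym vec = "nat \<Rightarrow> real"
type_synonym form = "vec list \<Rightarrow> real"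
type_synonym cmat = "nat \<Rightarrow> nat \<Rightarrow> complex"

definition M7 :: "vec set" where
  "M7 = {v. \<forall>n. n \<notin> {1..7} \<longrightarrow> v n = 0}"

definition lin :: "real \<Rightarrow> vec \<Rightarrow> real \<Rightarrow> vec \<Rightarrow> vec" where
  "lin a u b w = (\<lambda>n. a * u n + b * w n)"

definition ldet :: "nat \<Rightarrow> (nat \<Rightarrow> nat \<Rightarrow> 'a::comm_ring_1) \<Rightarrow> 'a" where
  "ldet k M = (\<Sum>p\<in>{p. p permutes {..<k}}. of_int (sign p) * (\<Prod>i<k. M i (p i)))"

definition restr :: "nat \<Rightarrow> form \<Rightarrow> form" where
  "restr k f = (\<lambda>xs. if length xs = k \<and> set xs \<subseteq> M7 then f xs else 0)"

definition is_form :: "nat \<Rightarrow> form \<Rightarrow> bool" where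
  "is_form k \<alpha> \<longleftrightarrow>
     (\<forall>xs. \<not> (length xs = k \<and> set xs \<subseteq> M7) \<longrightarrow> \<alpha> xs = 0)
   \<and> (\<forall>xs i u w a b. length xs = k \<and> set xs \<subseteq> M7 \<and> i < k \<and> u \<in> M7 \<and> w \<in> M7 \<longrightarrow>
        \<alpha> (xs[i := lin a u b w]) = a * \<alpha> (xs[i := u]) + b * \<alpha> (xs[i := w]))
   \<and> (\<forall>xs i j. length xs = k \<and> set xs \<subseteq> M7 \<and> i < k \<and> j < k \<and> i \<noteq> j \<and> xs ! i = xs ! j
        \<longrightarrow> \<alpha> xs = 0)"

definition wedge :: "nat \<Rightarrow> nat \<Rightarrow> form \<Rightarrow> form \<Rightarrow> form" where
  "wedge k l \<alpha> \<beta> = restr (k + l) (\<lambda>xs.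
     (\<Sum>p\<in>{p. p permutes {..<k + l}}. of_int (sign p)
        * \<alpha> (map (\<lambda>i. xs ! p i) [0..<k]) * \<beta> (map (\<lambda>i. xs ! p i) [k..<k + l]))
     / (fact k * fact l))"

definition iota :: "vec \<Rightarrow> form \<Rightarrow> form" where
  "iota X \<alpha> = (\<lambda>xs. \<alpha> (X # xs))"

definition eform :: "nat list \<Rightarrow> form" where
  "eform I = restr (length I) (\<lambda>xs. ldet (length I) (\<lambda>a b. (xs ! a) (I ! b)))"

definition mmul :: "cmat \<Rightarrow> cmat \<Rightarrow> cmat" where
  "mmul A B = (\<lambda>i j. \<Sum>k<4. A i k * B k j)"

definition madj :: "cmat \<Rightarrow> cmat" where
  "madj A = (\<lambda>i j. cnj (A j i))"

definition mcomm :: "cmat \<Rightarrow> cmat \<Rightarrow> cmat" where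
  "mcomm A B = (\<lambda>i j. mmul A B i j - mmul B A i j)"

text \<open>Basis e_1,...,e_7 of m inside su(4) (rows/columns indexed 0..3).\<close>
definition mbasis :: "nat \<Rightarrow> cmat" where
  "mbasis k = (\<lambda>i j.
     if k = 1 then (if i = 0 \<and> j = 0 then 3 * \<i> else if i = j \<and> i \<in> {1..3} then - \<i> else 0)
     else if k \<in> {2..7} then
       (let c = k div 2 in
        if even k then (if i = 0 \<and> j = c then -1 else if i = c \<and> j = 0 then 1 else 0)
        else (if (i = 0 \<and> j = c) \<or> (i = c \<and> j = 0) then \<i> else 0))
     else 0)"

definition emb :: "vec \<Rightarrow> cmat" where
  "emb v = (\<lambda>i j. \<Sum>k\<in>{1..7}. complex_of_real (v k) * mbasis k i j)"

definition hsu3 :: "cmat set" where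
  "hsu3 = {Z. (\<forall>i j. (i = 0 \<or> j = 0 \<or> i \<ge> 4 \<or> j \<ge> 4) \<longrightarrow> Z i j = 0)
             \<and> (\<forall>i j. Z i j = - cnj (Z j i)) \<and> Z 1 1 + Z 2 2 + Z 3 3 = 0}"

text \<open>Bracket projected to m along su(3) (reductive decomposition su(4) = su(3) + m).\<close>
definition brm :: "vec \<Rightarrow> vec \<Rightarrow> vec" where
  "brm X Y = (THE v. v \<in> M7 \<and> (\<lambda>i j. mcomm (emb X) (emb Y) i j - emb v i j) \<in> hsu3)"

text \<open>Exterior derivative of invariant k-forms:
  d\<alpha>(X_0,..,X_k) = sum_{i<j} (-1)^(i+j) \<alpha>([X_i,X_j]_m, X_0,..(omit i,j)..,X_k).\<close>
definition dform :: "nat \<Rightarrow> form \<Rightarrow> form" where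
  "dform k \<alpha> = restr (k + 1) (\<lambda>xs.
     \<Sum>i<k + 1. \<Sum>j\<in>{i<..<k + 1}. (-1) ^ (i + j)
        * \<alpha> (brm (xs ! i) (xs ! j) # [xs ! t. t \<leftarrow> [0..<k + 1], t \<noteq> i \<and> t \<noteq> j]))"

definition SU3 :: "cmat set" where
  "SU3 = {h. (\<forall>i<3. \<forall>j<3. (\<Sum>k<3. h i k * cnj (h j k)) = (if i = j then 1 else 0))
            \<and> ldet 3 h = 1}"

definition embH :: "cmat \<Rightarrow> cmat" where
  "embH h = (\<lambda>i j. if i = 0 \<and> j = 0 then 1
                    else if i \<in> {1..3} \<and> j \<in> {1..3} then h (i - 1) (j - 1) else 0)"

definition adv :: "cmat \<Rightarrow> vec \<Rightarrow> vec" where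
  "adv h X = (THE v. v \<in> M7 \<and> emb v = mmul (mmul (embH h) (emb X)) (madj (embH h)))"

definition invariant :: "nat \<Rightarrow> form \<Rightarrow> bool" where
  "invariant k \<alpha> \<longleftrightarrow> (\<forall>h\<in>SU3. \<forall>xs. length xs = k \<and> set xs \<subseteq> M7 \<longrightarrow>
                        \<alpha> (map (adv h) xs) = \<alpha> xs)"

definition inner_prod :: "(vec \<Rightarrow> vec \<Rightarrow> real) \<Rightarrow> bool" where
  "inner_prod g \<longleftrightarrow> (\<forall>u v. (u \<notin> M7 \<or> v \<notin> M7) \<longrightarrow> g u v = 0)
     \<and> (\<forall>u v. g u v = g v u)
     \<and> (\<forall>u v w a b. u \<in> M7 \<and> v \<in> M7 \<and> w \<in> M7 \<longrightarrow> g (lin a u b v) w = a * g u w + b * g v w)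
     \<and> (\<forall>v\<in>M7. v \<noteq> (\<lambda>_. 0) \<longrightarrow> g v v > 0)"

definition orthonormal :: "(vec \<Rightarrow> vec \<Rightarrow> real) \<Rightarrow> vec list \<Rightarrow> bool" where
  "orthonormal g fs \<longleftrightarrow> length fs = 7 \<and> set fs \<subseteq> M7
     \<and> (\<forall>i<7. \<forall>j<7. g (fs ! i) (fs ! j) = (if i = j then 1 else 0))"

definition vol_form :: "(vec \<Rightarrow> vec \<Rightarrow> real) \<Rightarrow> form \<Rightarrow> bool" where
  "vol_form g vol \<longleftrightarrow> is_form 7 vol \<and> (\<forall>fs. orthonormal g fs \<longrightarrow> vol fs = 1 \<or> vol fs = -1)"

text \<open>Induced inner product on k-forms (computed in any g-orthonormal basis).\<close>
definition form_inner :: "(vec \<Rightarrow> vec \<Rightarrow> real) \<Rightarrow> nat \<Rightarrow> form \<Rightarrow> form \<Rightarrow> real" where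
  "form_inner g k \<alpha> \<beta> = (let fs = (SOME fs. orthonormal g fs) in
     (\<Sum>is\<in>{is. length is = k \<and> set is \<subseteq> {..<7}}.
        \<alpha> (map (\<lambda>i. fs ! i) is) * \<beta> (map (\<lambda>i. fs ! i) is)) / fact k)"

definition hodge :: "(vec \<Rightarrow> vec \<Rightarrow> real) \<Rightarrow> form \<Rightarrow> nat \<Rightarrow> form \<Rightarrow> form" where
  "hodge g vol k \<alpha> = (THE \<beta>. is_form (7 - k) \<beta> \<and>
     (\<forall>\<gamma>. is_form k \<gamma> \<longrightarrow> wedge k (7 - k) \<gamma> \<beta> = (\<lambda>xs. form_inner g k \<gamma> \<alpha> * vol xs)))"

definition g2_compat :: "form \<Rightarrow> (vec \<Rightarrow> vec \<Rightarrow> real) \<Rightarrow> form \<Rightarrow> bool" where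
  "g2_compat \<phi> g vol \<longleftrightarrow> (\<forall>X\<in>M7. \<forall>Y\<in>M7.
     (\<lambda>xs. (1/6) * wedge 4 3 (wedge 2 2 (iota X \<phi>) (iota Y \<phi>)) \<phi> xs) = (\<lambda>xs. g X Y * vol xs))"

definition positive :: "form \<Rightarrow> bool" where
  "positive \<phi> \<longleftrightarrow> is_form 3 \<phi> \<and> (\<exists>g vol. inner_prod g \<and> vol_form g vol \<and> g2_compat \<phi> g vol)"

definition metvol :: "form \<Rightarrow> (vec \<Rightarrow> vec \<Rightarrow> real) \<times> form" where
  "metvol \<phi> = (THE p. case p of (g, vol) \<Rightarrow> inner_prod g \<and> vol_form g vol \<and> g2_compat \<phi> g vol)"

definition laplacian :: "form \<Rightarrow> form" where
  "laplacian \<phi> = (let s = hodge (fst (metvol \<phi>)) (snd (metvol \<phi>)) in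
     (\<lambda>xs. s 4 (dform 3 (s 4 (dform 3 \<phi>))) xs - dform 2 (s 5 (dform 4 (s 3 \<phi>))) xs))"

definition PosInv :: "form set" where
  "PosInv = {\<phi>. positive \<phi> \<and> invariant 3 \<phi>}"

definition orient_pres :: "form \<Rightarrow> bool" where
  "orient_pres \<phi> \<longleftrightarrow> (\<exists>c>0. snd (metvol (laplacian \<phi>)) = (\<lambda>xs. c * snd (metvol \<phi>) xs))"

definition omega :: form where
  "omega = (\<lambda>xs. eform [2,3] xs + eform [4,5] xs + eform [6,7] xs)"

definition VR :: form where
  "VR = (\<lambda>xs. eform [2,4,6] xs - eform [2,5,7] xs - eform [3,4,7] xs - eform [3,5,6] xs)"

definition VI :: form where
  "VI = (\<lambda>xs. eform [3,4,6] xs - eform [3,5,7] xs + eform [2,4,7] xs + eform [2,5,6] xs)"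

definition fp_form :: "real \<Rightarrow> real \<Rightarrow> real \<Rightarrow> real \<Rightarrow> form" where
  "fp_form a0 R0 \<sigma> \<alpha> = (\<lambda>xs. \<sigma> ^ 3 * a0 ^ 3 * wedge 1 2 (eform [1]) omega xs
        + R0 ^ 3 * cos \<alpha> * VR xs + R0 ^ 3 * sin \<alpha> * VI xs)"

end

theory Submission
  imports Defs "Jordan_Normal_Form.Determinant"
begin

text \<open>
  The invariant 3-forms are \<open>\<phi> = A e\<^sup>1 \<and> \<omega> + x V\<^sub>R + y V\<^sub>I\<close>: the diagonal matrices with entries in
  \<open>{1, -1, \<i>, -\<i>}\<close> and a cyclic permutation matrix already cut the 35 coefficients down to three.
  Writing \<open>x\<^sup>2 + y\<^sup>2 = R\<^sup>6\<close>, the cubic expression defining the metric gives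
  \<open>g = diag (A\<^sup>2/R\<^sup>4, R\<^sup>2, \<dots>, R\<^sup>2)\<close> with volume form \<open>A R\<^sup>4 e\<^sup>1\<^sup>\<dots>\<^sup>7\<close>, so \<open>\<phi>\<close> is positive iff
  \<open>A\<close> and \<open>(x, y)\<close> do not vanish. Every such form is coclosed, and \<open>* d\<close> is diagonal on
  \<open>e\<^sup>1 \<and> \<omega>\<close> and \<open>V\<^sub>R, V\<^sub>I\<close> with eigenvalues \<open>4A/(3R\<^sup>4)\<close> and \<open>12R\<^sup>2/A\<close>. Hence the Laplacian sends
  \<open>(A, x, y)\<close> to \<open>(16A\<^sup>3/(9R\<^sup>8), 144R\<^sup>4x/A\<^sup>2, 144R\<^sup>4y/A\<^sup>2)\<close>, a monomial map that is invertible
  because its exponent matrix is nonsingular; its fixed points have \<open>A = \<plusminus>192\<close> and \<open>R = 4\<close>.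
\<close>

subsection \<open>Determinants\<close>

text \<open>Two features of the definitions block direct computation. \<open>brm\<close>,
  \<open>adv\<close>, \<open>metvol\<close> and \<open>hodge\<close> take their value by
  \<open>THE\<close>, and \<open>form_inner\<close> takes a frame by \<open>SOME\<close>; each
  choice has to be replaced by a coordinate formula. And \<open>wedge\<close> runs over all
  permutations, 5040 in top degree; instead, wedge products of basis covectors become concatenated
  index lists, and forms are compared only on increasing lists of coordinate vectors. The constants
  come from the bracket: \<open>e_1\<close> has the eigenvalues 3i and -i, whose difference 4, once
  for each of three slots, gives 12; the \<open>e_1\<close> component gives d e^1 = (2/3) omega, and
  omega wedge omega is twice \<open>omega_sq\<close>, hence 4/3. The metric fixes the volume form
  only up to sign; the cubic identity then fixes size and sign together through an odd power. With
  r' the length of the new (x, y), the map from (log |A|, log R) to (log |A'|, log r') has linear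
  part with rows (3, -8) and (-2, 7), of determinant 5.\<close>

lemma ldet_eq_det: "ldet k M = det (mat k k (\<lambda>(i, j). M i j))"
proof -
  have "det (mat k k (\<lambda>(i, j). M i j)) = (\<Sum>p | p permutes {0..<k}. signof p * (\<Prod>i = 0..<k. M i (p i)))"
    by (subst det_def'[of _ k]) (auto intro!: sum.cong prod.cong simp: permutes_in_image)
  then show ?thesis
    by (simp add: ldet_def lessThan_atLeast0)
qed

lemma ldet_cong:
  "(\<And>i j. i < k \<Longrightarrow> j < k \<Longrightarrow> M i j = N i j) \<Longrightarrow> ldet k M = ldet k N"
  unfolding ldet_def
  by (intro sum.cong prod.cong arg_cong2[where f = "(*)"] refl)
     (auto simp: permutes_in_image[of _ "{..<k}", unfolded lessThan_iff])

lemma ldet_transpose: "ldet k (\<lambda>i j. M j i) = ldet k M"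
  unfolding ldet_eq_det
  by (subst (2) det_transpose[of _ k, symmetric])
     (auto intro!: arg_cong[where f = det] eq_matI)

lemma ldet_row_linear:
  assumes "i < k"
  shows "ldet k (\<lambda>a b. if a = i then c * u b + d * w b else M a b)
       = c * ldet k (\<lambda>a b. if a = i then u b else M a b) + d * ldet k (\<lambda>a b. if a = i then w b else M a b)"
proof -
  have split: "(\<Prod>a<k. if a = i then f (p a) else M a (p a)) = f (p i) * (\<Prod>a\<in>{..<k} - {i}. M a (p a))"
      for f p
    using assms by (subst prod.remove[of _ i]) (auto intro!: prod.cong)
  show ?thesis
    unfolding ldet_def sum_distrib_left sum.distrib[symmetric]
    by (intro sum.cong refl) (simp add: split[of "\<lambda>b. c * u b
        + d * w b"] split[of u] split[of w] algebra_simps)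
qed

lemma ldet_identical_rows:
  assumes "i < k" "j < k" "i \<noteq> j" "\<And>b. b < k \<Longrightarrow> M i b = M j b"
  shows "ldet k M = 0"
  unfolding ldet_eq_det
  by (rule det_identical_rows[of _ k i j]) (use assms in \<open>auto intro!: eq_vecI\<close>)

lemma ldet_permute_rows:
  assumes "p permutes {..<k}"
  shows "ldet k (\<lambda>i j. M (p i) j) = of_int (sign p) * ldet k M"
proof -
  have p: "p permutes {0..<k}" using assms by (simp add: lessThan_atLeast0)
  have "mat k k (\<lambda>(i, j). M (p i) j) = mat k k (\<lambda>(i, j). mat k k (\<lambda>(i, j). M i j) $$ (p i, j))"
    using p by (intro eq_matI) (auto simp: permutes_in_image)
  then show ?thesis
    unfolding ldet_eq_det using det_permute_rows[of "mat k k (\<lambda>(i, j). M i j)" k p] p by simp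
qed

lemma ldet_mult:
  "ldet k (\<lambda>i j. \<Sum>l<k. M i l * N l j) = ldet k M * ldet k N"
  unfolding ldet_eq_det
  by (subst det_mult[symmetric, of _ k])
     (auto intro!: arg_cong[where f = det] eq_matI simp: scalar_prod_def lessThan_atLeast0)

lemma ldet_Suc:
  "ldet (Suc k) M = (\<Sum>i<Suc k. (-1) ^ i * M i 0 * ldet k (\<lambda>a b. M (if a < i then a else Suc a) (Suc b)))"
proof -
  let ?A = "mat (Suc k) (Suc k) (\<lambda>(i, j). M i j)"
  have "det ?A = (\<Sum>i<Suc k. ?A $$ (i, 0) * cofactor ?A i 0)"
    by (rule laplace_expansion_column) auto
  also have "\<dots> = (\<Sum>i<Suc k. (-1) ^ i * M i 0 * ldet k (\<lambda>a b. M (if a < i then a else Suc a) (Suc b)))"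
  proof (intro sum.cong refl)
    fix i assume "i \<in> {..<Suc k}"
    moreover have "mat_delete ?A i 0 = mat k k (\<lambda>(a, b). M (if a < i then a else Suc a) (Suc b))"
      using \<open>i \<in> _\<close> by (auto simp: mat_delete_def intro!: eq_matI)
    ultimately show "?A $$ (i, 0) * cofactor ?A i 0
        = (-1) ^ i * M i 0 * ldet k (\<lambda>a b. M (if a < i then a else Suc a) (Suc b))"
      by (simp add: cofactor_def ldet_eq_det)
  qed
  finally show ?thesis by (simp add: ldet_eq_det)
qed

lemma ldet_0: "ldet 0 M = 1"
  by (simp add: ldet_def)

subsection \<open>Alternating forms on basis vectors\<close>

definition basis_vec :: "nat \<Rightarrow> Defs.vec" where
  "basis_vec n = (\<lambda>m. if m = n then 1 else 0)"

lemma basis_vec_M7: "basis_vec n \<in> M7 \<longleftrightarrow> n \<in> {1..7}"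
  by (auto simp: basis_vec_def M7_def)

lemma basis_vec_image_M7: "set ns \<subseteq> {1..7} \<Longrightarrow> set (map basis_vec ns) \<subseteq> M7"
  using basis_vec_M7 by auto

lemma lin_M7: "u \<in> M7 \<Longrightarrow> w \<in> M7 \<Longrightarrow> lin a u b w \<in> M7"
  by (auto simp: M7_def lin_def)

lemma linear_functional_expand:
  assumes L: "\<And>u w a b. u \<in> M7 \<Longrightarrow> w \<in> M7 \<Longrightarrow> L (lin a u b w) = a * L u + b * L w" and X: "X \<in> M7"
  shows "L X = (\<Sum>n\<in>{1..7}. X n * (L (basis_vec n) :: real))"
proof -
  have "L (\<lambda>n. if n \<le> m then X n else 0) = (\<Sum>n\<in>{1..m}. X n * L (basis_vec n))" if "m \<le> 7" for m
    using that
  proof (induction m)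
    case 0
    \<comment> \<open>The zero vector is \<open>lin 0 X 0 X\<close>, so linearity alone gives it the
      value 0.\<close>
    have "(\<lambda>n. if n \<le> 0 then X n else 0) = lin 0 X 0 X"
      using X by (auto simp: lin_def M7_def)
    then show ?case using L[OF X X, of 0 0] by simp
  next
    case (Suc m)
    let ?T = "\<lambda>n. if n \<le> m then X n else 0"
    have "(\<lambda>n. if n \<le> Suc m then X n else 0) = lin 1 ?T (X (Suc m)) (basis_vec (Suc m))"
      by (auto simp: lin_def basis_vec_def fun_eq_iff le_Suc_eq)
    moreover have "?T \<in> M7" "basis_vec (Suc m) \<in> M7"
      using X Suc.prems unfolding basis_vec_M7 by (auto simp: M7_def)
    ultimately show ?case using L[of ?T "basis_vec (Suc m)"] Suc by simp
  qed
  from this[of 7] have "L (\<lambda>n. if n \<le> 7 then X n else 0) = (\<Sum>n\<in>{1..7}. X n * L (basis_vec n))" by simp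
  moreover have "(\<lambda>n. if n \<le> 7 then X n else 0) = X"
    using X by (auto simp: M7_def)
  ultimately show ?thesis by simp
qed

lemma is_formD0: "is_form k \<alpha> \<Longrightarrow> \<not> (length xs = k \<and> set xs \<subseteq> M7) \<Longrightarrow> \<alpha> xs = 0"
  unfolding is_form_def by blast

lemma is_form_lin_slot:
  "is_form k \<alpha> \<Longrightarrow> length xs = k \<Longrightarrow> set xs \<subseteq> M7 \<Longrightarrow> i < k \<Longrightarrow> u \<in> M7 \<Longrightarrow> w \<in> M7 \<Longrightarrow>
     \<alpha> (xs[i := lin a u b w]) = a * \<alpha> (xs[i := u]) + b * \<alpha> (xs[i := w])"
  unfolding is_form_def by blast

lemma is_form_eq_slots:
  "is_form k \<alpha> \<Longrightarrow> length xs = k \<Longrightarrow> set xs \<subseteq> M7 \<Longrightarrow> i < k \<Longrightarrow> j < k \<Longrightarrow> i \<noteq> j \<Longrightarrow> xs ! i = xs ! j \<Longrightarrow> \<alpha> xs = 0"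
  unfolding is_form_def by blast

lemma is_formI:
  assumes "\<And>xs. \<not> (length xs = k \<and> set xs \<subseteq> M7) \<Longrightarrow> \<alpha> xs = 0"
    and "\<And>xs i u w a b. length xs = k \<Longrightarrow> set xs \<subseteq> M7 \<Longrightarrow> i < k \<Longrightarrow> u \<in> M7 \<Longrightarrow> w \<in> M7 \<Longrightarrow>
        \<alpha> (xs[i := lin a u b w]) = a * \<alpha> (xs[i := u]) + b * \<alpha> (xs[i := w])"
    and "\<And>xs i j. length xs = k \<Longrightarrow> set xs \<subseteq> M7 \<Longrightarrow> i < k \<Longrightarrow> j < k \<Longrightarrow> i \<noteq> j \<Longrightarrow> xs ! i = xs ! j \<Longrightarrow> \<alpha> xs = 0"
  shows "is_form k \<alpha>"
  using assms unfolding is_form_def by blast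

lemma is_form_lin:
  assumes "is_form k \<alpha>" "is_form k \<beta>"
  shows "is_form k (\<lambda>xs. a * \<alpha> xs + b * \<beta> xs)"
proof (rule is_formI)
  show "a * \<alpha> xs + b * \<beta> xs = 0" if "\<not> (length xs = k \<and> set xs \<subseteq> M7)" for xs
    using that is_formD0[OF assms(1)] is_formD0[OF assms(2)] by simp
  show "a * \<alpha> (xs[i := lin c u d w]) + b * \<beta> (xs[i := lin c u d w])
      = c * (a * \<alpha> (xs[i := u]) + b * \<beta> (xs[i := u])) + d * (a * \<alpha> (xs[i := w]) + b * \<beta> (xs[i := w]))"
    if "length xs = k" "set xs \<subseteq> M7" "i < k" "u \<in> M7" "w \<in> M7" for xs i u w c d
    using is_form_lin_slot[OF assms(1) that, of c d] is_form_lin_slot[OF assms(2) that, of c d]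
    by (simp add: algebra_simps)
  show "a * \<alpha> xs + b * \<beta> xs = 0" if "length xs = k" "set xs \<subseteq> M7" "i < k" "j < k" "i \<noteq> j" "xs ! i
      = xs ! j" for xs i j
    using is_form_eq_slots[OF assms(1) that] is_form_eq_slots[OF assms(2) that] by simp
qed

lemma is_form_zero: "is_form k (\<lambda>xs. 0)"
  by (rule is_formI) auto

lemma is_form_scale: "is_form k \<alpha> \<Longrightarrow> is_form k (\<lambda>xs. a * \<alpha> xs)"
  using is_form_lin[of k \<alpha> \<alpha> a 0] by simp

lemma is_form_add: "is_form k \<alpha> \<Longrightarrow> is_form k \<beta> \<Longrightarrow> is_form k (\<lambda>xs. \<alpha> xs + \<beta> xs)"
  using is_form_lin[of k \<alpha> \<beta> 1 1] by simp

lemma is_form_diff: "is_form k \<alpha> \<Longrightarrow> is_form k \<beta> \<Longrightarrow> is_form k (\<lambda>xs. \<alpha> xs - \<beta> xs)"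
  using is_form_lin[of k \<alpha> \<beta> 1 "-1"] by simp

lemma is_form_sum:
  "finite S \<Longrightarrow> (\<And>s. s \<in> S \<Longrightarrow> is_form k (\<alpha> s)) \<Longrightarrow> is_form k (\<lambda>xs. \<Sum>s\<in>S. \<alpha> s xs)"
  by (induction S rule: finite_induct) (auto intro: is_form_zero is_form_add)

lemma is_form_eform: "is_form (length I) (eform I)"
proof (rule is_formI)
  let ?k = "length I"
  show "eform I xs = 0" if "\<not> (length xs = ?k \<and> set xs \<subseteq> M7)" for xs
    using that by (auto simp: eform_def restr_def)
  fix xs :: "Defs.vec list" and i
  assume xs: "length xs = ?k" "set xs \<subseteq> M7" and i: "i < ?k"
  show "eform I (xs[i := lin a u b w]) = a * eform I (xs[i := u]) + b * eform I (xs[i := w])"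
    if u: "u \<in> M7" "w \<in> M7" for u w a b
  proof -
    have upd: "eform I (xs[i := v]) = ldet ?k (\<lambda>c d. if c = i then v (I ! d) else (xs ! c) (I ! d))"
        if "v \<in> M7" for v
      using that xs i set_update_subset_insert[of xs i v]
      by (auto simp: eform_def restr_def nth_list_update intro!: ldet_cong)
    show ?thesis
      unfolding upd[OF u(1)] upd[OF u(2)] upd[OF lin_M7[OF u]]
      unfolding lin_def by (rule ldet_row_linear[OF i])
  qed
  show "eform I xs = 0" if "j < ?k" "i \<noteq> j" "xs ! i = xs ! j" for j
    using xs i that by (auto simp: eform_def restr_def intro: ldet_identical_rows[of i _ j])
qed

lemma is_form_iota:
  assumes "is_form (Suc k) \<alpha>" "X \<in> M7"
  shows "is_form k (iota X \<alpha>)"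
proof (rule is_formI)
  show "iota X \<alpha> xs = 0" if "\<not> (length xs = k \<and> set xs \<subseteq> M7)" for xs
    unfolding iota_def by (rule is_formD0[OF assms(1)]) (use that in auto)
  show "iota X \<alpha> (xs[i := lin a u b w]) = a * iota X \<alpha> (xs[i := u]) + b * iota X \<alpha> (xs[i := w])"
    if "length xs = k" "set xs \<subseteq> M7" "i < k" "u \<in> M7" "w \<in> M7" for xs i u w a b
    using is_form_lin_slot[OF assms(1), of "X # xs" "Suc i" u w a b] that assms(2) by (simp add: iota_def)
  show "iota X \<alpha> xs = 0" if "length xs = k" "set xs \<subseteq> M7" "i < k" "j < k" "i \<noteq> j" "xs ! i = xs ! j"
      for xs i j
    using is_form_eq_slots[OF assms(1), of "X # xs" "Suc i" "Suc j"] that assms(2) by (simp add: iota_def)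
qed

lemma form_lin_head:
  assumes "is_form (Suc k) \<alpha>" "length xs = k" "set xs \<subseteq> M7" "u \<in> M7" "w \<in> M7"
  shows "\<alpha> (lin a u b w # xs) = a * \<alpha> (u # xs) + b * \<alpha> (w # xs)"
  using is_form_lin_slot[OF assms(1), of "u # xs" 0 u w a b] assms by simp

lemma form_expand_head:
  assumes "is_form (Suc k) \<alpha>" "length xs = k" "set xs \<subseteq> M7" "X \<in> M7"
  shows "\<alpha> (X # xs) = (\<Sum>n\<in>{1..7}. X n * \<alpha> (basis_vec n # xs))"
  by (rule linear_functional_expand[where L = "\<lambda>X. \<alpha> (X # xs)"])
     (use form_lin_head[OF assms(1-3)] assms(4) in auto)

text \<open>Induction on the degree: contraction with a coordinate vector lowers it, and linearity
  in the first slot reduces an arbitrary first argument to coordinate vectors.\<close>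

lemma form_ext_basis:
  assumes "is_form k \<alpha>" "is_form k \<beta>"
    and "\<And>ns. length ns = k \<Longrightarrow> set ns \<subseteq> {1..7} \<Longrightarrow> \<alpha> (map basis_vec ns) = \<beta> (map basis_vec ns)"
  shows "\<alpha> = \<beta>"
  using assms
proof (induction k arbitrary: \<alpha> \<beta>)
  case 0
  show ?case
  proof
    fix xs show "\<alpha> xs = \<beta> xs"
      using is_formD0[OF 0(1), of xs] is_formD0[OF 0(2), of xs] 0(3)[of "[]"] by (cases xs) auto
  qed
next
  case (Suc k)
  have iota_eq: "iota (basis_vec n) \<alpha> = iota (basis_vec n) \<beta>" if n: "n \<in> {1..7}" for n
  proof (rule Suc.IH)
    show "is_form k (iota (basis_vec n) \<alpha>)" "is_form k (iota (basis_vec n) \<beta>)"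
      using is_form_iota[OF Suc.prems(1)] is_form_iota[OF Suc.prems(2)] n basis_vec_M7 by blast+
    show "iota (basis_vec n) \<alpha> (map basis_vec ns) = iota (basis_vec n) \<beta> (map basis_vec ns)"
        if "length ns = k" "set ns \<subseteq> {1..7}" for ns
      using Suc.prems(3)[of "n # ns"] that n by (simp add: iota_def)
  qed
  show ?case
  proof
    fix xs show "\<alpha> xs = \<beta> xs"
    proof (cases "length xs = Suc k \<and> set xs \<subseteq> M7")
      case True
      then obtain X ys where xs: "xs = X # ys" "length ys = k" "set ys \<subseteq> M7" "X \<in> M7"
        by (cases xs) auto
      have "\<alpha> (basis_vec n # ys) = \<beta> (basis_vec n # ys)" if "n \<in> {1..7}" for n
        using iota_eq[OF that] by (metis iota_def)
      then show ?thesis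
        unfolding xs(1) form_expand_head[OF Suc.prems(1) xs(2-4)] form_expand_head[OF Suc.prems(2) xs(2-4)]
        by simp
    qed (use is_formD0[OF Suc.prems(1)] is_formD0[OF Suc.prems(2)] in simp)
  qed
qed

text \<open>Polarisation: the form vanishes with the sum of both entries in both slots, and so do
  the two diagonal terms of the expansion, which leaves two terms that cancel.\<close>

lemma form_swap:
  assumes f: "is_form k \<alpha>" and xs: "length xs = k" "set xs \<subseteq> M7" and ij: "i < k" "j < k" "i \<noteq> j"
  shows "\<alpha> (xs[i := xs ! j, j := xs ! i]) = - \<alpha> xs"
proof -
  let ?u = "xs ! i" and ?w = "xs ! j"
  have uw: "?u \<in> M7" "?w \<in> M7" using xs ij by auto
  let ?F = "\<lambda>v w. \<alpha> (xs[i := v, j := w])"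
  have upd: "length (xs[i := v]) = k" "set (xs[i := v]) \<subseteq> M7" if "v \<in> M7" for v
    using xs that set_update_subset_insert[of xs i v] by auto
  have upd2: "length (xs[j := v]) = k" "set (xs[j := v]) \<subseteq> M7" if "v \<in> M7" for v
    using xs that set_update_subset_insert[of xs j v] by auto
  have diag: "?F v v = 0" if "v \<in> M7" for v
    by (rule is_form_eq_slots[OF f, of _ i j])
       (use upd[OF that] that ij set_update_subset_insert[of "xs[i := v]" j v] in auto)
  have r: "?F v (lin 1 ?u 1 ?w) = ?F v ?u + ?F v ?w" if "v \<in> M7" for v
    using is_form_lin_slot[OF f upd[OF that] ij(2) uw, of 1 1] by simp
  have l: "?F (lin 1 ?u 1 ?w) v = ?F ?u v + ?F ?w v" if "v \<in> M7" for v
    using is_form_lin_slot[OF f upd2[OF that] ij(1) uw, of 1 1]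
    unfolding list_update_swap[OF ij(3)] by (simp only: mult_1)
  have "0 = ?F (lin 1 ?u 1 ?w) (lin 1 ?u 1 ?w)"
    using diag lin_M7[OF uw] by simp
  also have "\<dots> = ?F ?u ?w + ?F ?w ?u"
    using l[OF lin_M7[OF uw, of 1 1]] r[OF uw(1)] r[OF uw(2)] diag[OF uw(1)] diag[OF uw(2)] by linarith
  finally show ?thesis by simp
qed

lemma permute_list_transpose_comp:
  assumes "p permutes {..<length xs}" "a < length xs" "b < length xs" "a \<noteq> b"
  shows "permute_list (transpose a b \<circ> p) xs = permute_list p (xs[a := xs ! b, b := xs ! a])"
  using assms
  by (intro nth_equalityI) (auto simp: permute_list_def transpose_def nth_list_update)

text \<open>A permutation is built up from transpositions, and each of them contributes one sign by
  \<open>form_swap\<close>.\<close>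

lemma form_permute:
  assumes f: "is_form k \<alpha>" and xs: "length xs = k" "set xs \<subseteq> M7" and p: "p permutes {..<k}"
  shows "\<alpha> (permute_list p xs) = of_int (sign p) * \<alpha> xs"
  using p finite_lessThan[of k] xs
proof (induction p arbitrary: xs rule: permutes_induct)
  case (swap a b p)
  let ?ys = "xs[a := xs ! b, b := xs ! a]"
  have ys: "length ?ys = k" "set ?ys \<subseteq> M7"
    using swap set_swap[of a xs b] by auto
  have "\<alpha> (permute_list (transpose a b \<circ> p) xs) = \<alpha> (permute_list p ?ys)"
    using swap by (subst permute_list_transpose_comp) auto
  also have "\<dots> = of_int (sign p) * (- \<alpha> xs)"
    using swap.IH[OF ys] form_swap[OF f swap.prems(1,2), of a b] swap by simp
  also have "\<dots> = of_int (sign (transpose a b \<circ> p)) * \<alpha> xs"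
    using swap by (subst sign_compose) (auto simp: sign_swap_id permutation_swap_id intro:
        permutation_permutes[THEN iffD2])
  finally show ?case .
qed simp

text \<open>One increasing list for each k-element subset of \<open>{1..7}\<close>; these label the
  standard basis \<open>eform I\<close> of the k-forms.\<close>

definition sorted_lists :: "nat \<Rightarrow> nat list set" where
  "sorted_lists k = {I. sorted_wrt (<) I \<and> set I \<subseteq> {1..7} \<and> length I = k}"

lemma finite_sorted_lists: "finite (sorted_lists k)"
  by (rule finite_subset[OF _ finite_lists_length_eq[of "{1..7}" k]]) (auto simp: sorted_lists_def)

lemma sorted_lists_distinct: "I \<in> sorted_lists k \<Longrightarrow> distinct I"
  by (auto simp: sorted_lists_def strict_sorted_iff)

text \<open>Sorting a repetition-free list of coordinate vectors changes both forms by the same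
  sign, and a repetition makes both vanish, so increasing lists suffice.\<close>

lemma form_ext:
  assumes f: "is_form k \<alpha>" "is_form k \<beta>"
    and eq: "\<And>I. I \<in> sorted_lists k \<Longrightarrow> \<alpha> (map basis_vec I) = \<beta> (map basis_vec I)"
  shows "\<alpha> = \<beta>"
proof (rule form_ext_basis[OF f])
  fix ns :: "nat list" assume ns: "length ns = k" "set ns \<subseteq> {1..7}"
  show "\<alpha> (map basis_vec ns) = \<beta> (map basis_vec ns)"
  proof (cases "distinct ns")
    case True
    then have I: "sort ns \<in> sorted_lists k" using ns by (auto simp: sorted_lists_def strict_sorted_iff)
    obtain p where p: "p permutes {..<k}" "permute_list p (sort ns) = ns"
      using mset_eq_permutation[of ns "sort ns"] ns by auto
    have m: "map basis_vec ns = permute_list p (map basis_vec (sort ns))"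
      using p ns by (simp add: permute_list_map)
    have M: "set (map basis_vec (sort ns)) \<subseteq> M7" "length (map basis_vec (sort ns)) = k"
      using ns basis_vec_M7 by auto
    show ?thesis
      unfolding m form_permute[OF f(1) M(2,1) p(1)] form_permute[OF f(2) M(2,1) p(1)] eq[OF I] ..
  next
    case False
    then obtain i j where "i < k" "j < k" "i \<noteq> j" "map basis_vec ns ! i = map basis_vec ns ! j"
      using ns by (auto simp: distinct_conv_nth)
    then show ?thesis
      using is_form_eq_slots[OF f(1), of "map basis_vec ns" i j] is_form_eq_slots[OF f(2), of "map
          basis_vec ns" i j] ns basis_vec_image_M7
      by auto
  qed
qed

lemma eform_basis:
  assumes "I \<in> sorted_lists k" "J \<in> sorted_lists k"
  shows "eform I (map basis_vec J) = (if I = J then 1 else 0)"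
proof -
  have IJ: "length I = k" "length J = k" "set J \<subseteq> {1..7}" "distinct I" "distinct J"
    using assms sorted_lists_distinct by (auto simp: sorted_lists_def)
  have e: "eform I (map basis_vec J) = ldet k (\<lambda>a b. if I ! b = J ! a then 1 else 0)"
    using IJ basis_vec_image_M7[OF IJ(3)] by (auto simp: eform_def restr_def basis_vec_def intro!:
        ldet_cong)
  show ?thesis
  proof (cases "I = J")
    case True
    have "ldet k (\<lambda>a b. if I ! b = J ! a then 1 else 0) = ldet k (\<lambda>a b. if a = b then 1 else (0::real))"
      using True IJ by (intro ldet_cong) (auto simp: nth_eq_iff_index_eq)
    also have "\<dots> = 1"
      unfolding ldet_eq_det using det_one[of k] unfolding one_mat_def by simp
    finally show ?thesis using e True by simp
  next
    case False
    have "set J \<noteq> set I"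
      using assms False by (auto simp: sorted_lists_def strict_sorted_iff dest: sorted_distinct_set_unique)
    then have "\<not> set J \<subseteq> set I"
      using card_subset_eq[of "set I" "set J"] distinct_card[OF IJ(4)] distinct_card[OF IJ(5)] IJ by auto
    \<comment> \<open>The row of \<open>J ! a\<close> in the 0-1 matrix is zero, so every term of
      the Leibniz sum has a vanishing factor.\<close>
    then obtain a where a: "a < k" "J ! a \<notin> set I" using IJ by (auto simp: in_set_conv_nth subset_iff)
    have "(\<Prod>i<k. if I ! p i = J ! i then 1 else (0::real)) = 0" if "p permutes {..<k}" for p
    proof (rule prod_zero)
      have "p a < k" using that a by (simp add: permutes_in_image[of p "{..<k}", unfolded lessThan_iff])
      then show "\<exists>i\<in>{..<k}. (if I ! p i = J ! i then 1 else (0::real)) = 0"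
        using a IJ by (intro bexI[of _ a]) (auto, metis nth_mem)
    qed simp
    then have "ldet k (\<lambda>a b. if I ! b = J ! a then 1 else (0::real)) = 0"
      unfolding ldet_def by (intro sum.neutral) (metis (no_types, lifting) mem_Collect_eq mult_zero_right)
    then show ?thesis using e False by simp
  qed
qed

lemma eform_sorted_lists: "I \<in> sorted_lists k \<Longrightarrow> is_form k (eform I)"
  using is_form_eform[of I] by (auto simp: sorted_lists_def)

lemma form_expand:
  assumes "is_form k \<alpha>"
  shows "\<alpha> = (\<lambda>xs. \<Sum>I\<in>sorted_lists k. \<alpha> (map basis_vec I) * eform I xs)"
proof (rule form_ext[OF assms])
  show "is_form k (\<lambda>xs. \<Sum>I\<in>sorted_lists k. \<alpha> (map basis_vec I) * eform I xs)"
    by (intro is_form_sum is_form_scale eform_sorted_lists finite_sorted_lists)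
  show "\<alpha> (map basis_vec J) = (\<Sum>I\<in>sorted_lists k. \<alpha> (map basis_vec I) * eform I (map basis_vec J))"
      if "J \<in> sorted_lists k" for J
  proof -
    have "(\<Sum>I\<in>sorted_lists k. \<alpha> (map basis_vec I) * eform I (map basis_vec J))
        = (\<Sum>I\<in>sorted_lists k. if I = J then \<alpha> (map basis_vec J) else 0)"
      using that by (intro sum.cong refl) (simp add: eform_basis)
    then show ?thesis using that by (simp add: finite_sorted_lists)
  qed
qed

subsection \<open>Wedge products\<close>

text \<open>Expanding the two small determinants gives one sum over p for each pair (q, r) of block
  permutations. Such a pair acts as a single permutation of all indices and can be absorbed into p,
  so every pair contributes the full determinant. The number of pairs is what the normalisation in
  \<open>wedge\<close> divides by.\<close>

lemma sum_permutes_ldet_blocks: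
  fixes N :: "nat \<Rightarrow> nat \<Rightarrow> real"
  shows "(\<Sum>p | p permutes {..<k + l}. of_int (sign p) * ldet k (\<lambda>a b. N (p a) b) * ldet l (\<lambda>a b. N (p
      (k + a)) (k + b)))
       = fact k * fact l * ldet (k + l) N"
proof -
  let ?K = "{q. q permutes {..<k}}" and ?L = "{r. r permutes {..<l}}" and ?P = "{p. p permutes {..<k + l}}"
  have key: "of_int (sign q) * of_int (sign r) *
      (\<Sum>p\<in>?P. of_int (sign p) * ((\<Prod>a<k. N (p a) (q a)) * (\<Prod>a<l. N (p (k + a)) (k + r a)))) = ldet (k + l) N"
    if q: "q permutes {..<k}" and r: "r permutes {..<l}" for q r
  proof -
    \<comment> \<open>The permutation r moved to the second block of indices; q and r' have disjoint
      supports.\<close>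
    define r' where "r' = map_permutation {..<l} ((+) k) r"
    have "bij_betw ((+) k) {..<l} {k..<k + l}"
      by (auto simp: bij_betw_def lessThan_atLeast0)
    then have r'p: "r' permutes {k..<k + l}"
      unfolding r'_def using r by (rule map_permutation_permutes)
    have r'n: "r' permutes {..<k + l}" by (rule permutes_subset[OF r'p]) auto
    have qn: "q permutes {..<k + l}" by (rule permutes_subset[OF q]) auto
    have r'_sign: "sign r' = sign r"
      unfolding r'_def by (rule sign_map_permutation) (use r in auto)
    have s: "(q \<circ> r') permutes {..<k + l}"
      using r'n qn by (rule permutes_compose)
    have sgn: "sign (q \<circ> r') = sign q * sign r"
      using sign_compose[of q r'] qn r'n r'_sign permutation_permutes[of q] permutation_permutes[of
          r'] by auto
    have lo: "(q \<circ> r') a = q a" if "a < k" for a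
      using permutes_not_in[OF r'p, of a] that by simp
    have hi: "(q \<circ> r') (k + a) = k + r a" if "a < l" for a
    proof -
      have "r' (k + a) = k + r a"
        unfolding r'_def using map_permutation_apply[of "(+) k" "{..<l}" a r] that by simp
      then show ?thesis using permutes_not_in[OF q, of "k + r a"] by simp
    qed
    have "(\<Prod>a<k. N (p a) (q a)) * (\<Prod>a<l. N (p (k + a)) (k + r a)) = (\<Prod>i<k + l. N (p i) ((q \<circ> r') i))" for p
      unfolding lessThan_atLeast0
    proof -
      have "(\<Prod>i = 0..<k + l. N (p i) ((q \<circ> r') i)) =
        (\<Prod>i = 0..<k. N (p i) ((q \<circ> r') i)) * (\<Prod>i = k..<k + l. N (p i) ((q \<circ> r') i))"
        by (rule prod.atLeastLessThan_concat[symmetric]) auto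
      also have "(\<Prod>i = k..<k + l. N (p i) ((q \<circ> r') i)) = (\<Prod>i = 0..<l. N (p (k + i)) ((q \<circ> r') (k + i)))"
        using prod.shift_bounds_nat_ivl[of "\<lambda>i. N (p i) ((q \<circ> r') i)" 0 k l] by (simp add: add.commute)
      finally show "(\<Prod>a = 0..<k. N (p a) (q a)) * (\<Prod>a = 0..<l. N (p (k + a)) (k + r a)) = (\<Prod>i = 0..<k
          + l. N (p i) ((q \<circ> r') i))"
        using lo hi by simp
    qed
    then have "(\<Sum>p\<in>?P. of_int (sign p) * ((\<Prod>a<k. N (p a) (q a)) * (\<Prod>a<l. N (p (k + a)) (k + r a))))
        = ldet (k + l) (\<lambda>i j. N j ((q \<circ> r') i))"
      by (simp add: ldet_def)
    also have "\<dots> = of_int (sign (q \<circ> r')) * ldet (k + l) N"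
      using ldet_permute_rows[OF s, of "\<lambda>i j. N j i"] ldet_transpose[of "k + l" N] by simp
    finally have "of_int (sign q) * of_int (sign r) * (\<Sum>p\<in>?P. of_int (sign p) * ((\<Prod>a<k. N (p a) (q a))
        * (\<Prod>a<l. N (p (k + a)) (k + r a))))
        = of_int ((sign q * sign q) * (sign r * sign r)) * ldet (k + l) N"
      by (simp only: sgn of_int_mult mult_ac)
    then show ?thesis by simp
  qed
  have "(\<Sum>p\<in>?P. of_int (sign p) * ldet k (\<lambda>a b. N (p a) b) * ldet l (\<lambda>a b. N (p (k + a)) (k + b)))
      = (\<Sum>p\<in>?P. \<Sum>q\<in>?K. \<Sum>r\<in>?L. of_int (sign q) * of_int (sign r) *
           (of_int (sign p) * ((\<Prod>a<k. N (p a) (q a)) * (\<Prod>a<l. N (p (k + a)) (k + r a)))))"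
    unfolding ldet_def
    by (intro sum.cong refl) (subst mult.assoc, subst sum_product, simp only: sum_distrib_left mult_ac)
  also have "\<dots> = (\<Sum>q\<in>?K. \<Sum>r\<in>?L. \<Sum>p\<in>?P. of_int (sign q) * of_int (sign r) *
           (of_int (sign p) * ((\<Prod>a<k. N (p a) (q a)) * (\<Prod>a<l. N (p (k + a)) (k + r a)))))"
    by (rule trans[OF sum.swap]) (intro sum.cong refl sum.swap)
  also have "\<dots> = (\<Sum>q\<in>?K. \<Sum>r\<in>?L. ldet (k + l) N)"
    by (intro sum.cong refl) (simp only: sum_distrib_left[symmetric] key mem_Collect_eq)
  also have "\<dots> = fact k * fact l * ldet (k + l) N"
    using card_permutations[of "{..<k}" k] card_permutations[of "{..<l}" l] by simp
  finally show ?thesis .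
qed

text \<open>This makes \<open>wedge\<close> computable: later products are expanded by bilinearity
  into concatenated index lists, without unfolding the permutation sum.\<close>

lemma wedge_eform: "wedge (length I) (length J) (eform I) (eform J) = eform (I @ J)"
proof
  let ?k = "length I" and ?l = "length J"
  fix xs
  show "wedge ?k ?l (eform I) (eform J) xs = eform (I @ J) xs"
  proof (cases "length xs = ?k + ?l \<and> set xs \<subseteq> M7")
    case True
    let ?N = "\<lambda>i j. (xs ! i) ((I @ J) ! j)"
    have "eform I (map (\<lambda>i. xs ! p i) [0..<?k]) = ldet ?k (\<lambda>a b. ?N (p a) b)"
      "eform J (map (\<lambda>i. xs ! p i) [?k..<?k + ?l]) = ldet ?l (\<lambda>a b. ?N (p (?k + a)) (?k + b))"
      if p: "p permutes {..<?k + ?l}" for p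
    proof -
      have "xs ! p i \<in> M7" if "i < ?k + ?l" for i
        using True that permutes_in_image[OF p, of i] by (auto intro!: subsetD[OF conjunct2[OF True]])
      then have "set (map (\<lambda>i. xs ! p i) [0..<?k]) \<subseteq> M7" "set (map (\<lambda>i. xs ! p i) [?k..<?k + ?l]) \<subseteq> M7"
        by auto
      then show "eform I (map (\<lambda>i. xs ! p i) [0..<?k]) = ldet ?k (\<lambda>a b. ?N (p a) b)"
        "eform J (map (\<lambda>i. xs ! p i) [?k..<?k + ?l]) = ldet ?l (\<lambda>a b. ?N (p (?k + a)) (?k + b))"
        unfolding eform_def restr_def by (auto intro!: ldet_cong simp: nth_append)
    qed
    then have "wedge ?k ?l (eform I) (eform J) xs = (\<Sum>p | p permutes {..<?k + ?l}.
       of_int (sign p) * ldet ?k (\<lambda>a b. ?N (p a) b) * ldet ?l (\<lambda>a b. ?N (p (?k + a)) (?k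
           + b))) / (fact ?k * fact ?l)"
      unfolding wedge_def restr_def using True by simp
    also have "\<dots> = ldet (?k + ?l) ?N"
      by (subst sum_permutes_ldet_blocks) simp
    finally show ?thesis using True by (simp add: eform_def restr_def)
  qed (auto simp: wedge_def eform_def restr_def)
qed

lemma wedge_sum_left:
  "wedge k l (\<lambda>xs. \<Sum>s\<in>S. c s * \<alpha> s xs) \<beta> = (\<lambda>xs. \<Sum>s\<in>S. c s * wedge k l (\<alpha> s) \<beta> xs)"
proof
  fix xs
  show "wedge k l (\<lambda>xs. \<Sum>s\<in>S. c s * \<alpha> s xs) \<beta> xs = (\<Sum>s\<in>S. c s * wedge k l (\<alpha> s) \<beta> xs)"
  proof (cases "length xs = k + l \<and> set xs \<subseteq> M7")
    case True
    show ?thesis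
      unfolding wedge_def restr_def if_P[OF True]
      by (simp only: sum_distrib_left sum_distrib_right sum_divide_distrib times_divide_eq_right)
         (subst sum.swap, intro sum.cong refl, simp add: mult_ac)
  next
    case False
    show ?thesis unfolding wedge_def restr_def if_not_P[OF False] by simp
  qed
qed

lemma wedge_sum_right:
  "wedge k l \<alpha> (\<lambda>xs. \<Sum>s\<in>S. c s * \<beta> s xs) = (\<lambda>xs. \<Sum>s\<in>S. c s * wedge k l \<alpha> (\<beta> s) xs)"
proof
  fix xs
  show "wedge k l \<alpha> (\<lambda>xs. \<Sum>s\<in>S. c s * \<beta> s xs) xs = (\<Sum>s\<in>S. c s * wedge k l \<alpha> (\<beta> s) xs)"
  proof (cases "length xs = k + l \<and> set xs \<subseteq> M7")
    case True
    show ?thesis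
      unfolding wedge_def restr_def if_P[OF True]
      by (simp only: sum_distrib_left sum_distrib_right sum_divide_distrib times_divide_eq_right)
         (subst sum.swap, intro sum.cong refl, simp add: mult_ac)
  next
    case False
    show ?thesis unfolding wedge_def restr_def if_not_P[OF False] by simp
  qed
qed

lemma wedge_add_right: "wedge k l \<alpha> (\<lambda>xs. \<beta> xs + \<beta>' xs) = (\<lambda>xs. wedge k l \<alpha> \<beta> xs + wedge k l \<alpha> \<beta>' xs)"
  using wedge_sum_right[where S = "UNIV :: bool set" and c = "\<lambda>_. 1" and \<beta>
      = "\<lambda>s. if s then \<beta> else \<beta>'"] by (simp add: UNIV_bool add.commute)

lemma wedge_scale_right: "wedge k l \<alpha> (\<lambda>xs. c * \<beta> xs) = (\<lambda>xs. c * wedge k l \<alpha> \<beta> xs)"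
  using wedge_sum_right[where S = "{()}" and c = "\<lambda>_. c" and \<beta> = "\<lambda>_. \<beta>"] by simp

lemma wedge_expand:
  assumes "is_form k \<alpha>" "is_form l \<beta>"
  shows "wedge k l \<alpha> \<beta> = (\<lambda>xs. \<Sum>I\<in>sorted_lists k. \<alpha> (map basis_vec I) * (\<Sum>J\<in>sorted_lists l. \<beta> (map
      basis_vec J) * eform (I @ J) xs))"
proof -
  have "wedge k l \<alpha> \<beta> = wedge k l (\<lambda>xs. \<Sum>I\<in>sorted_lists k. \<alpha> (map basis_vec I) * eform I xs) (\<lambda>xs.
      \<Sum>J\<in>sorted_lists l. \<beta> (map basis_vec J) * eform J xs)"
    using form_expand[OF assms(1)] form_expand[OF assms(2)] by simp
  also have "\<dots> = (\<lambda>xs. \<Sum>I\<in>sorted_lists k. \<alpha> (map basis_vec I) * (\<Sum>J\<in>sorted_lists l. \<beta> (map basis_vec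
      J) * wedge k l (eform I) (eform J) xs))"
    unfolding wedge_sum_left wedge_sum_right ..
  also have "\<dots> = (\<lambda>xs. \<Sum>I\<in>sorted_lists k. \<alpha> (map basis_vec I) * (\<Sum>J\<in>sorted_lists l. \<beta> (map basis_vec
      J) * eform (I @ J) xs))"
    by (intro ext sum.cong refl arg_cong2[where f
        = "(*)"]) (auto simp: sorted_lists_def wedge_eform[symmetric])
  finally show ?thesis .
qed

lemma is_form_wedge:
  assumes "is_form k \<alpha>" "is_form l \<beta>"
  shows "is_form (k + l) (wedge k l \<alpha> \<beta>)"
proof -
  have "is_form (k + l) (eform (I @ J))" if "I \<in> sorted_lists k" "J \<in> sorted_lists l" for I J
    using is_form_eform[of "I @ J"] that by (auto simp: sorted_lists_def)
  then show ?thesis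
    unfolding wedge_expand[OF assms] by (intro is_form_sum is_form_scale finite_sorted_lists)
qed

section \<open>Reordering the indices of a basis covector product\<close>

lemma eform_permute:
  assumes "p permutes {..<length I}"
  shows "eform (permute_list p I) xs = of_int (sign p) * eform I xs"
proof -
  have "ldet (length I) (\<lambda>a b. (xs ! a) (permute_list p I ! b))
      = ldet (length I) (\<lambda>b a. (xs ! a) (I ! p b))"
    by (subst ldet_transpose[symmetric]) (auto intro!: ldet_cong simp: permute_list_nth[OF assms])
  also have "\<dots> = of_int (sign p) * ldet (length I) (\<lambda>a b. (xs ! a) (I ! b))"
    using ldet_permute_rows[OF assms, of "\<lambda>b a. (xs ! a) (I ! b)"] ldet_transpose[of "length I" "\<lambda>a b.
        (xs ! a) (I ! b)"] by simp
  finally show ?thesis by (auto simp: eform_def restr_def)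
qed

lemma eform_swap: "eform (P @ a # b # Q) xs = - eform (P @ b # a # Q) xs"
proof -
  let ?n = "length P" and ?I = "P @ b # a # Q"
  have p: "transpose ?n (Suc ?n) permutes {..<length ?I}"
    by (rule permutes_swap_id) auto
  have "permute_list (transpose ?n (Suc ?n)) ?I = P @ a # b # Q"
    by (rule nth_equalityI) (auto simp: permute_list_nth[OF p] transpose_def nth_append nth_Cons'
        split: if_splits)
  then show ?thesis
    using eform_permute[OF p, of xs] by (simp add: sign_swap_id)
qed

lemma eform_repeat: "eform (P @ a # a # Q) xs = 0"
  using eform_swap[of P a a Q xs] by simp

text \<open>Insertion sort that records the sign, so that the simplifier can evaluate signs of
  concrete index lists. The sign 0 marks a repeated index and survives all later products and sign
  changes.\<close>

fun signed_insert :: "nat \<Rightarrow> nat list \<Rightarrow> real \<times> nat list" where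
  "signed_insert a [] = (1, [a])"
| "signed_insert a (b # L) = (if a < b then (1, a # b # L) else if a = b then (0, a # b # L)
     else (case signed_insert a L of (s, M) \<Rightarrow> (- s, b # M)))"

fun signed_sort :: "nat list \<Rightarrow> real \<times> nat list" where
  "signed_sort [] = (1, [])"
| "signed_sort (a # L) = (case signed_sort L of (s, M) \<Rightarrow> case signed_insert a M of (t, M') \<Rightarrow> (s * t, M'))"

lemma eform_signed_insert: "signed_insert a L = (s, M) \<Longrightarrow> eform (P @ a # L) xs = s * eform (P @ M) xs"
proof (induction L arbitrary: P s M)
  case (Cons b L)
  show ?case
  proof (cases "a \<le> b")
    case True
    then show ?thesis using Cons.prems eform_repeat[of P a L xs] by (auto split: if_splits)
  next
    case False
    then obtain t N where t: "signed_insert a L = (t, N)" "s = - t" "M = b # N"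
      using Cons.prems by (auto split: prod.splits)
    then show ?thesis
      using Cons.IH[OF t(1), of "P @ [b]"] eform_swap[of P a b L xs] by simp
  qed
qed simp

lemma eform_signed_sort_aux: "signed_sort L = (s, M) \<Longrightarrow> eform (P @ L) xs = s * eform (P @ M) xs"
proof (induction L arbitrary: P s M)
  case (Cons a L)
  then obtain s' M' t where 1: "signed_sort L = (s', M')" "signed_insert a M' = (t, M)" "s = s' * t"
    by (auto split: prod.splits)
  then show ?case
    using Cons.IH[OF 1(1), of "P @ [a]"] eform_signed_insert[OF 1(2), of P xs] by simp
qed simp

lemma eform_signed_sort: "eform L xs = fst (signed_sort L) * eform (snd (signed_sort L)) xs"
  using eform_signed_sort_aux[of L "fst (signed_sort L)" "snd (signed_sort L)" "[]" xs] by simp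

subsection \<open>Diagonal metrics and their Hodge star\<close>

declare One_nat_def [simp del]

text \<open>The value 0 outside \<open>M7\<close> is what \<open>inner_prod\<close> demands; it
  allows metrics to be compared as functions.\<close>

definition diag_met :: "(nat \<Rightarrow> real) \<Rightarrow> Defs.vec \<Rightarrow> Defs.vec \<Rightarrow> real" where
  "diag_met D u v = (if u \<in> M7 \<and> v \<in> M7 then \<Sum>n\<in>{1..7}. D n * u n * v n else 0)"

lemma inner_prod_diag_met:
  assumes "\<forall>n\<in>{1..7}. D n > 0"
  shows "inner_prod (diag_met D)"
  unfolding inner_prod_def
proof (intro conjI allI impI ballI)
  show "diag_met D (lin a u b v) w = a * diag_met D u w + b * diag_met D v w"
    if "u \<in> M7 \<and> v \<in> M7 \<and> w \<in> M7" for u v w a b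
    using that lin_M7[of u v a b] unfolding diag_met_def
    by (simp add: lin_def algebra_simps sum.distrib sum_distrib_left)
  show "diag_met D v v > 0" if v: "v \<in> M7" "v \<noteq> (\<lambda>_. 0)" for v
  proof -
    obtain n where n: "n \<in> {1..7}" "v n \<noteq> 0" using v by (auto simp: M7_def fun_eq_iff)
    have "(\<Sum>n\<in>{1..7}. D n * v n * v n) > 0"
    proof (rule sum_pos2[OF _ n(1)])
      show "0 < D n * v n * v n" using bspec[OF assms n(1)] n(2)
          by (auto simp: mult.assoc zero_less_mult_iff linorder_neq_iff)
      show "0 \<le> D i * v i * v i" if "i \<in> {1..7}" for i using bspec[OF assms that] by (simp add: mult.assoc)
    qed auto
    then show ?thesis using v by (simp add: diag_met_def)
  qed
qed (auto simp: diag_met_def mult_ac)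

lemma sum_1_7_shift: "(\<Sum>n\<in>{1..7}. f n) = (\<Sum>j<7. f (Suc j))"
  using sum.atLeast1_atMost_eq[of f 7] by (simp add: One_nat_def)

lemma prod_1_7_shift: "(\<Prod>n\<in>{1..7}. f n) = (\<Prod>j<7. f (Suc j))"
  using prod.atLeast1_atMost_eq[of f 7] by (simp add: One_nat_def)

lemma orthonormal_diag_met_scaled_basis:
  assumes "\<forall>n\<in>{1..7}. D n > 0"
  shows "orthonormal (diag_met D) (map (\<lambda>n m. basis_vec n m / sqrt (D n)) [1..<8])"
proof -
  have M: "(\<lambda>m. basis_vec n m / sqrt (D n)) \<in> M7" if "n \<in> {1..7}" for n
    using that by (auto simp: M7_def basis_vec_def)
  have g: "diag_met D (\<lambda>m. basis_vec i m / sqrt (D i)) (\<lambda>m. basis_vec j m / sqrt (D j)) = (if i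
      = j then 1 else 0)"
    if ij: "i \<in> {1..7}" "j \<in> {1..7}" for i j
  proof -
    have "(\<Sum>n\<in>{1..7}. D n * (basis_vec i n / sqrt (D i)) * (basis_vec j n / sqrt (D j)))
        = (\<Sum>n\<in>{1..7}. if n = i then (if i = j then D i / (sqrt (D i) * sqrt (D i)) else 0) else 0)"
      by (intro sum.cong) (auto simp: basis_vec_def)
    also have "\<dots> = (if i = j then 1 else 0)"
      using ij bspec[OF assms ij(1)] by auto
    finally show ?thesis using M[OF ij(1)] M[OF ij(2)] by (simp add: diag_met_def)
  qed
  have nth: "map (\<lambda>n m. basis_vec n m / sqrt (D n)) [1..<8] ! i
      = (\<lambda>m. basis_vec (Suc i) m / sqrt (D (Suc i)))" if "i < 7" for i
    using that by (simp add: Suc_eq_plus1_left)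
  show ?thesis
    unfolding orthonormal_def
  proof (intro conjI allI impI)
    show "length (map (\<lambda>n m. basis_vec n m / sqrt (D n)) [1..<8]) = 7" by simp
    show "set (map (\<lambda>n m. basis_vec n m / sqrt (D n)) [1..<8]) \<subseteq> M7" using M by auto
    show "diag_met D (map (\<lambda>n m. basis_vec n m / sqrt (D n)) [1..<8] ! i) (map (\<lambda>n m. basis_vec n m /
        sqrt (D n)) [1..<8] ! j)
        = (if i = j then 1 else 0)" if "i < 7" "j < 7" for i j
      unfolding nth[OF that(1)] nth[OF that(2)] using g[of "Suc i" "Suc j"] that by simp
  qed
qed

lemma orthonormal_diag_met_gram:
  assumes "orthonormal (diag_met D) fs" "i < 7" "j < 7"
  shows "(\<Sum>l<7. (fs ! i) (Suc l) * (D (Suc l) * (fs ! j) (Suc l))) = (if i = j then 1 else 0)"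
proof -
  have "fs ! i \<in> M7" "fs ! j \<in> M7" using assms unfolding orthonormal_def
      by (auto intro!: nth_mem subsetD[of "set fs" M7])
  then have "diag_met D (fs ! i) (fs ! j) = (\<Sum>l<7. (fs ! i) (Suc l) * (D (Suc l) * (fs ! j) (Suc l)))"
    unfolding diag_met_def sum_1_7_shift by (simp add: mult_ac)
  then show ?thesis using assms by (simp add: orthonormal_def)
qed

text \<open>The Gram relation exhibits a right inverse of the square coordinate matrix of the frame.
  A right inverse is also a left inverse, and exchanging the factors gives the completeness
  relation.\<close>

lemma orthonormal_diag_met_complete:
  assumes fs: "orthonormal (diag_met D) fs" and D: "\<forall>n\<in>{1..7}. D n > 0" and nm: "n \<in> {1..7}" "m \<in> {1..7}"
  shows "(\<Sum>i<7. (fs ! i) n * (fs ! i) m) = (if n = m then 1 / D n else 0)"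
proof -
  let ?A = "mat 7 7 (\<lambda>(i, l). (fs ! i) (Suc l))" and ?B = "mat 7 7 (\<lambda>(l, j). D (Suc l) * (fs ! j) (Suc l))"
  have "?A * ?B = 1\<^sub>m 7"
    by (intro eq_matI) (auto simp: scalar_prod_def orthonormal_diag_met_gram[OF fs] simp flip:
        lessThan_atLeast0)
  then have "?B * ?A = 1\<^sub>m 7"
    by (rule mat_mult_left_right_inverse[rotated 2]) auto
  then have "(?B * ?A) $$ (n - 1, m - 1) = 1\<^sub>m 7 $$ (n - 1, m - 1)" by simp
  then have "(\<Sum>i<7. D n * (fs ! i) n * (fs ! i) m) = (if n = m then 1 else 0)"
    using nm by (auto simp: scalar_prod_def lessThan_atLeast0 split: if_splits)
  then have "D n * (\<Sum>i<7. (fs ! i) n * (fs ! i) m) = (if n = m then 1 else 0)"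
    by (simp add: sum_distrib_left mult.assoc)
  then show ?thesis using bspec[OF D nm(1)] by (auto simp: field_simps)
qed

lemma ldet_scale_rows: "ldet k (\<lambda>i j. c i * M i j) = (\<Prod>i<k. c i) * ldet k M"
  unfolding ldet_def by (simp add: prod.distrib sum_distrib_left mult_ac)

lemma eform_top: "length xs = 7 \<Longrightarrow> set xs \<subseteq> M7 \<Longrightarrow> eform [1..<8] xs = ldet 7 (\<lambda>a b. (xs ! a) (Suc b))"
  unfolding eform_def restr_def by (auto intro!: ldet_cong simp: Suc_eq_plus1_left)

lemma vol_form_diag_met:
  assumes D: "\<forall>n\<in>{1..7}. D n > 0" and v: "v\<^sup>2 = (\<Prod>n\<in>{1..7}. D n)"
  shows "vol_form (diag_met D) (\<lambda>xs. v * eform [1..<8] xs)"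
  unfolding vol_form_def
proof (intro conjI allI impI)
  show "is_form 7 (\<lambda>xs. v * eform [1..<8] xs)"
    using is_form_eform[of "[1..<8]"] by (intro is_form_scale) simp
  fix fs assume fs: "orthonormal (diag_met D) fs"
  let ?d = "ldet 7 (\<lambda>a b. (fs ! a) (Suc b))"
  have e: "eform [1..<8] fs = ?d"
    using fs by (intro eform_top) (auto simp: orthonormal_def)
  have "?d * ldet 7 (\<lambda>l j. D (Suc l) * (fs ! j) (Suc l)) = ldet 7 (\<lambda>i j. if i = j then 1 else 0)"
    unfolding ldet_mult[symmetric] by (intro ldet_cong) (simp add: orthonormal_diag_met_gram[OF fs])
  also have "\<dots> = 1"
    unfolding ldet_eq_det using det_one[of 7] unfolding one_mat_def by simp
  finally have "v\<^sup>2 * (?d * ?d) = 1"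
    unfolding ldet_scale_rows v prod_1_7_shift using ldet_transpose[of 7 "\<lambda>a b. (fs ! a) (Suc b)"]
        by (simp add: mult_ac)
  then have "(v * eform [1..<8] fs)\<^sup>2 = 1" by (simp add: e power2_eq_square mult_ac)
  then show "v * eform [1..<8] fs = 1 \<or> v * eform [1..<8] fs = -1" by (simp add: power2_eq_1_iff)
qed

section \<open>The induced inner product on forms\<close>

lemma sum_lists_Suc:
  "(\<Sum>is\<in>{is. length is = Suc k \<and> set is \<subseteq> S}. f is) = (\<Sum>i\<in>S. \<Sum>is\<in>{is. length is = k
      \<and> set is \<subseteq> S}. f (i # is))"
proof -
  have "{is. length is = Suc k \<and> set is \<subseteq> S} = (\<lambda>(i, is). i # is) ` (S \<times> {is. length is = k \<and> set is \<subseteq> S})"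
    by (auto simp: length_Suc_conv image_iff)
  then show ?thesis
    by (subst sum.cartesian_product) (auto simp: sum.reindex inj_on_def case_prod_unfold)
qed

text \<open>For an increasing list this is the squared length of \<open>eform ns\<close> in the
  metric \<open>diag_met D\<close>.\<close>

definition inv_weight :: "(nat \<Rightarrow> real) \<Rightarrow> nat list \<Rightarrow> real" where
  "inv_weight D ns = prod_list (map (\<lambda>n. 1 / D n) ns)"

lemma inv_weight_simps: "inv_weight D [] = 1" "inv_weight D (n # ns) = inv_weight D ns / D n"
  by (simp_all add: inv_weight_def)

lemma inv_weight_permute: "p permutes {..<length I} \<Longrightarrow> inv_weight D (permute_list p I) = inv_weight D I"
  unfolding inv_weight_def permute_list_map[symmetric] prod_mset_prod_list[symmetric] mset_map by simp

text \<open>Expanding both forms in the first slot produces exactly the frame sums evaluated by the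
  completeness relation.\<close>

lemma trace_orthonormal:
  assumes fs: "orthonormal (diag_met D) fs" and D: "\<forall>n\<in>{1..7}. D n > 0"
    and f: "is_form (Suc k) \<alpha>" "is_form (Suc k) \<beta>" and xs: "length xs = k" "set xs \<subseteq> M7"
  shows "(\<Sum>i<7. \<alpha> (fs ! i # xs) * \<beta> (fs ! i # xs))
      = (\<Sum>n\<in>{1..7}. \<alpha> (basis_vec n # xs) * \<beta> (basis_vec n # xs) / D n)"
proof -
  have fM: "fs ! i \<in> M7" if "i < 7" for i
    using fs that unfolding orthonormal_def by (auto intro!: nth_mem subsetD[of "set fs" M7])
  let ?a = "\<lambda>n. \<alpha> (basis_vec n # xs)" and ?b = "\<lambda>n. \<beta> (basis_vec n # xs)"
  have "(\<Sum>i<7. \<alpha> (fs ! i # xs) * \<beta> (fs ! i # xs))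
      = (\<Sum>i<7. \<Sum>n\<in>{1..7}. \<Sum>m\<in>{1..7}. ((fs ! i) n * (fs ! i) m) * (?a n * ?b m))"
  proof (intro sum.cong refl)
    fix i assume "i \<in> {..<7::nat}"
    then have i: "fs ! i \<in> M7" using fM by simp
    show "\<alpha> (fs ! i # xs) * \<beta> (fs ! i # xs) = (\<Sum>n\<in>{1..7}. \<Sum>m\<in>{1..7}. ((fs ! i) n * (fs ! i) m) * (?a n
        * ?b m))"
      unfolding form_expand_head[OF f(1) xs i] form_expand_head[OF f(2) xs i] sum_product
      by (simp add: mult_ac)
  qed
  also have "\<dots> = (\<Sum>n\<in>{1..7}. \<Sum>m\<in>{1..7}. \<Sum>i<7. ((fs ! i) n * (fs ! i) m) * (?a n * ?b m))"
    by (rule trans[OF sum.swap]) (intro sum.cong refl sum.swap)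
  also have "\<dots> = (\<Sum>n\<in>{1..7}. \<Sum>m\<in>{1..7}. if m = n then ?a n * ?b n / D n else 0)"
    by (intro sum.cong refl) (auto simp: sum_distrib_right[symmetric] orthonormal_diag_met_complete[OF
        fs D])
  also have "\<dots> = (\<Sum>n\<in>{1..7}. ?a n * ?b n / D n)"
    by simp
  finally show ?thesis .
qed

text \<open>The frame is eliminated one slot at a time by \<open>trace_orthonormal\<close>. The
  right-hand side does not mention the frame, so the choice made by \<open>SOME\<close> in
  \<open>form_inner\<close> is immaterial.\<close>

lemma sum_orthonormal_lists:
  assumes fs: "orthonormal (diag_met D) fs" and D: "\<forall>n\<in>{1..7}. D n > 0"
  shows "is_form k \<alpha> \<Longrightarrow> is_form k \<beta> \<Longrightarrow>
    (\<Sum>is\<in>{is. length is = k \<and> set is \<subseteq> {..<7}}. \<alpha> (map (\<lambda>i. fs ! i) is) * \<beta> (map (\<lambda>i. fs ! i) is))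
    = (\<Sum>ns\<in>{ns. length ns = k \<and> set ns \<subseteq> {1..7}}. inv_weight D ns * (\<alpha> (map basis_vec ns) * \<beta> (map
        basis_vec ns)))"
proof (induction k arbitrary: \<alpha> \<beta>)
  case 0
  have "{is. length is = 0 \<and> set is \<subseteq> S} = {[]}" for S :: "nat set" by auto
  then show ?case by (simp add: inv_weight_simps)
next
  case (Suc k)
  let ?N = "{ns. length ns = k \<and> set ns \<subseteq> {1..7::nat}}" and ?I = "{is. length is = k
      \<and> set is \<subseteq> {..<7::nat}}"
  have fM: "fs ! i \<in> M7" if "i < 7" for i
    using fs that unfolding orthonormal_def by (auto intro!: nth_mem subsetD[of "set fs" M7])
  have "(\<Sum>i<7. \<Sum>is\<in>?I. \<alpha> (fs ! i # map (\<lambda>i. fs ! i) is) * \<beta> (fs ! i # map (\<lambda>i. fs ! i) is))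
      = (\<Sum>i<7. \<Sum>ns\<in>?N. inv_weight D ns * (\<alpha> (fs ! i # map basis_vec ns) * \<beta> (fs ! i # map basis_vec ns)))"
  proof (rule sum.cong[OF refl])
    fix i assume "i \<in> {..<7::nat}"
    then have "is_form k (iota (fs ! i) \<alpha>)" "is_form k (iota (fs ! i) \<beta>)"
      using Suc.prems fM is_form_iota by auto
    from Suc.IH[OF this]
    show "(\<Sum>is\<in>?I. \<alpha> (fs ! i # map (\<lambda>i. fs ! i) is) * \<beta> (fs ! i # map (\<lambda>i. fs ! i) is))
      = (\<Sum>ns\<in>?N. inv_weight D ns * (\<alpha> (fs ! i # map basis_vec ns) * \<beta> (fs ! i # map basis_vec ns)))"
      by (simp add: iota_def)
  qed
  also have "\<dots> = (\<Sum>ns\<in>?N. inv_weight D ns * (\<Sum>i<7. \<alpha> (fs ! i # map basis_vec ns) * \<beta> (fs ! i # map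
      basis_vec ns)))"
    unfolding sum_distrib_left by (rule sum.swap)
  also have "\<dots> = (\<Sum>ns\<in>?N. inv_weight D ns * (\<Sum>n\<in>{1..7}. \<alpha> (basis_vec n # map basis_vec ns) * \<beta>
      (basis_vec n # map basis_vec ns) / D n))"
    by (rule sum.cong[OF refl], subst trace_orthonormal[OF fs D Suc.prems]) (use basis_vec_image_M7 in auto)
  also have "\<dots> = (\<Sum>ns\<in>?N. \<Sum>n\<in>{1..7}. inv_weight D (n # ns) * (\<alpha> (map basis_vec (n # ns)) * \<beta> (map
      basis_vec (n # ns))))"
    by (rule sum.cong[OF refl]) (simp add: sum_distrib_left inv_weight_simps)
  also have "\<dots> = (\<Sum>n\<in>{1..7}. \<Sum>ns\<in>?N. inv_weight D (n # ns) * (\<alpha> (map basis_vec (n # ns)) * \<beta> (map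
      basis_vec (n # ns))))"
    by (rule sum.swap)
  finally show ?case unfolding sum_lists_Suc list.map .
qed

lemma eform_basis_vec_list:
  assumes "length ns = length I" "set ns \<subseteq> {1..7}"
  shows "eform I (map basis_vec ns) = (\<Sum>p | p permutes {..<length I}. of_int (sign p) * (if ns
      = permute_list p I then 1 else 0))"
proof -
  have "eform I (map basis_vec ns) = ldet (length I) (\<lambda>a b. if I ! b = ns ! a then 1 else 0)"
    using assms basis_vec_image_M7[OF assms(2)]
        by (auto simp: eform_def restr_def basis_vec_def intro!: ldet_cong)
  also have "\<dots> = (\<Sum>p | p permutes {..<length I}. of_int (sign p) * (if ns
      = permute_list p I then 1 else 0))"
    unfolding ldet_def
  proof (intro sum.cong refl arg_cong2[where f = "(*)"])
    fix p assume "p \<in> {p. p permutes {..<length I}}"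
    then have p: "p permutes {..<length I}" by simp
    show "(\<Prod>i<length I. if I ! p i = ns ! i then 1 else 0) = (if ns
        = permute_list p I then 1 else (0::real))"
    proof (cases "ns = permute_list p I")
      case True
      then show ?thesis by (simp add: permute_list_nth[OF p])
    next
      case False
      then obtain i where i: "i < length I" "ns ! i \<noteq> I ! p i"
        using assms permute_list_nth[OF p] by (metis length_permute_list nth_equalityI)
      have "(\<Prod>i<length I. if I ! p i = ns ! i then 1 else (0::real)) = 0"
        by (rule prod_zero) (use i in \<open>auto intro!: bexI[of _ i]\<close>)
      then show ?thesis using False by simp
    qed
  qed
  finally show ?thesis .
qed

text \<open>Only the rearrangements of \<open>I\<close> contribute. Both forms change by the same
  sign, so all of them give the same term, and their number cancels the factor
  \<open>fact k\<close>.\<close>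

lemma form_inner_eform:
  assumes D: "\<forall>n\<in>{1..7}. D n > 0" and f: "is_form k \<alpha>" and I: "I \<in> sorted_lists k"
  shows "form_inner (diag_met D) k (eform I) \<alpha> = inv_weight D I * \<alpha> (map basis_vec I)"
proof -
  define fs where "fs = (SOME fs. orthonormal (diag_met D) fs)"
  have fs: "orthonormal (diag_met D) fs"
    unfolding fs_def by (rule someI[where P = "orthonormal (diag_met D)"], rule
        orthonormal_diag_met_scaled_basis[OF D])
  have k: "length I = k" "set I \<subseteq> {1..7}" using I by (auto simp: sorted_lists_def)
  let ?N = "{ns. length ns = k \<and> set ns \<subseteq> {1..7::nat}}" and ?P = "{p. p permutes {..<k}}"
  have fin: "finite ?N" using finite_lists_length_eq[of "{1..7::nat}" k] by (simp add: conj_commute)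
  have "(\<Sum>ns\<in>?N. inv_weight D ns * (eform I (map basis_vec ns) * \<alpha> (map basis_vec ns)))
      = (\<Sum>ns\<in>?N. \<Sum>p\<in>?P. if ns = permute_list p I then of_int (sign p) * inv_weight D ns * \<alpha> (map
          basis_vec ns) else 0)"
    using k by (intro sum.cong refl) (auto simp: eform_basis_vec_list sum_distrib_left
        sum_distrib_right intro!: sum.cong)
  also have "\<dots> = (\<Sum>p\<in>?P. \<Sum>ns\<in>?N. if ns = permute_list p I then of_int (sign p) * inv_weight D ns * \<alpha>
      (map basis_vec ns) else 0)"
    by (rule sum.swap)
  also have "\<dots> = (\<Sum>p\<in>?P. inv_weight D I * \<alpha> (map basis_vec I))"
  proof (intro sum.cong refl)
    fix p assume "p \<in> ?P"
    then have p: "p permutes {..<k}" by simp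
    have "permute_list p I \<in> ?N" using k p by (simp add: set_permute_list)
    then have "(\<Sum>ns\<in>?N. if ns = permute_list p I then of_int (sign p) * inv_weight D ns * \<alpha> (map
        basis_vec ns) else 0)
        = of_int (sign p) * inv_weight D (permute_list p I) * \<alpha> (map basis_vec (permute_list p I))"
      using fin by (simp add: sum.delta)
    also have "\<dots> = of_int (sign p) * inv_weight D I * (of_int (sign p) * \<alpha> (map basis_vec I))"
      using inv_weight_permute[of p I D] form_permute[OF f, of "map basis_vec I" p] k p
          basis_vec_image_M7[OF k(2)]
      by (simp add: permute_list_map)
    also have "\<dots> = of_int (sign p * sign p) * (inv_weight D I * \<alpha> (map basis_vec I))"
      by (simp only: of_int_mult mult_ac)
    also have "\<dots> = inv_weight D I * \<alpha> (map basis_vec I)" by simp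
    finally show "(\<Sum>ns\<in>?N. if ns = permute_list p I then of_int (sign p) * inv_weight D ns * \<alpha> (map
        basis_vec ns) else 0) = inv_weight D I * \<alpha> (map basis_vec I)" .
  qed
  also have "\<dots> = fact k * (inv_weight D I * \<alpha> (map basis_vec I))"
    using card_permutations[of "{..<k}" k] by simp
  finally show ?thesis
    unfolding form_inner_def Let_def fs_def[symmetric] sum_orthonormal_lists[OF fs D
        eform_sorted_lists[OF I] f] by simp
qed

lemma form_inner_sum_left:
  "form_inner g k (\<lambda>xs. \<Sum>s\<in>S. c s * \<gamma> s xs) \<alpha> = (\<Sum>s\<in>S. c s * form_inner g k (\<gamma> s) \<alpha>)"
  unfolding form_inner_def Let_def
  by (simp only: sum_distrib_left sum_distrib_right sum_divide_distrib times_divide_eq_right)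
     (subst sum.swap, simp add: mult_ac)

lemma form_inner_expand:
  assumes "\<forall>n\<in>{1..7}. D n > 0" "is_form k \<gamma>" "is_form k \<alpha>"
  shows "form_inner (diag_met D) k \<gamma> \<alpha> = (\<Sum>I\<in>sorted_lists k. \<gamma> (map basis_vec I) * (inv_weight D I * \<alpha>
      (map basis_vec I)))"
proof -
  have "form_inner (diag_met D) k \<gamma> \<alpha> = form_inner (diag_met D) k (\<lambda>xs. \<Sum>I\<in>sorted_lists k. \<gamma> (map
      basis_vec I) * eform I xs) \<alpha>"
    using form_expand[OF assms(2)] by simp
  then show ?thesis
    using form_inner_eform[OF assms(1,3)] by (simp add: form_inner_sum_left)
qed

section \<open>Complementary indices and the star operator\<close>

definition compl_list :: "nat list \<Rightarrow> nat list" where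
  "compl_list I = filter (\<lambda>n. n \<notin> set I) [1..<8]"

text \<open>The sign relating e^I wedge e^J, with J the complement of I, to e^{1...7}; it is read
  off by evaluation on the coordinate frame.\<close>

definition shuffle_sign :: "nat list \<Rightarrow> real" where
  "shuffle_sign I = eform (I @ compl_list I) (map basis_vec [1..<8])"

lemma set_compl_list: "set (compl_list I) = {1..7} - set I"
  by (auto simp: compl_list_def)

lemma compl_list_sorted_lists:
  assumes "I \<in> sorted_lists k" shows "compl_list I \<in> sorted_lists (7 - k)"
proof -
  have "sorted_wrt (<) (compl_list I)" unfolding compl_list_def by (intro sorted_wrt_filter sorted_wrt_upt)
  moreover have "length (compl_list I) = card (set (compl_list I))"
    by (rule distinct_card[symmetric]) (simp add: compl_list_def)
  moreover have "card (set (compl_list I)) = 7 - k"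
    unfolding set_compl_list using assms distinct_card[OF sorted_lists_distinct[OF assms]]
    by (subst card_Diff_subset) (auto simp: sorted_lists_def)
  ultimately show ?thesis by (auto simp: sorted_lists_def set_compl_list)
qed

lemma sorted_lists_eqI: "I \<in> sorted_lists k \<Longrightarrow> J \<in> sorted_lists l \<Longrightarrow> set I = set J \<Longrightarrow> I = J"
  by (auto simp: sorted_lists_def strict_sorted_iff intro: sorted_distinct_set_unique)

lemma compl_list_compl_list: "I \<in> sorted_lists k \<Longrightarrow> compl_list (compl_list I) = I"
  by (rule sorted_lists_eqI[OF compl_list_sorted_lists[OF compl_list_sorted_lists]]) (auto simp:
      set_compl_list, auto simp: sorted_lists_def)

lemma sorted_lists_7: "sorted_lists 7 = {[1..<8]}"
proof -
  have top: "[1..<8] \<in> sorted_lists 7" by (auto simp: sorted_lists_def)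
  moreover have "I = [1..<8]" if "I \<in> sorted_lists 7" for I
  proof (rule sorted_lists_eqI[OF that top])
    have "card (set I) = 7" using distinct_card[OF sorted_lists_distinct[OF that]] that
        by (simp add: sorted_lists_def)
    moreover have "set I \<subseteq> {1..7}" using that by (simp add: sorted_lists_def)
    ultimately have "set I = {1..7}" by (intro card_subset_eq) simp_all
    also have "\<dots> = set [1..<8]" by auto
    finally show "set I = set [1..<8]" .
  qed
  ultimately show ?thesis by blast
qed

lemma form7_expand:
  assumes "is_form 7 \<alpha>" shows "\<alpha> = (\<lambda>xs. \<alpha> (map basis_vec [1..<8]) * eform [1..<8] xs)"
  using form_expand[OF assms] unfolding sorted_lists_7 by simp

lemma eform_top_basis: "eform [1..<8] (map basis_vec [1..<8]) = 1"
  using eform_basis[of "[1..<8]" 7 "[1..<8]"] sorted_lists_7 by simp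

lemma eform_not_distinct:
  assumes "\<not> distinct I" shows "eform I xs = 0"
proof -
  obtain i j where ij: "i < length I" "j < length I" "i \<noteq> j" "I ! i = I ! j"
    using assms by (auto simp: distinct_conv_nth)
  have "ldet (length I) (\<lambda>a b. (xs ! a) (I ! b)) = 0"
    by (subst ldet_transpose[symmetric], rule ldet_identical_rows[of i _ j]) (use ij in auto)
  then show ?thesis by (auto simp: eform_def restr_def)
qed

lemma shuffle_sign_square: assumes "I \<in> sorted_lists k" shows "shuffle_sign I * shuffle_sign I = 1"
proof -
  have "distinct (I @ compl_list I)" "set (I @ compl_list I) = set [1..<8]"
    using sorted_lists_distinct[OF assms] sorted_lists_distinct[OF compl_list_sorted_lists[OF assms]]
        assms by (auto simp: set_compl_list, auto simp: sorted_lists_def)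
  then have "mset (I @ compl_list I) = mset [1..<8]"
    by (metis distinct_upt set_eq_iff_mset_eq_distinct)
  then obtain p where p: "p permutes {..<length [1..<8]}" "permute_list p [1..<8] = I @ compl_list I"
    by (rule mset_eq_permutation)
  have "shuffle_sign I = of_int (sign p)"
    unfolding shuffle_sign_def p(2)[symmetric] eform_permute[OF p(1)] eform_top_basis by simp
  then show ?thesis by (metis of_int_1 of_int_mult sign_idempotent)
qed

text \<open>In complementary degrees an increasing list other than \<open>compl_list I\<close>
  shares an index with \<open>I\<close>, so only one term of the inner sum survives.\<close>

lemma wedge_top:
  assumes k: "k \<le> 7" and f: "is_form k \<gamma>" "is_form (7 - k) \<beta>"
  shows "wedge k (7 - k) \<gamma> \<beta> = (\<lambda>xs. (\<Sum>I\<in>sorted_lists k. \<gamma> (map basis_vec I) * (shuffle_sign I * \<beta>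
      (map basis_vec (compl_list I)))) * eform [1..<8] xs)"
proof -
  have inner: "(\<Sum>J\<in>sorted_lists (7 - k). \<beta> (map basis_vec J) * eform (I @ J) xs)
      = shuffle_sign I * \<beta> (map basis_vec (compl_list I)) * eform [1..<8] xs"
    if I: "I \<in> sorted_lists k" for I xs
  proof -
    have zero: "eform (I @ J) xs = 0" if J: "J \<in> sorted_lists (7 - k)" "J \<noteq> compl_list I" for J
    proof (rule eform_not_distinct, rule notI)
      assume "distinct (I @ J)"
      then have "set J \<subseteq> set (compl_list I)" "card (set J) = card (set (compl_list I))"
        using J distinct_card[OF sorted_lists_distinct[OF J(1)]] distinct_card[OF
            sorted_lists_distinct[OF compl_list_sorted_lists[OF I]]] compl_list_sorted_lists[OF I]
        by (auto simp: set_compl_list, auto simp: sorted_lists_def)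
      then have "set J = set (compl_list I)" by (intro card_subset_eq) auto
      then show False using sorted_lists_eqI[OF J(1) compl_list_sorted_lists[OF I]] J(2) by simp
    qed
    have "(\<Sum>J\<in>sorted_lists (7 - k). \<beta> (map basis_vec J) * eform (I @ J) xs) = (\<Sum>J\<in>sorted_lists (7
        - k). if J = compl_list I then \<beta> (map basis_vec J) * eform (I @ J) xs else 0)"
      by (intro sum.cong refl) (simp add: zero)
    also have "\<dots> = \<beta> (map basis_vec (compl_list I)) * eform (I @ compl_list I) xs"
      using compl_list_sorted_lists[OF I] by (simp add: finite_sorted_lists)
    also have "eform (I @ compl_list I) xs = shuffle_sign I * eform [1..<8] xs"
    proof -
      have "is_form 7 (eform (I @ compl_list I))"
        using is_form_eform[of "I @ compl_list I"] I compl_list_sorted_lists[OF I] k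
            by (simp add: sorted_lists_def)
      then show ?thesis unfolding shuffle_sign_def using form7_expand by meson
    qed
    finally show ?thesis by simp
  qed
  show ?thesis
    unfolding wedge_expand[OF f] sum_distrib_right
    by (intro ext sum.cong refl) (simp add: inner)
qed

text \<open>The coordinate formula of the Hodge star: e^I goes to its complement, scaled by its
  squared length and by the volume coefficient \<open>v\<close>, whose sign carries the
  orientation.\<close>

definition diag_star :: "(nat \<Rightarrow> real) \<Rightarrow> real \<Rightarrow> nat \<Rightarrow> form \<Rightarrow> form" where
  "diag_star D v k \<alpha> = (\<lambda>xs. \<Sum>I\<in>sorted_lists k. \<alpha> (map basis_vec I) * (v * inv_weight D I *
      shuffle_sign I * eform (compl_list I) xs))"

lemma is_form_diag_star: "is_form (7 - k) (diag_star D v k \<alpha>)"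
  unfolding diag_star_def by (intro is_form_sum finite_sorted_lists is_form_scale
      eform_sorted_lists[OF compl_list_sorted_lists])

lemma diag_star_basis:
  assumes "I \<in> sorted_lists k"
  shows "diag_star D v k \<alpha> (map basis_vec (compl_list I))
      = v * inv_weight D I * shuffle_sign I * \<alpha> (map basis_vec I)"
proof -
  have "diag_star D v k \<alpha> (map basis_vec (compl_list I)) = (\<Sum>J\<in>sorted_lists k. if J
      = I then v * inv_weight D I * shuffle_sign I * \<alpha> (map basis_vec I) else 0)"
    unfolding diag_star_def
  proof (intro sum.cong refl)
    fix J assume J: "J \<in> sorted_lists k"
    have "compl_list J = compl_list I \<longleftrightarrow> J = I"
        using compl_list_compl_list[OF J] compl_list_compl_list[OF assms] by metis
    then show "\<alpha> (map basis_vec J) * (v * inv_weight D J * shuffle_sign J * eform (compl_list J) (map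
        basis_vec (compl_list I))) = (if J = I then v * inv_weight D I * shuffle_sign I * \<alpha> (map
        basis_vec I) else 0)"
      by (simp add: eform_basis[OF compl_list_sorted_lists[OF J] compl_list_sorted_lists[OF assms]])
  qed
  then show ?thesis using assms by (simp add: finite_sorted_lists)
qed

lemma hodge_eq_diag_star:
  assumes D: "\<forall>n\<in>{1..7}. D n > 0" and k: "k \<le> 7" and f: "is_form k \<alpha>"
  shows "hodge (diag_met D) (\<lambda>xs. v * eform [1..<8] xs) k \<alpha> = diag_star D v k \<alpha>"
  unfolding hodge_def
proof (rule the_equality)
  show "is_form (7 - k) (diag_star D v k \<alpha>) \<and>
    (\<forall>\<gamma>. is_form k \<gamma> \<longrightarrow> wedge k (7 - k) \<gamma> (diag_star D v k \<alpha>)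
        = (\<lambda>xs. form_inner (diag_met D) k \<gamma> \<alpha> * (v * eform [1..<8] xs)))"
  proof (intro conjI allI impI is_form_diag_star)
    fix \<gamma> assume \<gamma>: "is_form k \<gamma>"
    have "(\<Sum>I\<in>sorted_lists k. \<gamma> (map basis_vec I) * (shuffle_sign I * diag_star D v k \<alpha> (map basis_vec
        (compl_list I)))) = form_inner (diag_met D) k \<gamma> \<alpha> * v"
      unfolding form_inner_expand[OF D \<gamma> f] sum_distrib_right
    proof (intro sum.cong refl)
      fix I assume I: "I \<in> sorted_lists k"
      have "\<gamma> (map basis_vec I) * (shuffle_sign I * diag_star D v k \<alpha> (map basis_vec (compl_list I)))
          = (shuffle_sign I * shuffle_sign I) * (\<gamma> (map basis_vec I) * (inv_weight D I * \<alpha> (map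
          basis_vec I)) * v)"
        unfolding diag_star_basis[OF I] by (simp only: mult_ac)
      then show "\<gamma> (map basis_vec I) * (shuffle_sign I * diag_star D v k \<alpha> (map basis_vec (compl_list
          I))) = \<gamma> (map basis_vec I) * (inv_weight D I * \<alpha> (map basis_vec I)) * v"
        by (simp add: shuffle_sign_square[OF I])
    qed
    then show "wedge k (7 - k) \<gamma> (diag_star D v k \<alpha>)
        = (\<lambda>xs. form_inner (diag_met D) k \<gamma> \<alpha> * (v * eform [1..<8] xs))"
      unfolding wedge_top[OF k \<gamma> is_form_diag_star] by (simp add: mult.assoc)
  qed
next
  fix \<beta> assume \<beta>: "is_form (7 - k) \<beta> \<and>
    (\<forall>\<gamma>. is_form k \<gamma> \<longrightarrow> wedge k (7 - k) \<gamma> \<beta> = (\<lambda>xs. form_inner (diag_met D) k \<gamma> \<alpha> * (v * eform [1..<8] xs)))"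
  show "\<beta> = diag_star D v k \<alpha>"
  proof (rule form_ext[OF conjunct1[OF \<beta>] is_form_diag_star])
    fix J assume J: "J \<in> sorted_lists (7 - k)"
    define I where "I = compl_list J"
    have I: "I \<in> sorted_lists k" using compl_list_sorted_lists[OF J] k by (simp add: I_def)
    have J_eq: "J = compl_list I" using compl_list_compl_list[OF J] by (simp add: I_def)
    \<comment> \<open>Testing the defining property with the single form \<open>eform I\<close>
      isolates the coefficient of the candidate at the complement of \<open>I\<close>; this is the
      uniqueness half.\<close>
    have "wedge k (7 - k) (eform I) \<beta> (map basis_vec [1..<8]) = inv_weight D I * \<alpha> (map basis_vec I) * v"
      using \<beta> eform_sorted_lists[OF I] by (simp add: form_inner_eform[OF D f I] eform_top_basis del:
          upt_Suc upt_rec_numeral)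
    moreover have "wedge k (7 - k) (eform I) \<beta> (map basis_vec [1..<8]) = (\<Sum>K\<in>sorted_lists k. if K
        = I then shuffle_sign I * \<beta> (map basis_vec (compl_list I)) else 0)"
      unfolding wedge_top[OF k eform_sorted_lists[OF I] conjunct1[OF \<beta>]] eform_top_basis mult_1_right
      by (intro sum.cong refl) (auto simp: eform_basis[OF I])
    ultimately have "shuffle_sign I * \<beta> (map basis_vec (compl_list I))
        = v * inv_weight D I * \<alpha> (map basis_vec I)"
      using I by (simp add: finite_sorted_lists mult_ac)
    then have "(shuffle_sign I * shuffle_sign I) * \<beta> (map basis_vec (compl_list I))
        = v * inv_weight D I * shuffle_sign I * \<alpha> (map basis_vec I)"
      by (simp only: mult_ac)
    then show "\<beta> (map basis_vec J) = diag_star D v k \<alpha> (map basis_vec J)"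
      unfolding J_eq diag_star_basis[OF I] by (simp add: shuffle_sign_square[OF I])
  qed
qed

lemma diag_star_add: "diag_star D v k (\<lambda>xs. \<alpha> xs + \<beta> xs) = (\<lambda>xs. diag_star D v k \<alpha> xs
    + diag_star D v k \<beta> xs)"
  unfolding diag_star_def by (simp add: sum.distrib distrib_right)

lemma diag_star_scale: "diag_star D v k (\<lambda>xs. c * \<alpha> xs) = (\<lambda>xs. c * diag_star D v k \<alpha> xs)"
  unfolding diag_star_def by (simp add: sum_distrib_left mult.assoc)

lemma diag_star_zero: "diag_star D v k (\<lambda>xs. 0) = (\<lambda>xs. 0)"
  unfolding diag_star_def by simp

lemma diag_star_eform:
  assumes "I \<in> sorted_lists k"
  shows "diag_star D v k (eform I) = (\<lambda>xs. v * inv_weight D I * shuffle_sign I * eform (compl_list I) xs)"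
proof
  fix xs
  have "diag_star D v k (eform I) xs = (\<Sum>J\<in>sorted_lists k. if J
      = I then v * inv_weight D I * shuffle_sign I * eform (compl_list I) xs else 0)"
    unfolding diag_star_def using assms by (intro sum.cong refl) (auto simp: eform_basis)
  then show "diag_star D v k (eform I) xs = v * inv_weight D I * shuffle_sign I * eform (compl_list I) xs"
    using assms by (simp add: finite_sorted_lists)
qed

subsection \<open>Bracket and exterior derivative\<close>

lemma atLeastAtMost_1_7: "{1..7::nat} = {1, 2, 3, 4, 5, 6, 7}"
  by auto

lemma mbasis_simps:
  "mbasis 1 = (\<lambda>i j. if i = 0 \<and> j = 0 then 3 * \<i> else if i = j \<and> i \<in> {1..3} then - \<i> else 0)"
  "mbasis 2 = (\<lambda>i j. if i = 0 \<and> j = 1 then -1 else if i = 1 \<and> j = 0 then 1 else 0)"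
  "mbasis 3 = (\<lambda>i j. if (i = 0 \<and> j = 1) \<or> (i = 1 \<and> j = 0) then \<i> else 0)"
  "mbasis 4 = (\<lambda>i j. if i = 0 \<and> j = 2 then -1 else if i = 2 \<and> j = 0 then 1 else 0)"
  "mbasis 5 = (\<lambda>i j. if (i = 0 \<and> j = 2) \<or> (i = 2 \<and> j = 0) then \<i> else 0)"
  "mbasis 6 = (\<lambda>i j. if i = 0 \<and> j = 3 then -1 else if i = 3 \<and> j = 0 then 1 else 0)"
  "mbasis 7 = (\<lambda>i j. if (i = 0 \<and> j = 3) \<or> (i = 3 \<and> j = 0) then \<i> else 0)"
  unfolding mbasis_def Let_def by (auto simp: fun_eq_iff)

lemma emb_eq:
  "emb v i j =
    (if i = 0 \<and> j = 0 then Complex 0 (3 * v 1)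
     else if i = 0 \<and> j \<in> {1, 2, 3} then Complex (- v (2 * j)) (v (2 * j + 1))
     else if j = 0 \<and> i \<in> {1, 2, 3} then Complex (v (2 * i)) (v (2 * i + 1))
     else if i = j \<and> i \<in> {1, 2, 3} then Complex 0 (- v 1)
     else 0)"
proof -
  have i3: "{1..3::nat} = {1, 2, 3}" by auto
  show ?thesis
    unfolding emb_def atLeastAtMost_1_7
    by (auto simp: mbasis_simps i3 complex_eq_iff)
qed

text \<open>The first column already contains all seven coordinates. Matrices in \<open>hsu3\<close>
  vanish there, which is why this gives uniqueness of the projected bracket as well.\<close>

lemma emb_inj:
  assumes "u \<in> M7" "v \<in> M7" "\<And>i. i < 4 \<Longrightarrow> emb u i 0 = emb v i 0"
  shows "u = v"
proof
  fix n :: nat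
  have "n \<notin> {1..7} \<or> n \<in> {1, 2, 3, 4, 5, 6, 7}" by auto
  moreover have "u n = v n" if "n \<notin> {1..7}" using assms that by (auto simp: M7_def)
  ultimately show "u n = v n"
    using assms(3)[of 0] assms(3)[of 1] assms(3)[of 2] assms(3)[of 3] by (auto simp: emb_eq complex_eq_iff)
qed

definition omega_val :: "Defs.vec \<Rightarrow> Defs.vec \<Rightarrow> real" where
  "omega_val x y = x 2 * y 3 - x 3 * y 2 + x 4 * y 5 - x 5 * y 4 + x 6 * y 7 - x 7 * y 6"

text \<open>With \<open>J e\<^bsub>2j\<^esub> = e\<^bsub>2j+1\<^esub>\<close>, this is \<open>-2/3 \<omega>(x, y) e\<^sub>1 + 4 (y\<^sub>1 J x - x\<^sub>1 J y)\<close>.\<close>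

definition bracket :: "Defs.vec \<Rightarrow> Defs.vec \<Rightarrow> Defs.vec" where
  "bracket x y = (\<lambda>n. if n = 1 then - (2/3) * omega_val x y
     else if n \<in> {2, 4, 6} then 4 * (x 1 * y (n + 1) - y 1 * x (n + 1))
     else if n \<in> {3, 5, 7} then - 4 * (x 1 * y (n - 1) - y 1 * x (n - 1)) else 0)"

lemma bracket_M7: "bracket x y \<in> M7"
  by (auto simp: M7_def bracket_def)

lemma lessThan_4: "{..<4::nat} = {0, 1, 2, 3}" by auto

text \<open>Column 0 and the trace of the lower block are computed; row 0 follows because all
  matrices involved are skew-Hermitian. The corner entry of the commutator is -2i omega(x, y) and
  that of \<open>emb v\<close> is 3i \<open>v 1\<close>, whence the factor -2/3.\<close>

lemma brm_eq: "brm x y = bracket x y"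
  unfolding brm_def
proof (rule the_equality)
  let ?C = "mcomm (emb x) (emb y)"
  have skew: "emb z i j = - cnj (emb z j i)" for z i j
    by (auto simp: emb_eq complex_eq_iff)
  have outer: "?C i j = 0" if "i \<ge> 4 \<or> j \<ge> 4" for i j
    using that by (auto simp: mcomm_def mmul_def emb_eq)
  have skewC: "?C i j = - cnj (?C j i)" for i j
    unfolding mcomm_def mmul_def
    by (simp add: skew[of x i] skew[of y i] skew[of x _ j] skew[of y _ j] mult.commute)
  have col: "?C i 0 = emb (bracket x y) i 0" if "i < 4" for i
  proof -
    have "i \<in> {0, 1, 2, 3}" using that by auto
    then show ?thesis
      by (auto simp: mcomm_def mmul_def lessThan_4 emb_eq complex_eq_iff bracket_def omega_val_def
          algebra_simps)
  qed
  have row: "?C 0 j = emb (bracket x y) 0 j" if "j < 4" for j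
    using col[OF that] skewC[of 0 j] skew[of "bracket x y" 0 j] by simp
  have outer': "emb (bracket x y) i j = 0" if "i \<ge> 4 \<or> j \<ge> 4" for i j
    using that by (auto simp: emb_eq)
  have tr: "(?C 1 1 - emb (bracket x y) 1 1) + (?C 2 2 - emb (bracket x y) 2 2) + (?C 3 3
      - emb (bracket x y) 3 3) = 0"
    by (simp add: mcomm_def mmul_def lessThan_4 emb_eq complex_eq_iff bracket_def omega_val_def
        algebra_simps)
  show "bracket x y \<in> M7 \<and> (\<lambda>i j. ?C i j - emb (bracket x y) i j) \<in> hsu3"
    unfolding hsu3_def mem_Collect_eq
  proof (intro conjI allI impI bracket_M7 tr)
    show "?C i j - emb (bracket x y) i j = 0" if "i = 0 \<or> j = 0 \<or> i \<ge> 4 \<or> j \<ge> 4" for i j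
      using that col[of i] row[of j] outer[of i j] outer'[of i j] by (cases "i \<ge> 4 \<or> j \<ge> 4") auto
    show "?C i j - emb (bracket x y) i j = - cnj (?C j i - emb (bracket x y) j i)" for i j
      using skewC[of i j] skew[of "bracket x y" i j] by simp
  qed
  fix v assume v: "v \<in> M7 \<and> (\<lambda>i j. ?C i j - emb v i j) \<in> hsu3"
  show "v = bracket x y"
    by (rule emb_inj) (use v bracket_M7 col in \<open>auto simp: hsu3_def\<close>)
qed

section \<open>Coordinate polynomials of the invariant forms\<close>

definition horiz_inner :: "Defs.vec \<Rightarrow> Defs.vec \<Rightarrow> real" where
  "horiz_inner x y = x 2 * y 2 + x 3 * y 3 + x 4 * y 4 + x 5 * y 5 + x 6 * y 6 + x 7 * y 7"

definition minor3 :: "nat \<Rightarrow> nat \<Rightarrow> nat \<Rightarrow> Defs.vec \<Rightarrow> Defs.vec \<Rightarrow> Defs.vec \<Rightarrow> real" where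
  "minor3 a b c x y z = x a * (y b * z c - z b * y c) - y a * (x b * z c - z b * x c)
      + z a * (x b * y c - y b * x c)"

definition VR_val :: "Defs.vec \<Rightarrow> Defs.vec \<Rightarrow> Defs.vec \<Rightarrow> real" where
  "VR_val x y z = minor3 2 4 6 x y z - minor3 2 5 7 x y z - minor3 3 4 7 x y z - minor3 3 5 6 x y z"

definition VI_val :: "Defs.vec \<Rightarrow> Defs.vec \<Rightarrow> Defs.vec \<Rightarrow> real" where
  "VI_val x y z = minor3 3 4 6 x y z - minor3 3 5 7 x y z + minor3 2 4 7 x y z + minor3 2 5 6 x y z"

lemma omega_val_swap: "omega_val y x = - omega_val x y" and horiz_inner_swap: "horiz_inner y x
    = horiz_inner x y"
  by (simp_all add: omega_val_def horiz_inner_def)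

lemma minor3_swap: "minor3 a b c y x z = - minor3 a b c x y z" "minor3 a b c x z y = - minor3 a b c x y z"
  by (simp_all add: minor3_def algebra_simps)

lemma VR_val_swap: "VR_val y x z = - VR_val x y z" "VR_val x z y = - VR_val x y z"
  by (simp_all add: VR_val_def minor3_swap(1)[of _ _ _ y x z] minor3_swap(2)[of _ _ _ x z y])

lemma VI_val_swap: "VI_val y x z = - VI_val x y z" "VI_val x z y = - VI_val x y z"
  by (simp_all add: VI_val_def minor3_swap(1)[of _ _ _ y x z] minor3_swap(2)[of _ _ _ x z y])

lemma bracket_1: "bracket x y 1 = - (2/3) * omega_val x y"
  by (simp add: bracket_def)

text \<open>The horizontal part of the bracket involves only J, and omega(J x, z) is minus the
  horizontal inner product of x and z.\<close>

lemma omega_val_bracket: "omega_val (bracket x y) z = 4 * (x 1 * horiz_inner y z - y 1 * horiz_inner x z)"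
  by (simp add: omega_val_def horiz_inner_def bracket_def algebra_simps)

text \<open>\<open>VR_val\<close> and \<open>VI_val\<close> are the real and imaginary parts of a
  complex determinant, so inserting J in one slot multiplies by i and exchanges them up to
  sign.\<close>

lemma VR_val_bracket: "VR_val (bracket x y) z w = 4 * (x 1 * VI_val y z w - y 1 * VI_val x z w)"
  by (simp add: VR_val_def VI_val_def minor3_def bracket_def algebra_simps)

lemma VI_val_bracket: "VI_val (bracket x y) z w = - 4 * (x 1 * VR_val y z w - y 1 * VR_val x z w)"
  by (simp add: VR_val_def VI_val_def minor3_def bracket_def algebra_simps)

lemma eform_Cons:
  assumes "length xs = Suc (length I)" "set xs \<subseteq> M7"
  shows "eform (a # I) xs = (\<Sum>i<Suc (length I). (-1) ^ i * (xs ! i) a * eform I (take i xs @ drop (Suc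
      i) xs))"
proof -
  have "eform (a # I) xs = ldet (Suc (length I)) (\<lambda>i b. (xs ! i) ((a # I) ! b))"
    using assms by (simp add: eform_def restr_def)
  also have "\<dots> = (\<Sum>i<Suc (length I). (-1) ^ i * (xs ! i) a * ldet (length I) (\<lambda>c b. (xs ! (if c < i
      then c else Suc c)) (I ! b)))"
    unfolding ldet_Suc by simp
  also have "\<dots> = (\<Sum>i<Suc (length I). (-1) ^ i * (xs ! i) a * eform I (take i xs @ drop (Suc i) xs))"
  proof (rule sum.cong[OF refl])
    fix i assume i: "i \<in> {..<Suc (length I)}"
    have "set (take i xs @ drop (Suc i) xs) \<subseteq> M7"
      using assms(2) set_take_subset[of i xs] set_drop_subset[of "Suc i" xs] by auto
    moreover have "length (take i xs @ drop (Suc i) xs) = length I"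
      using i assms by simp
    ultimately have "eform I (take i xs @ drop (Suc i) xs)
        = ldet (length I) (\<lambda>c b. (xs ! (if c < i then c else Suc c)) (I ! b))"
      unfolding eform_def restr_def using i assms by (auto intro!: ldet_cong simp: nth_append min_def)
    then show "(-1) ^ i * (xs ! i) a * ldet (length I) (\<lambda>c b. (xs ! (if c < i then c else Suc c)) (I ! b))
      = (-1) ^ i * (xs ! i) a * eform I (take i xs @ drop (Suc i) xs)" by simp
  qed
  finally show ?thesis .
qed

lemma eform_Nil: "eform [] [] = 1"
  by (simp add: eform_def restr_def ldet_0)

lemma eform_1: "x \<in> M7 \<Longrightarrow> eform [a] [x] = x a"
  by (simp add: eform_Cons eform_Nil)

lemma eform_2: "{x, y} \<subseteq> M7 \<Longrightarrow> eform [a, b] [x, y] = x a * y b - y a * x b"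
  by (simp add: eform_Cons[of _ "[b]"] eform_1 numeral_eq_Suc)

lemma eform_3: "{x, y, z} \<subseteq> M7 \<Longrightarrow> eform [a, b, c] [x, y, z] = minor3 a b c x y z"
  by (simp add: eform_Cons[of _ "[b, c]"] eform_2 numeral_eq_Suc minor3_def)

lemma eform_4: "{x, y, z, w} \<subseteq> M7 \<Longrightarrow> eform [a, b, c, d] [x, y, z, w]
    = x a * minor3 b c d y z w - y a * minor3 b c d x z w + z a * minor3 b c d x y w
        - w a * minor3 b c d x y z"
  by (simp add: eform_Cons[of _ "[b, c, d]"] eform_3 numeral_eq_Suc)

text \<open>\<open>omega_sq\<close> is half of \<open>\<omega> \<and> \<omega>\<close>.\<close>

definition e1_omega :: form where
  "e1_omega = (\<lambda>xs. eform [1, 2, 3] xs + eform [1, 4, 5] xs + eform [1, 6, 7] xs)"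

definition omega_sq :: form where
  "omega_sq = (\<lambda>xs. eform [2, 3, 4, 5] xs + eform [2, 3, 6, 7] xs + eform [4, 5, 6, 7] xs)"

definition e1_VR :: form where
  "e1_VR = (\<lambda>xs. eform [1, 2, 4, 6] xs - eform [1, 2, 5, 7] xs - eform [1, 3, 4, 7] xs
      - eform [1, 3, 5, 6] xs)"

definition e1_VI :: form where
  "e1_VI = (\<lambda>xs. eform [1, 3, 4, 6] xs - eform [1, 3, 5, 7] xs + eform [1, 2, 4, 7] xs
      + eform [1, 2, 5, 6] xs)"

lemma e1_omega_eq: "{x, y, z} \<subseteq> M7 \<Longrightarrow> e1_omega [x, y, z] = x 1 * omega_val y z - y 1 * omega_val x z
    + z 1 * omega_val x y"
  unfolding e1_omega_def by (simp add: eform_3 minor3_def omega_val_def algebra_simps)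

lemma VR_eq: "{x, y, z} \<subseteq> M7 \<Longrightarrow> VR [x, y, z] = VR_val x y z"
  unfolding VR_def by (simp add: eform_3 VR_val_def)

lemma VI_eq: "{x, y, z} \<subseteq> M7 \<Longrightarrow> VI [x, y, z] = VI_val x y z"
  unfolding VI_def by (simp add: eform_3 VI_val_def)

lemma omega_sq_eq: "{x, y, z, w} \<subseteq> M7 \<Longrightarrow> omega_sq [x, y, z, w] = omega_val x y * omega_val z w
    - omega_val x z * omega_val y w + omega_val x w * omega_val y z"
  unfolding omega_sq_def by (simp add: eform_4 minor3_def omega_val_def algebra_simps)

lemma e1_VR_eq: "{x, y, z, w} \<subseteq> M7 \<Longrightarrow> e1_VR [x, y, z, w] = x 1 * VR_val y z w - y 1 * VR_val x z w
    + z 1 * VR_val x y w - w 1 * VR_val x y z"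
  unfolding e1_VR_def by (simp add: eform_4 VR_val_def algebra_simps)

lemma e1_VI_eq: "{x, y, z, w} \<subseteq> M7 \<Longrightarrow> e1_VI [x, y, z, w] = x 1 * VI_val y z w - y 1 * VI_val x z w
    + z 1 * VI_val x y w - w 1 * VI_val x y z"
  unfolding e1_VI_def by (simp add: eform_4 VI_val_def algebra_simps)

section \<open>Exterior derivatives of the invariant forms\<close>

lemma dform_3:
  assumes "{a, b, c, d} \<subseteq> M7"
  shows "dform 3 \<alpha> [a, b, c, d] = - \<alpha> [bracket a b, c, d] + \<alpha> [bracket a c, b, d] - \<alpha> [bracket a d, b, c]
    - \<alpha> [bracket b c, a, d] + \<alpha> [bracket b d, a, c] - \<alpha> [bracket c d, a, b]"
proof -
  have s: "{..<3 + 1::nat} = {0, 1, 2, 3}" "{0<..<4::nat} = {1, 2, 3}" "{1<..<4::nat} = {2, 3}"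
    "{2<..<4::nat} = {3}" "{3<..<4::nat} = {}" by auto
  have u: "[0..<3 + 1] = [0, 1, 2, 3]" by (simp add: upt_rec)
  show ?thesis
    using assms unfolding dform_def restr_def by (simp only: s u) (simp add: s brm_eq nth_Cons')
qed

lemma dform_4:
  assumes "{a, b, c, d, e} \<subseteq> M7"
  shows "dform 4 \<alpha> [a, b, c, d, e] = - \<alpha> [bracket a b, c, d, e] + \<alpha> [bracket a c, b, d, e]
      - \<alpha> [bracket a d, b, c, e]
    + \<alpha> [bracket a e, b, c, d] - \<alpha> [bracket b c, a, d, e] + \<alpha> [bracket b d, a, c, e]
        - \<alpha> [bracket b e, a, c, d]
    - \<alpha> [bracket c d, a, b, e] + \<alpha> [bracket c e, a, b, d] - \<alpha> [bracket d e, a, b, c]"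
proof -
  have s: "{..<4 + 1::nat} = {0, 1, 2, 3, 4}" "{0<..<5::nat} = {1, 2, 3, 4}" "{1<..<5::nat} = {2, 3, 4}"
    "{2<..<5::nat} = {3, 4}" "{3<..<5::nat} = {4}" "{4<..<5::nat} = {}" by auto
  have u: "[0..<4 + 1] = [0, 1, 2, 3, 4]" by (simp add: upt_rec)
  show ?thesis
    using assms unfolding dform_def restr_def by (simp only: s u) (simp add: s brm_eq nth_Cons')
qed

lemma dform_lin: "dform k (\<lambda>xs. a * \<alpha> xs + b * \<beta> xs) = (\<lambda>xs. a * dform k \<alpha> xs + b * dform k \<beta> xs)"
  unfolding dform_def restr_def by (auto simp: sum.distrib sum_distrib_left algebra_simps)

lemma dform_add: "dform k (\<lambda>xs. \<alpha> xs + \<beta> xs) = (\<lambda>xs. dform k \<alpha> xs + dform k \<beta> xs)"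
  using dform_lin[of k 1 \<alpha> 1 \<beta>] by simp

lemma dform_scale: "dform k (\<lambda>xs. a * \<alpha> xs) = (\<lambda>xs. a * dform k \<alpha> xs)"
  using dform_lin[of k a \<alpha> 0 \<alpha>] by simp

lemma dform_zero: "dform k (\<lambda>xs. 0) = (\<lambda>xs. 0)"
  unfolding dform_def restr_def by auto

lemma is_form_e1_omega: "is_form 3 e1_omega" and is_form_VR: "is_form 3 VR" and is_form_VI: "is_form 3 VI"
  and is_form_omega_sq: "is_form 4 omega_sq" and is_form_e1_VR: "is_form 4 e1_VR"
      and is_form_e1_VI: "is_form 4 e1_VI"
proof -
  have 3: "is_form 3 (eform [a, b, c])" for a b c
    using is_form_eform[of "[a, b, c]"] by (simp add: numeral_eq_Suc)
  have 4: "is_form 4 (eform [a, b, c, d])" for a b c d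
    using is_form_eform[of "[a, b, c, d]"] by (simp add: numeral_eq_Suc)
  show "is_form 3 e1_omega" "is_form 3 VR" "is_form 3 VI" "is_form 4 omega_sq" "is_form 4 e1_VR"
      "is_form 4 e1_VI"
    unfolding e1_omega_def VR_def VI_def omega_sq_def e1_VR_def e1_VI_def
        by (intro is_form_add is_form_diff 3 4)+
qed

lemma list_ext_4:
  assumes "\<And>xs. \<not> (length xs = 4 \<and> set xs \<subseteq> M7) \<Longrightarrow> f xs = g xs"
    and "\<And>a b c d. {a, b, c, d} \<subseteq> M7 \<Longrightarrow> f [a, b, c, d] = g [a, b, c, d]"
  shows "f = (g :: form)"
proof
  fix xs show "f xs = g xs"
  proof (cases "length xs = 4 \<and> set xs \<subseteq> M7")
    case True
    then obtain a b c d where "xs = [a, b, c, d]"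
      by (auto simp: numeral_eq_Suc length_Suc_conv)
    then show ?thesis using assms(2) True by simp
  qed (use assms(1) in simp)
qed

lemma list_ext_5:
  assumes "\<And>xs. \<not> (length xs = 5 \<and> set xs \<subseteq> M7) \<Longrightarrow> f xs = g xs"
    and "\<And>a b c d e. {a, b, c, d, e} \<subseteq> M7 \<Longrightarrow> f [a, b, c, d, e] = g [a, b, c, d, e]"
  shows "f = (g :: form)"
proof
  fix xs show "f xs = g xs"
  proof (cases "length xs = 5 \<and> set xs \<subseteq> M7")
    case True
    then obtain a b c d e where "xs = [a, b, c, d, e]"
      by (auto simp: numeral_eq_Suc length_Suc_conv)
    then show ?thesis using assms(2) True by simp
  qed (use assms(1) in simp)
qed

lemma dform_support: "\<not> (length xs = k + 1 \<and> set xs \<subseteq> M7) \<Longrightarrow> dform k \<alpha> xs = 0"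
  unfolding dform_def restr_def by auto

text \<open>This reflects d e^1 = (2/3) omega and d omega = 0: the terms with
  \<open>horiz_inner\<close> cancel by its symmetry, and \<open>omega_sq\<close> is only half of
  omega wedge omega.\<close>

lemma dform_e1_omega: "dform 3 e1_omega = (\<lambda>xs. (4/3) * omega_sq xs)"
proof (rule list_ext_4)
  show "dform 3 e1_omega xs = (4/3) * omega_sq xs" if "\<not> (length xs = 4 \<and> set xs \<subseteq> M7)" for xs
    using dform_support[of xs 3] is_formD0[OF is_form_omega_sq] that by simp
  fix a b c d :: Defs.vec assume M: "{a, b, c, d} \<subseteq> M7"
  show "dform 3 e1_omega [a, b, c, d] = (4/3) * omega_sq [a, b, c, d]"
    using M unfolding dform_3[OF M]
    by (simp add: e1_omega_eq omega_sq_eq bracket_M7 bracket_1 omega_val_bracket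
        omega_val_swap[of a b] omega_val_swap[of a c] omega_val_swap[of a d] omega_val_swap[of b c]
            omega_val_swap[of b d] omega_val_swap[of c d]
        horiz_inner_swap[of a b] horiz_inner_swap[of a c] horiz_inner_swap[of a d] horiz_inner_swap[of
            b c] horiz_inner_swap[of b d] horiz_inner_swap[of c d] algebra_simps)
qed

text \<open>The first coordinate of each argument enters three of the six brackets, with weight 4
  and equal signs once the arguments of \<open>VI_val\<close> are put in order; this gives
  12.\<close>

lemma dform_VR: "dform 3 VR = (\<lambda>xs. - 12 * e1_VI xs)"
proof (rule list_ext_4)
  show "dform 3 VR xs = - 12 * e1_VI xs" if "\<not> (length xs = 4 \<and> set xs \<subseteq> M7)" for xs
    using dform_support[of xs 3] is_formD0[OF is_form_e1_VI] that by simp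
  fix a b c d :: Defs.vec assume M: "{a, b, c, d} \<subseteq> M7"
  have "VI_val c b d = - VI_val b c d" "VI_val d b c = VI_val b c d" "VI_val c a d =
      - VI_val a c d" "VI_val d a c = VI_val a c d"
    "VI_val b a d = - VI_val a b d" "VI_val d a b = VI_val a b d" "VI_val b a c =
        - VI_val a b c" "VI_val c a b = VI_val a b c"
    by (metis VI_val_swap minus_minus)+
  then show "dform 3 VR [a, b, c, d] = - 12 * e1_VI [a, b, c, d]"
    using M unfolding dform_3[OF M]
    by (simp add: VR_eq e1_VI_eq bracket_M7 VR_val_bracket algebra_simps)
qed

lemma dform_VI: "dform 3 VI = (\<lambda>xs. 12 * e1_VR xs)"
proof (rule list_ext_4)
  show "dform 3 VI xs = 12 * e1_VR xs" if "\<not> (length xs = 4 \<and> set xs \<subseteq> M7)" for xs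
    using dform_support[of xs 3] is_formD0[OF is_form_e1_VR] that by simp
  fix a b c d :: Defs.vec assume M: "{a, b, c, d} \<subseteq> M7"
  have "VR_val c b d = - VR_val b c d" "VR_val d b c = VR_val b c d" "VR_val c a d =
      - VR_val a c d" "VR_val d a c = VR_val a c d"
    "VR_val b a d = - VR_val a b d" "VR_val d a b = VR_val a b d" "VR_val b a c =
        - VR_val a b c" "VR_val c a b = VR_val a b c"
    by (metis VR_val_swap minus_minus)+
  then show "dform 3 VI [a, b, c, d] = 12 * e1_VR [a, b, c, d]"
    using M unfolding dform_3[OF M]
    by (simp add: VI_eq e1_VR_eq bracket_M7 VI_val_bracket algebra_simps)
qed

lemma dform_omega_sq: "dform 4 omega_sq = (\<lambda>xs. 0)"
proof (rule list_ext_5)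
  show "dform 4 omega_sq xs = 0" if "\<not> (length xs = 5 \<and> set xs \<subseteq> M7)" for xs
    using dform_support[of xs 4] that by simp
  fix a b c d e :: Defs.vec assume M: "{a, b, c, d, e} \<subseteq> M7"
  show "dform 4 omega_sq [a, b, c, d, e] = 0"
    using M unfolding dform_4[OF M]
    by (simp add: omega_sq_eq bracket_M7 omega_val_bracket
        horiz_inner_swap[of b a] horiz_inner_swap[of c a] horiz_inner_swap[of d a] horiz_inner_swap[of
            e a] horiz_inner_swap[of c b] horiz_inner_swap[of d b] horiz_inner_swap[of e b]
        horiz_inner_swap[of d c] horiz_inner_swap[of e c] horiz_inner_swap[of e d] algebra_simps)
qed

text \<open>The value of \<open>e\<^sup>p \<and> e\<^sup>q \<and> e\<^sup>i \<and> e\<^sup>j \<and> e\<^sup>k\<close> as a sum over (2,3)-shuffles.\<close>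

definition shuffle_2_3 :: "nat \<Rightarrow> nat \<Rightarrow> nat \<Rightarrow> nat \<Rightarrow> nat \<Rightarrow> Defs.vec \<Rightarrow> Defs.vec \<Rightarrow> Defs.vec \<Rightarrow> Defs.vec \<Rightarrow>
    Defs.vec \<Rightarrow> real" where
  "shuffle_2_3 p q i j k a b c d e =
     (a p * b q - a q * b p) * minor3 i j k c d e - (a p * c q - a q * c p) * minor3 i j k b d e
   + (a p * d q - a q * d p) * minor3 i j k b c e - (a p * e q - a q * e p) * minor3 i j k b c d
   + (b p * c q - b q * c p) * minor3 i j k a d e - (b p * d q - b q * d p) * minor3 i j k a c e
   + (b p * e q - b q * e p) * minor3 i j k a c d + (c p * d q - c q * d p) * minor3 i j k a b e
   - (c p * e q - c q * e p) * minor3 i j k a b d + (d p * e q - d q * e p) * minor3 i j k a b c"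

text \<open>A product of covectors with a repeated index vanishes.\<close>

lemma shuffle_2_3_repeat:
  "shuffle_2_3 p q p j k a b c d e = 0" "shuffle_2_3 p q q j k a b c d e = 0"
  "shuffle_2_3 p q i p k a b c d e = 0" "shuffle_2_3 p q i q k a b c d e = 0"
  "shuffle_2_3 p q i j p a b c d e = 0" "shuffle_2_3 p q i j q a b c d e = 0"
  by (simp_all add: shuffle_2_3_def minor3_def algebra_simps)

text \<open>This is omega wedge V_R = 0. Each monomial of omega is a whole pair from 23, 45, 67, and
  each monomial of V_R takes one index from every pair, so every product repeats an index. Grouping
  into shuffles lets this be seen term by term.\<close>

lemma omega_val_wedge_VR_val:
  "omega_val a b * VR_val c d e - omega_val a c * VR_val b d e + omega_val a d * VR_val b c e
      - omega_val a e * VR_val b c d + omega_val b c * VR_val a d e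
   - omega_val b d * VR_val a c e + omega_val b e * VR_val a c d + omega_val c d * VR_val a b e
       - omega_val c e * VR_val a b d + omega_val d e * VR_val a b c = 0"
  (is "?L = 0")
proof -
  let ?S = "\<lambda>p q. shuffle_2_3 p q 2 4 6 a b c d e - shuffle_2_3 p q 2 5 7 a b c d e
      - shuffle_2_3 p q 3 4 7 a b c d e - shuffle_2_3 p q 3 5 6 a b c d e"
  have "?L = ?S 2 3 + ?S 4 5 + ?S 6 7"
    unfolding shuffle_2_3_def omega_val_def VR_val_def by (simp add: algebra_simps)
  then show ?thesis by (simp add: shuffle_2_3_repeat)
qed

lemma omega_val_wedge_VI_val:
  "omega_val a b * VI_val c d e - omega_val a c * VI_val b d e + omega_val a d * VI_val b c e
      - omega_val a e * VI_val b c d + omega_val b c * VI_val a d e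
   - omega_val b d * VI_val a c e + omega_val b e * VI_val a c d + omega_val c d * VI_val a b e
       - omega_val c e * VI_val a b d + omega_val d e * VI_val a b c = 0"
  (is "?L = 0")
proof -
  let ?S = "\<lambda>p q. shuffle_2_3 p q 3 4 6 a b c d e - shuffle_2_3 p q 3 5 7 a b c d e
      + shuffle_2_3 p q 2 4 7 a b c d e + shuffle_2_3 p q 2 5 6 a b c d e"
  have "?L = ?S 2 3 + ?S 4 5 + ?S 6 7"
    unfolding shuffle_2_3_def omega_val_def VI_val_def by (simp add: algebra_simps)
  then show ?thesis by (simp add: shuffle_2_3_repeat)
qed

text \<open>By the Leibniz rule, d e^1 wedge V_R leaves (2/3) omega wedge V_R, while d V_R already
  contains e^1 and is killed by another factor e^1. Hence the \<open>VI_val\<close> terms cancel and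
  the previous identity applies.\<close>

lemma dform_e1_VR: "dform 4 e1_VR = (\<lambda>xs. 0)"
proof (rule list_ext_5)
  show "dform 4 e1_VR xs = 0" if "\<not> (length xs = 5 \<and> set xs \<subseteq> M7)" for xs
    using dform_support[of xs 4] that by simp
  fix a b c d e :: Defs.vec assume M: "{a, b, c, d, e} \<subseteq> M7"
  have "dform 4 e1_VR [a, b, c, d, e] = (2/3) *
   (omega_val a b * VR_val c d e - omega_val a c * VR_val b d e + omega_val a d * VR_val b c e
       - omega_val a e * VR_val b c d + omega_val b c * VR_val a d e
   - omega_val b d * VR_val a c e + omega_val b e * VR_val a c d + omega_val c d * VR_val a b e
       - omega_val c e * VR_val a b d + omega_val d e * VR_val a b c)"
    using M unfolding dform_4[OF M]
    by (simp add: e1_VR_eq bracket_M7 VR_val_bracket bracket_1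
       VI_val_swap(1)[of b a] VI_val_swap(1)[of c a] VI_val_swap(1)[of d a] VI_val_swap(1)[of e a]
       VI_val_swap(1)[of c b] VI_val_swap(1)[of d b] VI_val_swap(1)[of e b] VI_val_swap(1)[of d c]
           VI_val_swap(1)[of e c] VI_val_swap(1)[of e d]
       VI_val_swap(2)[of _ b a] VI_val_swap(2)[of _ c a] VI_val_swap(2)[of _ d a] VI_val_swap(2)[of _ e a]
       VI_val_swap(2)[of _ c b] VI_val_swap(2)[of _ d b] VI_val_swap(2)[of _ e b] VI_val_swap(2)[of _
           d c] VI_val_swap(2)[of _ e c] VI_val_swap(2)[of _ e d]
       algebra_simps)
  then show "dform 4 e1_VR [a, b, c, d, e] = 0" by (simp only: omega_val_wedge_VR_val)
qed

lemma dform_e1_VI: "dform 4 e1_VI = (\<lambda>xs. 0)"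
proof (rule list_ext_5)
  show "dform 4 e1_VI xs = 0" if "\<not> (length xs = 5 \<and> set xs \<subseteq> M7)" for xs
    using dform_support[of xs 4] that by simp
  fix a b c d e :: Defs.vec assume M: "{a, b, c, d, e} \<subseteq> M7"
  have "dform 4 e1_VI [a, b, c, d, e] = (2/3) *
   (omega_val a b * VI_val c d e - omega_val a c * VI_val b d e + omega_val a d * VI_val b c e
       - omega_val a e * VI_val b c d + omega_val b c * VI_val a d e
   - omega_val b d * VI_val a c e + omega_val b e * VI_val a c d + omega_val c d * VI_val a b e
       - omega_val c e * VI_val a b d + omega_val d e * VI_val a b c)"
    using M unfolding dform_4[OF M]
    by (simp add: e1_VI_eq bracket_M7 VI_val_bracket bracket_1
       VR_val_swap(1)[of b a] VR_val_swap(1)[of c a] VR_val_swap(1)[of d a] VR_val_swap(1)[of e a]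
       VR_val_swap(1)[of c b] VR_val_swap(1)[of d b] VR_val_swap(1)[of e b] VR_val_swap(1)[of d c]
           VR_val_swap(1)[of e c] VR_val_swap(1)[of e d]
       VR_val_swap(2)[of _ b a] VR_val_swap(2)[of _ c a] VR_val_swap(2)[of _ d a] VR_val_swap(2)[of _ e a]
       VR_val_swap(2)[of _ c b] VR_val_swap(2)[of _ d b] VR_val_swap(2)[of _ e b] VR_val_swap(2)[of _
           d c] VR_val_swap(2)[of _ e c] VR_val_swap(2)[of _ e d]
       algebra_simps)
  then show "dform 4 e1_VI [a, b, c, d, e] = 0" by (simp only: omega_val_wedge_VI_val)
qed

subsection \<open>Invariant forms\<close>

lemma upt_1_8: "[1..<8] = [1, 2, 3, 4, 5, 6, 7::nat]"
  by (simp add: upt_rec)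

lemma shuffle_sign_signed_sort:
  assumes "snd (signed_sort (I @ compl_list I)) = [1..<8]"
  shows "shuffle_sign I = fst (signed_sort (I @ compl_list I))"
  unfolding shuffle_sign_def by (subst eform_signed_sort) (simp only: assms eform_top_basis mult_1_right)

lemma diag_star_diff: "diag_star D v k (\<lambda>xs. \<alpha> xs - \<beta> xs) = (\<lambda>xs. diag_star D v k \<alpha> xs
    - diag_star D v k \<beta> xs)"
  using diag_star_add[of D v k \<alpha> "\<lambda>xs. -1 * \<beta> xs"] diag_star_scale[of D v k "-1" \<beta>] by simp

definition met_diag :: "real \<Rightarrow> real \<Rightarrow> nat \<Rightarrow> real" where
  "met_diag p q = (\<lambda>n. if n = 1 then p else q)"

text \<open>The metric only separates \<open>e_1\<close> from the other six directions, so all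
  monomials of one form carry the same weight and the star respects the invariant
  combinations.\<close>

lemma diag_star_basis_forms:
  shows diag_star_omega_sq: "diag_star (met_diag p q) v 4 omega_sq
      = (\<lambda>xs. v / (q * q * q * q) * e1_omega xs)"
    and diag_star_e1_VR: "diag_star (met_diag p q) v 4 e1_VR = (\<lambda>xs. v / (p * q * q * q) * VI xs)"
    and diag_star_e1_VI: "diag_star (met_diag p q) v 4 e1_VI = (\<lambda>xs. - v / (p * q * q * q) * VR xs)"
    and diag_star_e1_omega: "diag_star (met_diag p q) v 3 e1_omega = (\<lambda>xs. v / (p * q * q) * omega_sq xs)"
    and diag_star_VR: "diag_star (met_diag p q) v 3 VR = (\<lambda>xs. - v / (q * q * q) * e1_VI xs)"
    and diag_star_VI: "diag_star (met_diag p q) v 3 VI = (\<lambda>xs. v / (q * q * q) * e1_VR xs)"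
  unfolding omega_sq_def e1_omega_def e1_VR_def e1_VI_def VR_def VI_def diag_star_add diag_star_diff
  by (auto simp: fun_eq_iff diag_star_eform sorted_lists_def shuffle_sign_signed_sort compl_list_def
      upt_1_8 inv_weight_simps met_diag_def
      add_divide_distrib diff_divide_distrib algebra_simps)

definition inv_form :: "real \<Rightarrow> real \<Rightarrow> real \<Rightarrow> form" where
  "inv_form A x y = (\<lambda>xs. A * e1_omega xs + x * VR xs + y * VI xs)"

lemma is_form_inv_form: "is_form 3 (inv_form A x y)"
  unfolding inv_form_def by (intro is_form_add is_form_scale is_form_e1_omega is_form_VR is_form_VI)

lemma dform_inv_form: "dform 3 (inv_form A x y) = (\<lambda>xs. (4/3 * A) * omega_sq xs + (12 * y) * e1_VR xs
    + (- 12 * x) * e1_VI xs)"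
  unfolding inv_form_def dform_add dform_scale dform_e1_omega dform_VR dform_VI
      by (auto simp: algebra_simps)

lemma diag_star_dform_inv_form:
  "diag_star (met_diag p q) v 4 (dform 3 (inv_form A x y))
      = inv_form (4/3 * (v / (q * q * q * q)) * A) (12 * (v / (p * q * q * q)) * x) (12 * (v / (p * q
      * q * q)) * y)"
  unfolding dform_inv_form diag_star_add diag_star_scale diag_star_omega_sq diag_star_e1_VR
      diag_star_e1_VI by (auto simp: inv_form_def algebra_simps)

text \<open>Star after d multiplies each coefficient by a factor linear in \<open>v\<close>.
  Applying it twice squares the factors, so the orientation drops out of the Laplacian. The second
  summand vanishes because the star of the form is closed.\<close>

lemma laplacian_inv_form:
  assumes pos: "p > 0" "q > 0" and m: "metvol (inv_form A x y)
      = (diag_met (met_diag p q), \<lambda>xs. v * eform [1..<8] xs)"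
  shows "laplacian (inv_form A x y) = inv_form (16/9 * (v / (q * q * q * q))\<^sup>2 * A) (144 * (v / (p * q
      * q * q))\<^sup>2 * x) (144 * (v / (p * q * q * q))\<^sup>2 * y)"
proof -
  have D: "\<forall>n\<in>{1..7}. met_diag p q n > 0" using pos by (simp add: met_diag_def)
  have W: "is_form 4 (dform 3 (inv_form A x y))" for A x y
    unfolding dform_inv_form by (intro is_form_add is_form_scale is_form_omega_sq is_form_e1_VR
        is_form_e1_VI)
  have h4: "hodge (diag_met (met_diag p q)) (\<lambda>xs. v * eform [1..<8] xs) 4 (dform 3 (inv_form A x y))
      = diag_star (met_diag p q) v 4 (dform 3 (inv_form A x y))" for A x y
    by (rule hodge_eq_diag_star[OF D _ W]) simp
  have "hodge (diag_met (met_diag p q)) (\<lambda>xs. v * eform [1..<8] xs) 3 (inv_form A x y)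
      = diag_star (met_diag p q) v 3 (inv_form A x y)"
    by (rule hodge_eq_diag_star[OF D _ is_form_inv_form]) simp
  moreover have "dform 4 (diag_star (met_diag p q) v 3 (inv_form A x y)) = (\<lambda>xs. 0)"
    unfolding inv_form_def diag_star_add diag_star_scale diag_star_e1_omega diag_star_VR diag_star_VI
        dform_add dform_scale dform_omega_sq dform_e1_VR dform_e1_VI by simp
  ultimately have co: "dform 4 (hodge (diag_met (met_diag p q)) (\<lambda>xs. v * eform [1..<8] xs) 3
      (inv_form A x y)) = (\<lambda>xs. 0)"
    by simp
  have h5: "hodge (diag_met (met_diag p q)) (\<lambda>xs. v * eform [1..<8] xs) 5 (\<lambda>xs. 0) = (\<lambda>xs. 0)"
    by (subst hodge_eq_diag_star[OF D _ is_form_zero]) (simp_all add: diag_star_zero)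
  show ?thesis
    unfolding laplacian_def m Let_def fst_conv snd_conv co h5 dform_zero h4 diag_star_dform_inv_form
        diff_zero
    by (simp add: inv_form_def power2_eq_square mult_ac)
qed

text \<open>On the last six coordinates the isotropy action is the standard one of \<open>SU(3)\<close> on \<open>\<complex>\<^sup>3\<close>.\<close>

definition cplx_coord :: "Defs.vec \<Rightarrow> nat \<Rightarrow> complex" where
  "cplx_coord x i = Complex (x (2 * i + 2)) (x (2 * i + 3))"

lemma cplx_coord_simps:
  "cplx_coord x 0 = Complex (x 2) (x 3)" "cplx_coord x 1 = Complex (x 4) (x 5)" "cplx_coord x 2
      = Complex (x 6) (x 7)"
  by (simp_all add: cplx_coord_def numeral_eq_Suc One_nat_def)

definition adv_coords :: "cmat \<Rightarrow> Defs.vec \<Rightarrow> Defs.vec" where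
  "adv_coords h x = (\<lambda>n. if n = 1 then x 1
     else if n \<in> {2, 4, 6} then Re (\<Sum>k<3. h (n div 2 - 1) k * cplx_coord x k)
     else if n \<in> {3, 5, 7} then Im (\<Sum>k<3. h (n div 2 - 1) k * cplx_coord x k) else 0)"

lemma adv_coords_M7: "adv_coords h x \<in> M7"
  by (auto simp: M7_def adv_coords_def)

lemma cplx_coord_adv_coords: "i < 3 \<Longrightarrow> cplx_coord (adv_coords h x) i = (\<Sum>k<3. h i k * cplx_coord x k)"
proof -
  assume "i < 3"
  then have "i = 0 \<or> i = 1 \<or> i = 2" by auto
  then show ?thesis by (auto simp: cplx_coord_def adv_coords_def complex_eq_iff)
qed

lemma adv_coords_1: "adv_coords h x 1 = x 1"
  by (simp add: adv_coords_def)

lemma lessThan_3: "{..<3::nat} = {0, 1, 2}" by auto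

lemma SU3_rows: "h \<in> SU3 \<Longrightarrow> i < 3 \<Longrightarrow> j < 3 \<Longrightarrow> (\<Sum>k<3. h i k * cnj (h j k)) = (if i = j then 1 else 0)"
  by (simp add: SU3_def)

lemma emb_cplx_coord:
  "emb x 0 0 = Complex 0 (3 * x 1)"
  "i < 3 \<Longrightarrow> emb x (Suc i) 0 = cplx_coord x i"
  "i < 3 \<Longrightarrow> emb x 0 (Suc i) = - cnj (cplx_coord x i)"
  "i < 3 \<Longrightarrow> j < 3 \<Longrightarrow> emb x (Suc i) (Suc j) = (if i = j then Complex 0 (- x 1) else 0)"
proof -
  show "emb x 0 0 = Complex 0 (3 * x 1)" by (simp add: emb_eq)
  show "emb x (Suc i) 0 = cplx_coord x i" if "i < 3"
  proof -
    have "i = 0 \<or> i = 1 \<or> i = 2" using that by auto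
    then show ?thesis by (auto simp: emb_eq cplx_coord_def numeral_eq_Suc One_nat_def)
  qed
  show "emb x 0 (Suc i) = - cnj (cplx_coord x i)" if "i < 3"
  proof -
    have "i = 0 \<or> i = 1 \<or> i = 2" using that by auto
    then show ?thesis by (auto simp: emb_eq cplx_coord_def complex_eq_iff numeral_eq_Suc One_nat_def)
  qed
  show "emb x (Suc i) (Suc j) = (if i = j then Complex 0 (- x 1) else 0)" if "i < 3" "j < 3"
  proof -
    have "Suc i \<in> {1, 2, 3}" using that by auto
    then show ?thesis by (simp add: emb_eq)
  qed
qed

lemma sum_lessThan_4_split: "(\<Sum>k<4. f k) = f 0 + (\<Sum>k<3. f (Suc k))"
  using sum.lessThan_Suc_shift[of f 3] by simp

lemma embH_simps:
  "embH h 0 0 = 1" "embH h 0 (Suc i) = 0" "embH h (Suc i) 0 = 0"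
  "i < 3 \<Longrightarrow> j < 3 \<Longrightarrow> embH h (Suc i) (Suc j) = h i j"
  by (auto simp: embH_def)

lemma adv_eq:
  assumes h: "h \<in> SU3"
  shows "adv h x = adv_coords h x"
  unfolding adv_def
proof (rule the_equality)
  let ?P = "mmul (mmul (embH h) (emb x)) (madj (embH h))"
  note simps = mmul_def madj_def sum_lessThan_4_split embH_simps emb_cplx_coord
  have 00: "?P 0 0 = emb (adv_coords h x) 0 0"
    by (simp add: simps adv_coords_1)
  have i0: "?P (Suc i) 0 = emb (adv_coords h x) (Suc i) 0" if "i < 3" for i
    using that by (simp add: simps cplx_coord_adv_coords)
  have zi: "?P 0 (Suc i) = emb (adv_coords h x) 0 (Suc i)" if "i < 3" for i
    using that by (simp add: simps cplx_coord_adv_coords sum_negf mult.commute)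
  \<comment> \<open>The lower block of \<open>emb x\<close> is a scalar matrix, so conjugation by
    \<open>h\<close> leaves it unchanged by orthonormality of the rows.\<close>
  have ij: "?P (Suc i) (Suc j) = emb (adv_coords h x) (Suc i) (Suc j)" if "i < 3" "j < 3" for i j
  proof -
    have "?P (Suc i) (Suc j) = (\<Sum>k<3. (\<Sum>l<3. h i l * (if l
        = k then Complex 0 (- x 1) else 0)) * cnj (h j k))"
      using that by (simp add: simps)
    also have "\<dots> = Complex 0 (- x 1) * (\<Sum>k<3. h i k * cnj (h j k))"
      unfolding sum_distrib_left
    proof (rule sum.cong[OF refl])
      fix k :: nat assume "k \<in> {..<3}"
      moreover have "(\<Sum>l<3. h i l * (if l = k then Complex 0 (- x 1) else 0)) = (\<Sum>l<3. if l
          = k then h i k * Complex 0 (- x 1) else 0)"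
        by (rule sum.cong) auto
      ultimately show "(\<Sum>l<3. h i l * (if l = k then Complex 0 (- x 1) else 0)) * cnj (h j k)
          = Complex 0 (- x 1) * (h i k * cnj (h j k))"
        by simp
    qed
    finally show ?thesis
      using that SU3_rows[OF h that] by (simp add: emb_cplx_coord adv_coords_1)
  qed
  have hi: "?P i j = emb (adv_coords h x) i j" if "i \<ge> 4 \<or> j \<ge> 4" for i j
    using that by (auto simp: mmul_def madj_def embH_def emb_eq)
  have "?P i j = emb (adv_coords h x) i j" for i j
  proof (cases "i \<ge> 4 \<or> j \<ge> 4")
    case False
    then show ?thesis
      using 00 i0[of "i - 1"] zi[of "j - 1"] ij[of "i - 1" "j - 1"] by (cases i; cases j) auto
  qed (use hi in auto)
  then show P: "adv_coords h x \<in> M7 \<and> emb (adv_coords h x) = ?P"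
    by (auto simp: adv_coords_M7 fun_eq_iff)
  show "v = adv_coords h x" if "v \<in> M7 \<and> emb v = ?P" for v
    by (rule emb_inj) (use that P in auto)
qed

text \<open>\<open>SU3\<close> is defined through orthonormal rows, whereas invariance of the
  Hermitian form needs orthonormal columns; a right inverse of a square matrix is also a left
  inverse.\<close>

lemma SU3_cols:
  assumes h: "h \<in> SU3" and ij: "i < 3" "j < 3"
  shows "(\<Sum>k<3. cnj (h k i) * h k j) = (if i = j then 1 else 0)"
proof -
  let ?A = "mat 3 3 (\<lambda>(i, j). h i j)" and ?B = "mat 3 3 (\<lambda>(i, j). cnj (h j i))"
  have "?A * ?B = 1\<^sub>m 3"
    by (intro eq_matI) (auto simp: scalar_prod_def SU3_rows[OF h] simp flip: lessThan_atLeast0)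
  then have "?B * ?A = 1\<^sub>m 3"
    by (rule mat_mult_left_right_inverse[rotated 2]) auto
  then have "(?B * ?A) $$ (i, j) = 1\<^sub>m 3 $$ (i, j)" by simp
  then show ?thesis using ij by (simp add: scalar_prod_def lessThan_atLeast0)
qed

lemma omega_val_cplx_coord: "omega_val x y = Im (\<Sum>c<3. cnj (cplx_coord x c) * cplx_coord y c)"
  by (simp add: lessThan_3 omega_val_def cplx_coord_simps)

lemma omega_val_adv_coords:
  assumes "h \<in> SU3"
  shows "omega_val (adv_coords h x) (adv_coords h y) = omega_val x y"
proof -
  have "(\<Sum>c<3. cnj (cplx_coord (adv_coords h x) c) * cplx_coord (adv_coords h y) c)
      = (\<Sum>c<3. \<Sum>k<3. \<Sum>l<3. (cnj (h c k) * h c l) * (cnj (cplx_coord x k) * cplx_coord y l))"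
    by (rule sum.cong[OF refl]) (simp only: lessThan_iff cplx_coord_adv_coords cnj_sum
        complex_cnj_mult sum_product, simp add: mult_ac)
  also have "\<dots> = (\<Sum>k<3. \<Sum>l<3. \<Sum>c<3. (cnj (h c k) * h c l) * (cnj (cplx_coord x k) * cplx_coord y l))"
    by (rule trans[OF sum.swap]) (rule sum.cong[OF refl], rule sum.swap)
  also have "\<dots> = (\<Sum>k<3. \<Sum>l<3. if l = k then cnj (cplx_coord x k) * cplx_coord y k else 0)"
    by (intro sum.cong refl) (auto simp: sum_distrib_right[symmetric] SU3_cols[OF assms])
  also have "\<dots> = (\<Sum>k<3. cnj (cplx_coord x k) * cplx_coord y k)"
    by simp
  finally show ?thesis by (simp add: omega_val_cplx_coord)
qed

lemma ldet_3: "ldet 3 M = M 0 0 * (M 1 1 * M 2 2 - M 2 1 * M 1 2) - M 1 0 * (M 0 1 * M 2 2 - M 2 1 * M 0 2)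
    + M 2 0 * (M 0 1 * M 1 2 - M 1 1 * M 0 2)"
  by (simp add: ldet_Suc ldet_0 numeral_eq_Suc One_nat_def algebra_simps)

lemma VR_val_VI_val_cplx_coord: "Complex (VR_val x y z) (VI_val x y z)
    = ldet 3 (\<lambda>i j. cplx_coord ([x, y, z] ! j) i)"
  unfolding ldet_3 by (simp add: complex_eq_iff cplx_coord_simps nth_Cons' VR_val_def VI_val_def
      minor3_def algebra_simps)

text \<open>The action multiplies the matrix of complex coordinates by \<open>h\<close> from the
  left, so its determinant is multiplied by det h = 1.\<close>

lemma VR_val_VI_val_adv_coords:
  assumes "h \<in> SU3"
  shows "VR_val (adv_coords h x) (adv_coords h y) (adv_coords h z)
      = VR_val x y z" "VI_val (adv_coords h x) (adv_coords h y) (adv_coords h z) = VI_val x y z"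
proof -
  have "ldet 3 (\<lambda>i j. cplx_coord ([adv_coords h x, adv_coords h y, adv_coords h z] ! j) i)
      = ldet 3 (\<lambda>i j. \<Sum>k<3. h i k * cplx_coord ([x, y, z] ! j) k)"
  proof (rule ldet_cong)
    fix i j :: nat assume ij: "i < 3" "j < 3"
    have "[adv_coords h x, adv_coords h y, adv_coords h z] ! j = adv_coords h ([x, y, z] ! j)"
      using nth_map[of j "[x, y, z]" "adv_coords h"] ij by simp
    then show "cplx_coord ([adv_coords h x, adv_coords h y, adv_coords h z] ! j) i
        = (\<Sum>k<3. h i k * cplx_coord ([x, y, z] ! j) k)"
      using cplx_coord_adv_coords[OF ij(1)] by simp
  qed
  also have "\<dots> = ldet 3 (\<lambda>i j. cplx_coord ([x, y, z] ! j) i)"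
    unfolding ldet_mult using assms by (simp add: SU3_def)
  finally show "VR_val (adv_coords h x) (adv_coords h y) (adv_coords h z)
      = VR_val x y z" "VI_val (adv_coords h x) (adv_coords h y) (adv_coords h z) = VI_val x y z"
    unfolding VR_val_VI_val_cplx_coord[symmetric] by auto
qed

lemma invariant_inv_form: "invariant 3 (inv_form A x y)"
  unfolding invariant_def
proof (intro ballI allI impI)
  fix h and xs :: "Defs.vec list" assume h: "h \<in> SU3" and xs: "length xs = 3 \<and> set xs \<subseteq> M7"
  then obtain a b c where abc: "xs = [a, b, c]" "{a, b, c} \<subseteq> M7"
    by (auto simp: numeral_eq_Suc length_Suc_conv)
  then show "inv_form A x y (map (adv h) xs) = inv_form A x y xs"
    using e1_omega_eq[of a b c] VR_eq[of a b c] VI_eq[of a b c] e1_omega_eq[of "adv_coords h a"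
        "adv_coords h b" "adv_coords h c"]
      VR_eq[of "adv_coords h a" "adv_coords h b" "adv_coords h c"] VI_eq[of "adv_coords h a"
          "adv_coords h b" "adv_coords h c"]
    by (simp add: inv_form_def adv_eq[OF h] adv_coords_M7 adv_coords_1 omega_val_adv_coords[OF h]
        VR_val_VI_val_adv_coords[OF h])
qed

section \<open>Reduction of an invariant form to three coefficients\<close>

lemma form_scale_slot:
  assumes "is_form k \<alpha>" "length xs = k" "set xs \<subseteq> M7" "i < k" "u \<in> M7"
  shows "\<alpha> (xs[i := (\<lambda>m. s * u m)]) = s * \<alpha> (xs[i := u])"
  using is_form_lin_slot[OF assms assms(5), of s 0] by (simp add: lin_def)

lemma form_scaled_basis_3:
  assumes f: "is_form 3 \<phi>" and n: "a \<in> {1..7}" "b \<in> {1..7}" "c \<in> {1..7}"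
  shows "\<phi> [\<lambda>m. s * basis_vec a m, \<lambda>m. t * basis_vec b m, \<lambda>m. u * basis_vec c m]
      = s * t * u * \<phi> (map basis_vec [a, b, c])"
proof -
  have e: "basis_vec a \<in> M7" "basis_vec b \<in> M7" "basis_vec c \<in> M7" using n basis_vec_M7 by auto
  have s: "(\<lambda>m. r * w m) \<in> M7" if "w \<in> M7" for r w using that by (auto simp: M7_def)
  have "\<phi> [\<lambda>m. s * basis_vec a m, \<lambda>m. t * basis_vec b m, \<lambda>m. u * basis_vec c m]
      = s * \<phi> [basis_vec a, \<lambda>m. t * basis_vec b m, \<lambda>m. u * basis_vec c m]"
    using form_scale_slot[OF f, of "[basis_vec a, \<lambda>m. t * basis_vec b m, \<lambda>m. u * basis_vec c m]" 0
        "basis_vec a" s] e s by simp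
  also have "\<phi> [basis_vec a, \<lambda>m. t * basis_vec b m, \<lambda>m. u * basis_vec c m]
      = t * \<phi> [basis_vec a, basis_vec b, \<lambda>m. u * basis_vec c m]"
    using form_scale_slot[OF f, of "[basis_vec a, basis_vec b, \<lambda>m. u * basis_vec c m]" 1 "basis_vec b"
        t] e s by (simp add: One_nat_def)
  also have "\<phi> [basis_vec a, basis_vec b, \<lambda>m. u * basis_vec c m]
      = u * \<phi> [basis_vec a, basis_vec b, basis_vec c]"
    using form_scale_slot[OF f, of "[basis_vec a, basis_vec b, basis_vec c]" 2 "basis_vec c" u] e s
        by (simp add: numeral_2_eq_2)
  finally show ?thesis by simp
qed

lemma M7_eqI:
  assumes "u \<in> M7" "w \<in> M7" "\<And>n. n \<in> {1..7} \<Longrightarrow> u n = w n"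
  shows "u = w"
proof
  fix n show "u n = w n" using assms by (cases "n \<in> {1..7}") (auto simp: M7_def)
qed

text \<open>A group element that permutes the coordinate vectors up to scalars turns invariance into
  an equation between two single coefficients.\<close>

lemma invariant_monomial:
  assumes f: "is_form 3 \<phi>" "invariant 3 \<phi>" and h: "h \<in> SU3"
    and t: "\<And>n. n \<in> {1..7} \<Longrightarrow> t n \<in> {1..7}"
    and st: "\<And>n m. n \<in> {1..7} \<Longrightarrow> m \<in> {1..7} \<Longrightarrow> adv_coords h (basis_vec n) m = s n * basis_vec (t n) m"
    and abc: "a \<in> {1..7}" "b \<in> {1..7}" "c \<in> {1..7}"
  shows "\<phi> (map basis_vec [a, b, c]) = s a * s b * s c * \<phi> (map basis_vec [t a, t b, t c])"
proof -
  have ae: "adv_coords h (basis_vec n) = (\<lambda>m. s n * basis_vec (t n) m)" if "n \<in> {1..7}" for n :: nat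
    by (rule M7_eqI[OF adv_coords_M7]) (use t[OF that] st[OF that] in \<open>auto simp: M7_def basis_vec_def\<close>)
  have "\<phi> (map basis_vec [a, b, c]) = \<phi> (map (adv h) (map basis_vec [a, b, c]))"
    using f(2) h abc basis_vec_M7[of a] basis_vec_M7[of b] basis_vec_M7[of c]
    unfolding invariant_def by (elim ballE[of _ _ h] allE[of _ "map basis_vec [a, b, c]"]) auto
  also have "map (adv h) (map basis_vec [a, b, c])
      = [\<lambda>m. s a * basis_vec (t a) m, \<lambda>m. s b * basis_vec (t b) m, \<lambda>m. s c * basis_vec (t c) m]"
    using abc by (simp add: adv_eq[OF h] ae)
  also have "\<phi> \<dots> = s a * s b * s c * \<phi> (map basis_vec [t a, t b, t c])"
    by (rule form_scaled_basis_3[OF f(1)]) (use t abc in auto)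
  finally show ?thesis .
qed

definition hdiag :: "complex \<Rightarrow> complex \<Rightarrow> complex \<Rightarrow> cmat" where
  "hdiag \<alpha> \<beta> \<gamma> = (\<lambda>i j. if i \<noteq> j then 0 else if i = 0 then \<alpha> else if i = 1 then \<beta> else \<gamma>)"

definition hcyc :: cmat where
  "hcyc = (\<lambda>i j. if i = (j + 1) mod 3 then 1 else 0)"

lemma all_less_3: "(\<forall>i<3::nat. P i) \<longleftrightarrow> P 0 \<and> P 1 \<and> P 2"
proof -
  have "i < 3 \<longleftrightarrow> i = 0 \<or> i = 1 \<or> i = 2" for i :: nat by auto
  then show ?thesis by auto
qed

lemma hdiag_SU3:
  "\<alpha> * cnj \<alpha> = 1 \<Longrightarrow> \<beta> * cnj \<beta> = 1 \<Longrightarrow> \<gamma> * cnj \<gamma> = 1 \<Longrightarrow> \<alpha> * \<beta> * \<gamma> = 1 \<Longrightarrow> hdiag \<alpha> \<beta> \<gamma> \<in> SU3"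
  unfolding SU3_def mem_Collect_eq all_less_3 ldet_3 lessThan_3 by (simp add: hdiag_def mult.assoc)

lemma hcyc_SU3: "hcyc \<in> SU3"
  unfolding SU3_def mem_Collect_eq all_less_3 ldet_3 lessThan_3 by (simp add: hcyc_def)

lemma sorted_lists_3_cases:
  assumes "I \<in> sorted_lists 3"
  obtains a b c where "I = [a, b, c]" "1 \<le> a" "a < b" "b < c" "c \<le> 7"
proof -
  obtain a b c where "I = [a, b, c]"
    using assms by (auto simp: sorted_lists_def numeral_eq_Suc length_Suc_conv)
  then show ?thesis using assms that[of a b c] by (auto simp: sorted_lists_def)
qed

lemma zero_if_odd_signs:
  fixes x :: real
  assumes "x = (if P then -1 else 1) * (if Q then -1 else 1) * (if R then -1 else 1) * x"
  shows "(P \<noteq> (Q \<noteq> R)) \<longrightarrow> x = 0"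
  using assms by (cases P; cases Q; cases R) auto

text \<open>The elements diag(-1, -1, 1) and diag(1, -1, -1) reverse the coordinate vectors 2 to 5
  and 4 to 7. The nested inequalities say that an odd number of indices is reversed, and then the
  coefficient equals its own negative.\<close>

lemma invariant_form_zero:
  assumes f: "is_form 3 \<phi>" "invariant 3 \<phi>" and abc: "a \<in> {1..7}" "b \<in> {1..7}" "c \<in> {1..7}"
    and odd: "((a \<in> {2,3,4,5}) \<noteq> ((b \<in> {2,3,4,5}) \<noteq> (c \<in> {2,3,4,5}))) \<or> ((a \<in> {4,5,6,7}) \<noteq> ((b \<in>
        {4,5,6,7}) \<noteq> (c \<in> {4,5,6,7})))"
  shows "\<phi> (map basis_vec [a, b, c]) = 0"
proof -
  note aexp_simps = adv_coords_def lessThan_3 cplx_coord_simps hdiag_def basis_vec_def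
  have s1: "\<phi> (map basis_vec [a, b, c]) = (if a \<in> {2,3,4,5} then -1 else 1) * (if b \<in> {2,3,4,5} then
      -1 else 1) * (if c \<in> {2,3,4,5} then -1 else 1) * \<phi> (map basis_vec [a, b, c])"
    if "a \<in> {1..7}" "b \<in> {1..7}" "c \<in> {1..7}" for a b c
    using that
  proof (rule invariant_monomial[OF f, where t = "\<lambda>n. n" and s
      = "\<lambda>n. if n \<in> {2,3,4,5} then -1 else 1", rotated 3])
    show "hdiag (-1) (-1) 1 \<in> SU3" by (rule hdiag_SU3) simp_all
    show "n \<in> {1..7}" if "n \<in> {1..7}" for n :: nat using that .
    show "adv_coords (hdiag (-1) (-1) 1) (basis_vec n) m
        = (\<lambda>n. if n \<in> {2,3,4,5} then -1 else 1) n * basis_vec n m" if "n \<in> {1..7}" "m \<in> {1..7}" for n m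
      using that unfolding atLeastAtMost_1_7 by (elim insertE emptyE; simp add: aexp_simps)
  qed
  have s2: "\<phi> (map basis_vec [a, b, c]) = (if a \<in> {4,5,6,7} then -1 else 1) * (if b \<in> {4,5,6,7} then
      -1 else 1) * (if c \<in> {4,5,6,7} then -1 else 1) * \<phi> (map basis_vec [a, b, c])"
    if "a \<in> {1..7}" "b \<in> {1..7}" "c \<in> {1..7}" for a b c
    using that
  proof (rule invariant_monomial[OF f, where t = "\<lambda>n. n" and s
      = "\<lambda>n. if n \<in> {4,5,6,7} then -1 else 1", rotated 3])
    show "hdiag 1 (-1) (-1) \<in> SU3" by (rule hdiag_SU3) simp_all
    show "n \<in> {1..7}" if "n \<in> {1..7}" for n :: nat using that .
    show "adv_coords (hdiag 1 (-1) (-1)) (basis_vec n) m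
        = (\<lambda>n. if n \<in> {4,5,6,7} then -1 else 1) n * basis_vec n m" if "n \<in> {1..7}" "m \<in> {1..7}" for n m
      using that unfolding atLeastAtMost_1_7 by (elim insertE emptyE; simp add: aexp_simps)
  qed
  show ?thesis
    using odd zero_if_odd_signs[OF s1[OF abc]] zero_if_odd_signs[OF s2[OF abc]] by argo
qed

lemma basis_vec_apply: "basis_vec n m = (if m = n then 1 else 0)"
  by (simp add: basis_vec_def)

lemma inv_form_basis_vec:
  assumes "a \<in> {1..7}" "b \<in> {1..7}" "c \<in> {1..7}"
  shows "inv_form A x y [basis_vec a, basis_vec b, basis_vec c]
      = A * (basis_vec a 1 * omega_val (basis_vec b) (basis_vec c)
      - basis_vec b 1 * omega_val (basis_vec a) (basis_vec c)
      + basis_vec c 1 * omega_val (basis_vec a) (basis_vec b))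
     + x * VR_val (basis_vec a) (basis_vec b) (basis_vec c)
         + y * VI_val (basis_vec a) (basis_vec b) (basis_vec c)"
proof -
  have M: "{basis_vec a, basis_vec b, basis_vec c} \<subseteq> M7" using assms basis_vec_M7 by auto
  show ?thesis using e1_omega_eq[OF M] VR_eq[OF M] VI_eq[OF M] by (simp add: inv_form_def)
qed

lemma inv_form_basis:
  "inv_form A x y [basis_vec 1, basis_vec 2, basis_vec 3]
      = A" "inv_form A x y [basis_vec 1, basis_vec 4, basis_vec 5]
      = A" "inv_form A x y [basis_vec 1, basis_vec 6, basis_vec 7] = A"
  "inv_form A x y [basis_vec 2, basis_vec 4, basis_vec 6]
      = x" "inv_form A x y [basis_vec 2, basis_vec 5, basis_vec 7] =
      - x" "inv_form A x y [basis_vec 3, basis_vec 4, basis_vec 7] = - x"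
  "inv_form A x y [basis_vec 3, basis_vec 5, basis_vec 6] = - x"
  "inv_form A x y [basis_vec 3, basis_vec 4, basis_vec 6]
      = y" "inv_form A x y [basis_vec 3, basis_vec 5, basis_vec 7] =
      - y" "inv_form A x y [basis_vec 2, basis_vec 4, basis_vec 7] = y"
  "inv_form A x y [basis_vec 2, basis_vec 5, basis_vec 6] = y"
  by (simp_all add: inv_form_basis_vec omega_val_def VR_val_def VI_val_def minor3_def basis_vec_apply)

lemma invariant_form_eq_inv_form:
  assumes f: "is_form 3 \<phi>" "invariant 3 \<phi>"
  shows "\<phi> = inv_form (\<phi> (map basis_vec [1, 2, 3])) (\<phi> (map basis_vec [2, 4, 6])) (\<phi> (map basis_vec
      [3, 4, 6]))"
proof (rule form_ext[OF f(1) is_form_inv_form])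
  define F where "F a b c = \<phi> (map basis_vec [a, b, c])" for a b c
  note aexp_simps = adv_coords_def lessThan_3 cplx_coord_simps hdiag_def hcyc_def basis_vec_def
  \<comment> \<open>The cyclic permutation of the three complex coordinates moves the pairs 23, 45,
    67 around and fixes \<open>e_1\<close>.\<close>
  define tc where "tc n = (if n = 1 then 1 else if n < 6 then n + 2 else n - 4)" for n :: nat
  have cyc: "F a b c = 1 * 1 * 1 * F (tc a) (tc b) (tc c)"
    if "a \<in> {1..7}" "b \<in> {1..7}" "c \<in> {1..7}" for a b c
    unfolding F_def
    using that
  proof (rule invariant_monomial[OF f, where t = tc and s = "\<lambda>n. 1", rotated 3])
    show "hcyc \<in> SU3" by (rule hcyc_SU3)
    show "(tc) n \<in> {1..7}" if "n \<in> {1..7}" for n :: nat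
      using that unfolding atLeastAtMost_1_7 by (elim insertE emptyE; simp add: atLeastAtMost_1_7 tc_def)
    show "adv_coords (hcyc) (basis_vec n) m = (\<lambda>n. 1) n * basis_vec ((tc) n) m"
        if "n \<in> {1..7}" "m \<in> {1..7}" for n m
      using that unfolding atLeastAtMost_1_7 by (elim insertE emptyE; simp add: aexp_simps tc_def)
  qed
  \<comment> \<open>Index map and signs of diag(i, -i, 1): multiplication by i sends
    \<open>e_2\<close> to \<open>e_3\<close> and \<open>e_3\<close> to minus \<open>e_2\<close>, and
    multiplication by -i sends \<open>e_4\<close> to minus \<open>e_5\<close> and \<open>e_5\<close>
    to \<open>e_4\<close>.\<close>
  define t4 where "t4 n = (if n = 2 then 3 else if n = 3 then 2 else if n = 4 then 5 else if n
      = 5 then 4 else n)" for n :: nat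
  define r4 where "r4 n = (if n = 3 \<or> n = 4 then -1 else 1 :: real)" for n :: nat
  have q4: "F a b c = r4 a * r4 b * r4 c * F (t4 a) (t4 b) (t4 c)"
    if "a \<in> {1..7}" "b \<in> {1..7}" "c \<in> {1..7}" for a b c
    unfolding F_def
    using that
  proof (rule invariant_monomial[OF f, where t = t4 and s = r4, rotated 3])
    show "hdiag \<i> (-\<i>) 1 \<in> SU3" by (rule hdiag_SU3) simp_all
    show "(t4) n \<in> {1..7}" if "n \<in> {1..7}" for n :: nat
      using that unfolding atLeastAtMost_1_7 by (elim insertE emptyE; simp add: atLeastAtMost_1_7
          t4_def r4_def)
    show "adv_coords (hdiag \<i> (-\<i>) 1) (basis_vec n) m = (r4) n * basis_vec ((t4) n) m"
        if "n \<in> {1..7}" "m \<in> {1..7}" for n m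
      using that unfolding atLeastAtMost_1_7 by (elim insertE emptyE; simp add: aexp_simps t4_def r4_def)
  qed
  \<comment> \<open>The same for diag(1, i, -i), which acts on the pairs 45 and 67.\<close>
  define t5 where "t5 n = (if n = 4 then 5 else if n = 5 then 4 else if n = 6 then 7 else if n
      = 7 then 6 else n)" for n :: nat
  define r5 where "r5 n = (if n = 5 \<or> n = 6 then -1 else 1 :: real)" for n :: nat
  have q5: "F a b c = r5 a * r5 b * r5 c * F (t5 a) (t5 b) (t5 c)"
    if "a \<in> {1..7}" "b \<in> {1..7}" "c \<in> {1..7}" for a b c
    unfolding F_def
    using that
  proof (rule invariant_monomial[OF f, where t = t5 and s = r5, rotated 3])
    show "hdiag 1 \<i> (-\<i>) \<in> SU3" by (rule hdiag_SU3) simp_all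
    show "(t5) n \<in> {1..7}" if "n \<in> {1..7}" for n :: nat
      using that unfolding atLeastAtMost_1_7 by (elim insertE emptyE; simp add: atLeastAtMost_1_7
          t5_def r5_def)
    show "adv_coords (hdiag 1 \<i> (-\<i>)) (basis_vec n) m = (r5) n * basis_vec ((t5) n) m"
        if "n \<in> {1..7}" "m \<in> {1..7}" for n m
      using that unfolding atLeastAtMost_1_7 by (elim insertE emptyE; simp add: aexp_simps t5_def r5_def)
  qed
  have vals: "F 1 4 5 = F 1 2 3" "F 1 6 7 = F 1 2 3"
    "F 3 5 6 = - F 2 4 6" "F 2 5 7 = - F 2 4 6" "F 3 4 7 = - F 2 4 6"
    "F 2 5 6 = F 3 4 6" "F 3 5 7 = - F 3 4 6" "F 2 4 7 = F 3 4 6"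
    using cyc[of 1 2 3] cyc[of 1 4 5] q4[of 2 4 6] q5[of 2 4 6] q4[of 2 5 7] q4[of 2 5 6] q5[of 3 4 6]
        q5[of 2 5 6]
    by (simp_all add: tc_def t4_def r4_def t5_def r5_def)
  fix I assume "I \<in> sorted_lists 3"
  then obtain a b c where I: "I = [a, b, c]" and o: "1 \<le> a" "a < b" "b < c" "c \<le> 7"
    by (rule sorted_lists_3_cases)
  have abc: "a \<in> {1..7}" "b \<in> {1..7}" "c \<in> {1..7}" using o by auto
  \<comment> \<open>Of the 35 increasing triples, eleven pass both parity tests: the three monomials
    of e^1 wedge omega and the eight of V_R and V_I.\<close>
  have tri: "(a, b, c) \<in> {(1,2,3), (1,4,5), (1,6,7), (2,4,6), (2,5,7), (3,4,7), (3,5,6), (3,4,6),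
      (3,5,7), (2,4,7), (2,5,6)}
    \<or> ((a \<in> {2,3,4,5}) \<noteq> ((b \<in> {2,3,4,5}) \<noteq> (c \<in> {2,3,4,5}))) \<or> ((a \<in> {4,5,6,7}) \<noteq> ((b \<in> {4,5,6,7}) \<noteq>
        (c \<in> {4,5,6,7})))"
    (is "?S \<or> ?O")
  proof -
    have "a \<in> {1,2,3,4,5}" "b \<in> {2,3,4,5,6}" "c \<in> {3,4,5,6,7}" using o by auto
    with o show ?thesis by (elim insertE emptyE) simp_all
  qed
  show "\<phi> (map basis_vec I) = inv_form (\<phi> (map basis_vec [1, 2, 3])) (\<phi> (map basis_vec [2, 4, 6])) (\<phi>
      (map basis_vec [3, 4, 6])) (map basis_vec I)"
  proof (cases ?O)
    case True
    then show ?thesis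
      using invariant_form_zero[OF f abc] invariant_form_zero[OF is_form_inv_form invariant_inv_form
          abc] I by simp
  next
    case False
    from tri have ?S
      by (rule disjE) (assumption, rule notE[OF False])
    then show ?thesis
      using vals[unfolded F_def] unfolding I by (elim insertE emptyE) (simp_all add: inv_form_basis)
  qed
qed

lemma inv_form_inject: "inv_form A x y = inv_form A' x' y' \<longleftrightarrow> A = A' \<and> x = x' \<and> y = y'"
  using inv_form_basis(1)[of A x y] inv_form_basis(1)[of A' x' y'] inv_form_basis(4)[of A x y]
      inv_form_basis(4)[of A' x' y']
    inv_form_basis(8)[of A x y] inv_form_basis(8)[of A' x' y'] by metis

subsection \<open>The metric of an invariant form\<close>

text \<open>The wedge product of two 2-forms as a signed sum over the six (2,2)-shuffles, in place
  of 24 permutations.\<close>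

definition shuffle_2_2 :: "form \<Rightarrow> form \<Rightarrow> Defs.vec \<Rightarrow> Defs.vec \<Rightarrow> Defs.vec \<Rightarrow> Defs.vec \<Rightarrow> real" where
  "shuffle_2_2 \<alpha> \<beta> a b c d = \<alpha> [a, b] * \<beta> [c, d] - \<alpha> [a, c] * \<beta> [b, d] + \<alpha> [a, d] * \<beta> [b, c]
     + \<alpha> [b, c] * \<beta> [a, d] - \<alpha> [b, d] * \<beta> [a, c] + \<alpha> [c, d] * \<beta> [a, b]"

lemma shuffle_2_2_sum:
  "shuffle_2_2 (\<lambda>xs. \<Sum>I\<in>S. f I * \<alpha> I xs) (\<lambda>xs. \<Sum>J\<in>T. g J * \<beta> J xs) a b c d
     = (\<Sum>I\<in>S. f I * (\<Sum>J\<in>T. g J * shuffle_2_2 (\<alpha> I) (\<beta> J) a b c d))"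
proof -
  have p: "(\<Sum>I\<in>S. f I * \<alpha> I u) * (\<Sum>J\<in>T. g J * \<beta> J w) = (\<Sum>I\<in>S. \<Sum>J\<in>T. f I * (g J * (\<alpha> I u * \<beta> J w)))" for u w
    unfolding sum_product by (intro sum.cong refl) simp
  show ?thesis
    unfolding shuffle_2_2_def p unfolding sum_distrib_left sum.distrib[symmetric] sum_subtractf[symmetric]
    by (intro sum.cong refl) (simp add: algebra_simps)
qed

text \<open>Both sides are bilinear in the forms. On basis 2-forms the claim is the Laplace
  expansion of a 4 by 4 determinant along two columns.\<close>

lemma wedge_2_2:
  assumes f: "is_form 2 \<alpha>" "is_form 2 \<beta>" and M: "{a, b, c, d} \<subseteq> M7"
  shows "wedge 2 2 \<alpha> \<beta> [a, b, c, d] = shuffle_2_2 \<alpha> \<beta> a b c d"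
proof -
  have e: "eform (I @ J) [a, b, c, d] = shuffle_2_2 (eform I) (eform J) a b c d" if IJ: "I \<in>
      sorted_lists 2" "J \<in> sorted_lists 2" for I J
  proof -
    obtain i j where I: "I = [i, j]"
      using IJ(1) by (cases I; cases "tl I") (auto simp: sorted_lists_def)
    obtain k l where J: "J = [k, l]"
      using IJ(2) by (cases J; cases "tl J") (auto simp: sorted_lists_def)
    from I J show ?thesis
      using M by (simp add: shuffle_2_2_def eform_2 eform_4 minor3_def algebra_simps)
  qed
  have "shuffle_2_2 \<alpha> \<beta> a b c d = shuffle_2_2 (\<lambda>xs. \<Sum>I\<in>sorted_lists 2. \<alpha> (map basis_vec I) * eform I
      xs) (\<lambda>xs. \<Sum>J\<in>sorted_lists 2. \<beta> (map basis_vec J) * eform J xs) a b c d"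
    using form_expand[OF f(1)] form_expand[OF f(2)] by simp
  also have "\<dots> = wedge 2 2 \<alpha> \<beta> [a, b, c, d]"
    unfolding wedge_expand[OF f] shuffle_2_2_sum
    by (intro sum.cong refl arg_cong2[where f = "(*)"]) (simp add: e)
  finally show ?thesis by simp
qed

lemma wedge_4_eform:
  assumes f: "is_form 4 \<psi>" and J: "J \<in> sorted_lists 3"
  shows "wedge 4 3 \<psi> (eform J) = (\<lambda>xs. shuffle_sign (compl_list J) * \<psi> (map basis_vec (compl_list J))
      * eform [1..<8] xs)"
proof -
  have cJ: "compl_list J \<in> sorted_lists 4" using compl_list_sorted_lists[OF J] by simp
  have "(\<Sum>I\<in>sorted_lists 4. \<psi> (map basis_vec I) * (shuffle_sign I * eform J (map basis_vec (compl_list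
      I)))) = (\<Sum>I\<in>sorted_lists 4. if I = compl_list J then shuffle_sign (compl_list J) * \<psi> (map
      basis_vec (compl_list J)) else 0)"
  proof (rule sum.cong[OF refl])
    fix I assume I: "I \<in> sorted_lists 4"
    then have "compl_list I \<in> sorted_lists 3" using compl_list_sorted_lists[OF I] by simp
    moreover have "J = compl_list I \<longleftrightarrow> I = compl_list J"
        using compl_list_compl_list[OF I] compl_list_compl_list[OF J] by metis
    ultimately show "\<psi> (map basis_vec I) * (shuffle_sign I * eform J (map basis_vec (compl_list I)))
        = (if I = compl_list J then shuffle_sign (compl_list J) * \<psi> (map basis_vec (compl_list J)) else 0)"
      by (simp add: eform_basis[OF J])
  qed
  also have "\<dots> = shuffle_sign (compl_list J) * \<psi> (map basis_vec (compl_list J))" using cJ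
      by (simp add: finite_sorted_lists)
  finally show ?thesis
    using wedge_top[of 4 \<psi> "eform J"] f eform_sorted_lists[OF J] by simp
qed

lemma wedge_diff_right: "wedge k l \<alpha> (\<lambda>xs. \<beta> xs - \<beta>' xs) = (\<lambda>xs. wedge k l \<alpha> \<beta> xs - wedge k l \<alpha> \<beta>' xs)"
  using wedge_add_right[of k l \<alpha> \<beta> "\<lambda>xs. -1 * \<beta>' xs"] wedge_scale_right[of k l \<alpha> "-1" \<beta>'] by simp

text \<open>Each monomial of the 3-form picks out the complementary coefficient of the 4-form, with
  its shuffle sign, so just eleven coefficients enter.\<close>

lemma wedge_4_inv_form:
  assumes f: "is_form 4 \<psi>"
  shows "wedge 4 3 \<psi> (inv_form A x y) = (\<lambda>xs.
     (A * (\<psi> (map basis_vec [4, 5, 6, 7]) + \<psi> (map basis_vec [2, 3, 6, 7]) + \<psi> (map basis_vec [2, 3, 4, 5]))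
    + x * (\<psi> (map basis_vec [1, 3, 5, 7]) - \<psi> (map basis_vec [1, 3, 4, 6])
        - \<psi> (map basis_vec [1, 2, 5, 6]) - \<psi> (map basis_vec [1, 2, 4, 7]))
    + y * (\<psi> (map basis_vec [1, 2, 4, 6]) - \<psi> (map basis_vec [1, 2, 5, 7])
        - \<psi> (map basis_vec [1, 3, 4, 7]) - \<psi> (map basis_vec [1, 3, 5, 6]))) * eform [1..<8] xs)"
  unfolding inv_form_def e1_omega_def VR_def VI_def wedge_add_right wedge_scale_right wedge_diff_right
  by (auto simp: fun_eq_iff wedge_4_eform[OF f] sorted_lists_def shuffle_sign_signed_sort
      compl_list_def upt_1_8 algebra_simps)

text \<open>The coefficient of e^{1...7} in the cubic expression of \<open>g2_compat\<close>. It is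
  the metric times the still unknown volume coefficient.\<close>

definition g2_quadratic :: "real \<Rightarrow> real \<Rightarrow> real \<Rightarrow> Defs.vec \<Rightarrow> Defs.vec \<Rightarrow> real" where
  "g2_quadratic A x y X Y = A ^ 3 * X 1 * Y 1 + A * (x\<^sup>2 + y\<^sup>2) * horiz_inner X Y"

lemma inv_form_basis_vec_basis_vec:
  assumes "X \<in> M7" "a \<in> {1..7}" "b \<in> {1..7}"
  shows "inv_form A x y [X, basis_vec a, basis_vec b]
      = A * (X 1 * omega_val (basis_vec a) (basis_vec b) - basis_vec a 1 * omega_val X (basis_vec b)
      + basis_vec b 1 * omega_val X (basis_vec a))
     + x * VR_val X (basis_vec a) (basis_vec b) + y * VI_val X (basis_vec a) (basis_vec b)"
proof -
  have M: "{X, basis_vec a, basis_vec b} \<subseteq> M7" using assms basis_vec_M7 by auto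
  show ?thesis using e1_omega_eq[OF M] VR_eq[OF M] VI_eq[OF M] by (simp add: inv_form_def)
qed

lemma inv_form_contract:
  assumes "X \<in> M7"
  shows "inv_form A x y [X, basis_vec 1, basis_vec 2]
      = A * X 3" "inv_form A x y [X, basis_vec 1, basis_vec 3] = - A * X 2"
    "inv_form A x y [X, basis_vec 1, basis_vec 4]
        = A * X 5" "inv_form A x y [X, basis_vec 1, basis_vec 5] = - A * X 4"
    "inv_form A x y [X, basis_vec 1, basis_vec 6]
        = A * X 7" "inv_form A x y [X, basis_vec 1, basis_vec 7] = - A * X 6"
    "inv_form A x y [X, basis_vec 2, basis_vec 3]
        = A * X 1" "inv_form A x y [X, basis_vec 4, basis_vec 5]
        = A * X 1" "inv_form A x y [X, basis_vec 6, basis_vec 7] = A * X 1"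
    "inv_form A x y [X, basis_vec 2, basis_vec 4] = x * X 6
        + y * X 7" "inv_form A x y [X, basis_vec 2, basis_vec 5] = - x * X 7 + y * X 6"
    "inv_form A x y [X, basis_vec 2, basis_vec 6] = - x * X 4
        - y * X 5" "inv_form A x y [X, basis_vec 2, basis_vec 7] = x * X 5 - y * X 4"
    "inv_form A x y [X, basis_vec 3, basis_vec 4] = - x * X 7
        + y * X 6" "inv_form A x y [X, basis_vec 3, basis_vec 5] = - x * X 6 - y * X 7"
    "inv_form A x y [X, basis_vec 3, basis_vec 6] = x * X 5
        - y * X 4" "inv_form A x y [X, basis_vec 3, basis_vec 7] = x * X 4 + y * X 5"
    "inv_form A x y [X, basis_vec 4, basis_vec 6] = x * X 2
        + y * X 3" "inv_form A x y [X, basis_vec 4, basis_vec 7] = - x * X 3 + y * X 2"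
    "inv_form A x y [X, basis_vec 5, basis_vec 6] = - x * X 3
        + y * X 2" "inv_form A x y [X, basis_vec 5, basis_vec 7] = - x * X 2 - y * X 3"
  by (simp_all add: inv_form_basis_vec_basis_vec assms omega_val_def VR_val_def VI_val_def minor3_def
      basis_vec_apply algebra_simps)

text \<open>The 21 contractions in \<open>inv_form_contract\<close> supply every value needed; the
  rest is polynomial arithmetic in the coordinates of X and Y.\<close>

lemma inv_form_cubic:
  assumes X: "X \<in> M7" and Y: "Y \<in> M7"
  shows "(\<lambda>xs. (1/6) * wedge 4 3 (wedge 2 2 (iota X (inv_form A x y)) (iota Y (inv_form A x y)))
      (inv_form A x y) xs)
       = (\<lambda>xs. g2_quadratic A x y X Y * eform [1..<8] xs)"
proof -
  have "is_form 2 (iota X (inv_form A x y))" "is_form 2 (iota Y (inv_form A x y))"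
    using is_form_iota[of 2 "inv_form A x y"] is_form_inv_form[of A x y] X Y by simp_all
  note f = this is_form_wedge[OF this, simplified]
  have e: "basis_vec 1 \<in> M7" "basis_vec 2 \<in> M7" "basis_vec 3 \<in> M7" "basis_vec 4 \<in> M7" "basis_vec 5 \<in>
      M7" "basis_vec 6 \<in> M7" "basis_vec 7 \<in> M7"
    by (simp_all add: basis_vec_M7)
  show ?thesis
    unfolding wedge_4_inv_form[OF f(3)] mult.assoc[symmetric]
    by (intro ext arg_cong2[where f = "(*)"] refl)
       (simp add: wedge_2_2[OF f(1,2)] e, simp add: shuffle_2_2_def iota_def inv_form_contract[OF X]
           inv_form_contract[OF Y]
        g2_quadratic_def horiz_inner_def power2_eq_square power3_eq_cube algebra_simps)
qed

section \<open>Orthonormal frames for an arbitrary inner product\<close>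

lemma inner_prod_lin:
  "inner_prod g \<Longrightarrow> u \<in> M7 \<Longrightarrow> v \<in> M7 \<Longrightarrow> w \<in> M7 \<Longrightarrow> g (lin a u b v) w = a * g u w + b * g v w"
  unfolding inner_prod_def by blast

lemma inner_prod_sym: "inner_prod g \<Longrightarrow> g u v = g v u"
  unfolding inner_prod_def by blast

lemma inner_prod_pos: "inner_prod g \<Longrightarrow> v \<in> M7 \<Longrightarrow> v n \<noteq> 0 \<Longrightarrow> g v v > 0"
  unfolding inner_prod_def by (metis (mono_tags, lifting))

lemma inner_prod_sum:
  assumes g: "inner_prod g" and w: "w \<in> M7" and f: "\<And>i. i < (k::nat) \<Longrightarrow> f i \<in> M7"
  shows "(\<lambda>n. \<Sum>i<k. c i * f i n) \<in> M7 \<and> g (\<lambda>n. \<Sum>i<k. c i * f i n) w = (\<Sum>i<k. c i * g (f i) w)"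
  using f
proof (induction k)
  case 0
  have "(\<lambda>n. 0) \<in> M7" by (simp add: M7_def)
  moreover have "g (\<lambda>n. 0) w = 0"
    using inner_prod_lin[OF g w w w, of 0 0] by (simp add: lin_def)
  ultimately show ?case by simp
next
  case (Suc k)
  let ?S = "\<lambda>n. \<Sum>i<k. c i * f i n"
  have S: "?S \<in> M7" "g ?S w = (\<Sum>i<k. c i * g (f i) w)" using Suc by auto
  have e: "(\<lambda>n. \<Sum>i<Suc k. c i * f i n) = lin 1 ?S (c k) (f k)" by (auto simp: lin_def)
  show ?case
    unfolding e using inner_prod_lin[OF g S(1) _ w, of "f k" 1 "c k"] S Suc.prems[of k] lin_M7[OF
        S(1), of "f k"] by auto
qed

text \<open>Gram-Schmidt on the coordinate vectors. The induction also records that the frame is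
  triangular, so the new vector has coordinate 1 at \<open>Suc k\<close> and cannot vanish. A frame
  is needed because \<open>vol_form\<close> bounds a form away from 0 only through orthonormal
  frames.\<close>

lemma orthonormal_exists:
  assumes g: "inner_prod g"
  shows "\<exists>fs. orthonormal g fs"
proof -
  have "\<exists>fs. length fs = k \<and> set fs \<subseteq> M7 \<and> (\<forall>i<k. \<forall>j<k. g (fs ! i) (fs ! j) = (if i = j then 1 else 0))
     \<and> (\<forall>i<k. \<forall>n. Suc i < n \<longrightarrow> (fs ! i) n = 0)" if "k \<le> 7" for k
    using that
  proof (induction k)
    case (Suc k)
    then obtain fs where fs: "length fs = k" "set fs \<subseteq> M7" "\<forall>i<k. \<forall>j<k. g (fs ! i) (fs ! j) = (if i
        = j then 1 else 0)"
      "\<forall>i<k. \<forall>n. Suc i < n \<longrightarrow> (fs ! i) n = 0" by auto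
    have fM: "fs ! i \<in> M7" if "i < k" for i using fs that by auto
    let ?e = "basis_vec (Suc k)"
    have e: "?e \<in> M7" using Suc.prems basis_vec_M7[of "Suc k"] by simp
    define S where "S = (\<lambda>n. \<Sum>i<k. g ?e (fs ! i) * (fs ! i) n)"
    have S: "S \<in> M7" "g S w = (\<Sum>i<k. g ?e (fs ! i) * g (fs ! i) w)" if "w \<in> M7" for w
      unfolding S_def using inner_prod_sum[OF g that, of k "\<lambda>i. fs ! i" "\<lambda>i. g ?e (fs ! i)"] fM by auto
    define u where "u = lin 1 ?e (-1) S"
    have u: "u \<in> M7" unfolding u_def by (rule lin_M7[OF e S(1)[OF e]])
    have u_orth: "g u (fs ! j) = 0" if "j < k" for j
    proof -
      have "(\<Sum>i<k. g ?e (fs ! i) * g (fs ! i) (fs ! j)) = (\<Sum>i<k. if i = j then g ?e (fs ! j) else 0)"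
        using fs(3) that by (intro sum.cong refl) auto
      then show ?thesis
        unfolding u_def using inner_prod_lin[OF g e S(1)[OF e] fM[OF that], of 1 "-1"] S(2)[OF fM[OF
            that]] that by simp
    qed
    have S0: "S n = 0" if "n > k" for n
      unfolding S_def using fs(4) that by (intro sum.neutral) auto
    have "u (Suc k) = 1" by (simp add: u_def lin_def basis_vec_def S0)
    then have pos: "g u u > 0" using inner_prod_pos[OF g u, of "Suc k"] by simp
    define f where "f = lin (1 / sqrt (g u u)) u 0 u"
    have f: "f \<in> M7" unfolding f_def by (rule lin_M7[OF u u])
    have gf: "g f w = g u w / sqrt (g u u)" if "w \<in> M7" for w
      unfolding f_def using inner_prod_lin[OF g u u that, of "1 / sqrt (g u u)" 0] by simp
    have ff: "g f f = 1"
      using gf[OF f] gf[OF u] inner_prod_sym[OF g, of u f] pos by simp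
    have f_orth: "g f (fs ! j) = 0" "g (fs ! j) f = 0" if "j < k" for j
      using gf[OF fM[OF that]] u_orth[OF that] inner_prod_sym[OF g, of "fs ! j" f] by simp_all
    have f0: "f n = 0" if "Suc k < n" for n
      using that S0[of n] by (simp add: f_def u_def lin_def basis_vec_def)
    show ?case
    proof (intro exI[of _ "fs @ [f]"] conjI allI impI)
      show "length (fs @ [f]) = Suc k" "set (fs @ [f]) \<subseteq> M7" using fs f by auto
      show "g ((fs @ [f]) ! i) ((fs @ [f]) ! j) = (if i = j then 1 else 0)" if "i < Suc k" "j < Suc k"
          for i j
        using that fs(1,3) ff f_orth by (auto simp: nth_append less_Suc_eq)
      show "((fs @ [f]) ! i) n = 0" if "i < Suc k" "Suc i < n" for i n
        using that fs(1,4) f0 by (auto simp: nth_append less_Suc_eq)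
    qed
  qed auto
  from this[of 7] show ?thesis unfolding orthonormal_def by auto
qed

text \<open>The sixth root makes R^3 the length of (x, y), matching the factor R_0^3 in
  \<open>fp_form\<close>, and keeps the metric free of fractional powers of R.\<close>

definition met_scale :: "real \<Rightarrow> real \<Rightarrow> real" where
  "met_scale x y = root 6 (x\<^sup>2 + y\<^sup>2)"

lemma met_scale_pos: "x\<^sup>2 + y\<^sup>2 \<noteq> 0 \<Longrightarrow> met_scale x y > 0"
  using sum_power2_gt_zero_iff[of x y] unfolding met_scale_def by (intro real_root_gt_zero) auto

lemma met_scale_power: "met_scale x y ^ 6 = x\<^sup>2 + y\<^sup>2"
  unfolding met_scale_def by (intro real_root_pow_pos2) auto

lemma met_scale_eqI: "R > 0 \<Longrightarrow> x\<^sup>2 + y\<^sup>2 = R ^ 6 \<Longrightarrow> met_scale x y = R"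
  unfolding met_scale_def by (simp add: real_root_power_cancel)

lemma diag_met_met_diag: "X \<in> M7 \<Longrightarrow> Y \<in> M7 \<Longrightarrow> diag_met (met_diag p q) X Y = p * X 1 * Y 1
    + q * horiz_inner X Y"
  unfolding diag_met_def atLeastAtMost_1_7 by (simp add: met_diag_def horiz_inner_def algebra_simps)

lemma prod_met_diag: "(\<Prod>n\<in>{1..7}. met_diag p q n) = p * q ^ 6"
  unfolding atLeastAtMost_1_7 by (simp add: met_diag_def numeral_eq_Suc)

text \<open>The cubic identity determines only the product of metric and volume coefficient. The
  unit volume of orthonormal frames gives one more equation, and together they determine
  both.\<close>

lemma compatible_metric_inv_form:
  assumes g: "inner_prod g" and vol: "vol_form g vol" and c: "g2_compat (inv_form A x y) g vol"
  shows "A \<noteq> 0 \<and> x\<^sup>2 + y\<^sup>2 \<noteq> 0 \<and> g = diag_met (met_diag (A\<^sup>2 / met_scale x y ^ 4) ((met_scale x y)\<^sup>2))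
    \<and> vol = (\<lambda>xs. A * met_scale x y ^ 4 * eform [1..<8] xs)"
proof -
  define v where "v = vol (map basis_vec [1..<8])"
  define p q where "p = g (basis_vec 1) (basis_vec 1)" and "q = g (basis_vec 2) (basis_vec 2)"
  let ?E = "eform [1..<8]"
  have vol_eq: "vol = (\<lambda>xs. v * ?E xs)"
    unfolding v_def using vol by (intro form7_expand) (simp add: vol_form_def)
  have B: "g2_quadratic A x y X Y = g X Y * v" if "X \<in> M7" "Y \<in> M7" for X Y
  proof -
    have "(\<lambda>xs. g2_quadratic A x y X Y * ?E xs) = (\<lambda>xs. g X Y * vol xs)"
      using c that inv_form_cubic[OF that, of A x y] unfolding g2_compat_def by metis
    then have "g2_quadratic A x y X Y * ?E (map basis_vec [1..<8])
        = g X Y * vol (map basis_vec [1..<8])" by metis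
    then show ?thesis by (simp only: eform_top_basis v_def mult_1_right)
  qed
  \<comment> \<open>The value of the volume form on some orthonormal frame is nonzero, hence so is
    its coefficient.\<close>
  obtain fs where "orthonormal g fs" using orthonormal_exists[OF g] by blast
  then have "vol fs = 1 \<or> vol fs = -1" using vol by (simp add: vol_form_def)
  then have v0: "v \<noteq> 0" unfolding vol_eq by auto
  have e: "basis_vec 1 \<in> M7" "basis_vec 2 \<in> M7" by (simp_all add: basis_vec_M7)
  have pq: "p > 0" "q > 0"
    unfolding p_def q_def using inner_prod_pos[OF g e(1), of 1] inner_prod_pos[OF g e(2), of 2]
        by (simp_all add: basis_vec_apply)
  \<comment> \<open>\<open>g2_quadratic\<close> has one coefficient for \<open>e_1\<close> and one
    for the other six directions, so evaluation at \<open>e_1\<close> and \<open>e_2\<close>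
    captures it.\<close>
  have Ap: "A ^ 3 = p * v" using B[OF e(1) e(1)]
      by (simp add: g2_quadratic_def p_def horiz_inner_def basis_vec_apply)
  have Aq: "A * (x\<^sup>2 + y\<^sup>2) = q * v" using B[OF e(2) e(2)]
      by (simp add: g2_quadratic_def q_def horiz_inner_def basis_vec_apply)
  have A0: "A \<noteq> 0" using Ap v0 pq by auto
  have r0: "x\<^sup>2 + y\<^sup>2 \<noteq> 0" using Aq v0 pq by auto
  let ?R = "met_scale x y"
  note R = met_scale_pos[OF r0]
  have g_eq: "g = diag_met (met_diag p q)"
  proof (intro ext)
    fix X Y
    show "g X Y = diag_met (met_diag p q) X Y"
    proof (cases "X \<in> M7 \<and> Y \<in> M7")
      case True
      have "g X Y * v = (p * v) * X 1 * Y 1 + (q * v) * horiz_inner X Y"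
        using B[of X Y] True unfolding g2_quadratic_def Ap Aq by simp
      also have "\<dots> = (p * X 1 * Y 1 + q * horiz_inner X Y) * v" by (simp add: algebra_simps)
      finally have "g X Y * v = (p * X 1 * Y 1 + q * horiz_inner X Y) * v" .
      then show ?thesis using v0 True by (simp add: diag_met_met_diag)
    next
      case False
      then show ?thesis using g by (auto simp: inner_prod_def diag_met_def)
    qed
  qed
  have D: "\<forall>n\<in>{1..7}. met_diag p q n > 0" using pq by (simp add: met_diag_def)
  \<comment> \<open>The given volume form and the one with coefficient
    \<open>sqrt (p * q ^ 6)\<close> both have square 1 on the same frame, so their coefficients
    agree up to sign.\<close>
  have v2: "v\<^sup>2 = p * q ^ 6"
  proof -
    obtain fs where fs: "orthonormal (diag_met (met_diag p q)) fs"
        using orthonormal_diag_met_scaled_basis[OF D] by blast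
    have "vol_form (diag_met (met_diag p q)) (\<lambda>xs. sqrt (p * q ^ 6) * ?E xs)"
      by (rule vol_form_diag_met[OF D]) (use pq in \<open>simp add: prod_met_diag\<close>)
    then have "sqrt (p * q ^ 6) * ?E fs = 1 \<or> sqrt (p * q ^ 6) * ?E fs = -1" using fs
        by (simp add: vol_form_def)
    then have 1: "(sqrt (p * q ^ 6) * ?E fs)\<^sup>2 = 1" by (simp only: power2_eq_1_iff)
    have "v * ?E fs = 1 \<or> v * ?E fs = -1" using vol fs unfolding g_eq vol_eq by (simp add: vol_form_def)
    then have 2: "(v * ?E fs)\<^sup>2 = 1" by (simp only: power2_eq_1_iff)
    then have "?E fs \<noteq> 0" by auto
    moreover have "v\<^sup>2 * (?E fs)\<^sup>2 = (sqrt (p * q ^ 6))\<^sup>2 * (?E fs)\<^sup>2"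
      using 1 2 by (simp only: power_mult_distrib)
    ultimately have "v\<^sup>2 = (sqrt (p * q ^ 6))\<^sup>2" by simp
    then show ?thesis using pq by simp
  qed
  \<comment> \<open>Eliminates p and q from A^3 = p v, A R^6 = q v and v^2 = p q^6. The exponent 9
    is odd, so v is recovered together with its sign, which is that of A.\<close>
  have "v ^ 9 = v ^ 7 * v\<^sup>2" by (simp add: power_add[symmetric])
  also have "\<dots> = (p * v) * (q * v) ^ 6"
    using power_Suc[of v 6] unfolding v2 by (simp add: power_mult_distrib mult_ac)
  also have "\<dots> = A ^ 3 * (A * ?R ^ 6) ^ 6" unfolding Ap[symmetric] Aq[symmetric] met_scale_power ..
  also have "\<dots> = (A * ?R ^ 4) ^ 9"
    by (simp only: power_mult_distrib power_mult[symmetric] mult.assoc[symmetric] power_add[symmetric]) simp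
  finally have v: "v = A * ?R ^ 4"
    by (metis odd_real_root_power_cancel odd_numeral)
  have p: "p = A\<^sup>2 / ?R ^ 4"
    using Ap A0 R unfolding v by (simp add: field_simps power2_eq_square power3_eq_cube)
  have q: "q = ?R\<^sup>2"
  proof -
    have "A * ?R ^ 4 * ?R\<^sup>2 = A * ?R ^ 4 * q"
      using Aq unfolding v met_scale_power[symmetric] by (simp add: mult_ac power_add[symmetric])
    then show ?thesis using A0 R by simp
  qed
  show ?thesis using A0 r0 g_eq vol_eq unfolding v p q by simp
qed

lemma inv_form_compatible:
  assumes A: "A \<noteq> 0" and r: "x\<^sup>2 + y\<^sup>2 \<noteq> 0"
  defines "R \<equiv> met_scale x y"
  shows "inner_prod (diag_met (met_diag (A\<^sup>2 / R ^ 4) (R\<^sup>2)))"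
    "vol_form (diag_met (met_diag (A\<^sup>2 / R ^ 4) (R\<^sup>2))) (\<lambda>xs. A * R ^ 4 * eform [1..<8] xs)"
    "g2_compat (inv_form A x y) (diag_met (met_diag (A\<^sup>2 / R ^ 4) (R\<^sup>2))) (\<lambda>xs. A * R ^ 4 * eform
        [1..<8] xs)"
proof -
  have R: "R > 0" unfolding R_def by (rule met_scale_pos[OF r])
  have D: "\<forall>n\<in>{1..7}. met_diag (A\<^sup>2 / R ^ 4) (R\<^sup>2) n > 0" using A R by (simp add: met_diag_def)
  show "inner_prod (diag_met (met_diag (A\<^sup>2 / R ^ 4) (R\<^sup>2)))" by (rule inner_prod_diag_met[OF D])
  have "(A * R ^ 4)\<^sup>2 = A\<^sup>2 / R ^ 4 * (R\<^sup>2) ^ 6"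
    using R by (simp add: power_mult_distrib power_mult[symmetric] field_simps power_add[symmetric])
  then show "vol_form (diag_met (met_diag (A\<^sup>2 / R ^ 4) (R\<^sup>2))) (\<lambda>xs. A * R ^ 4 * eform [1..<8] xs)"
    by (intro vol_form_diag_met[OF D]) (simp add: prod_met_diag)
  show "g2_compat (inv_form A x y) (diag_met (met_diag (A\<^sup>2 / R ^ 4) (R\<^sup>2))) (\<lambda>xs. A * R ^ 4 * eform
      [1..<8] xs)"
    unfolding g2_compat_def
  proof (intro ballI)
    fix X Y assume XY: "X \<in> M7" "Y \<in> M7"
    have h: "A\<^sup>2 / R ^ 4 * (A * R ^ 4) = A ^ 3" "R\<^sup>2 * (A * R ^ 4) = A * R ^ 6"
      using R by (simp_all add: power2_eq_square power3_eq_cube power_add[symmetric] numeral_eq_Suc)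
    have "diag_met (met_diag (A\<^sup>2 / R ^ 4) (R\<^sup>2)) X Y * (A * R ^ 4)
        = (A\<^sup>2 / R ^ 4 * (A * R ^ 4)) * X 1 * Y 1 + (R\<^sup>2 * (A * R ^ 4)) * horiz_inner X Y"
      unfolding diag_met_met_diag[OF XY] by (simp add: algebra_simps)
    then have "g2_quadratic A x y X Y = diag_met (met_diag (A\<^sup>2 / R ^ 4) (R\<^sup>2)) X Y * (A * R ^ 4)"
      unfolding h g2_quadratic_def met_scale_power[symmetric] R_def[symmetric] by simp
    then show "(\<lambda>xs. 1/6 * wedge 4 3 (wedge 2 2 (iota X (inv_form A x y)) (iota Y (inv_form A x y)))
        (inv_form A x y) xs)
      = (\<lambda>xs. diag_met (met_diag (A\<^sup>2 / R ^ 4) (R\<^sup>2)) X Y * (A * R ^ 4 * eform [1..<8] xs))"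
      unfolding inv_form_cubic[OF XY] by (simp add: mult.assoc)
  qed
qed

lemma metvol_inv_form:
  assumes "A \<noteq> 0" "x\<^sup>2 + y\<^sup>2 \<noteq> 0"
  shows "metvol (inv_form A x y) = (diag_met (met_diag (A\<^sup>2 / met_scale x y ^ 4) ((met_scale x y)\<^sup>2)),
      \<lambda>xs. A * met_scale x y ^ 4 * eform [1..<8] xs)"
  unfolding metvol_def
proof (rule the_equality)
  show "case (diag_met (met_diag (A\<^sup>2 / met_scale x y ^ 4) ((met_scale x y)\<^sup>2)), \<lambda>xs. A * met_scale x
      y ^ 4 * eform [1..<8] xs) of
    (g, vol) \<Rightarrow> inner_prod g \<and> vol_form g vol \<and> g2_compat (inv_form A x y) g vol"
    unfolding prod.case using inv_form_compatible[OF assms] by blast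
next
  fix m assume "case m of (g, vol) \<Rightarrow> inner_prod g \<and> vol_form g vol \<and> g2_compat (inv_form A x y) g vol"
  then have "inner_prod (fst m)" "vol_form (fst m) (snd m)" "g2_compat (inv_form A x y) (fst m) (snd m)"
    by (simp_all add: case_prod_unfold)
  from compatible_metric_inv_form[OF this]
  show "m = (diag_met (met_diag (A\<^sup>2 / met_scale x y ^ 4) ((met_scale x y)\<^sup>2)), \<lambda>xs. A * met_scale x y
      ^ 4 * eform [1..<8] xs)"
    by (metis prod.collapse)
qed

lemma PosInv_eq: "PosInv = {inv_form A x y |A x y. A \<noteq> 0 \<and> x\<^sup>2 + y\<^sup>2 \<noteq> 0}"
proof (intro equalityI subsetI)
  fix \<phi> assume "\<phi> \<in> PosInv"
  then have \<phi>: "is_form 3 \<phi>" "invariant 3 \<phi>" "\<exists>g vol. inner_prod g \<and> vol_form g vol \<and> g2_compat \<phi> g vol"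
    by (auto simp: PosInv_def positive_def)
  obtain A x y where "\<phi> = inv_form A x y" using invariant_form_eq_inv_form[OF \<phi>(1,2)] by blast
  then show "\<phi> \<in> {inv_form A x y |A x y. A \<noteq> 0 \<and> x\<^sup>2 + y\<^sup>2 \<noteq> 0}"
    using \<phi>(3) compatible_metric_inv_form by blast
next
  fix \<phi> assume "\<phi> \<in> {inv_form A x y |A x y. A \<noteq> 0 \<and> x\<^sup>2 + y\<^sup>2 \<noteq> 0}"
  then obtain A x y where \<phi>: "\<phi> = inv_form A x y" and "A \<noteq> 0" "x\<^sup>2 + y\<^sup>2 \<noteq> 0" by blast
  from inv_form_compatible[OF this(2,3)] have "positive \<phi>"
    unfolding positive_def \<phi> using is_form_inv_form by blast
  then show "\<phi> \<in> PosInv"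
    using invariant_inv_form by (simp add: PosInv_def \<phi>)
qed

lemma laplacian_inv_form_eq:
  assumes A: "A \<noteq> 0" and r: "x\<^sup>2 + y\<^sup>2 \<noteq> 0"
  defines "R \<equiv> met_scale x y"
  shows "laplacian (inv_form A x y) = inv_form (16/9 * A ^ 3 / R ^ 8) (144 * R ^ 4 / A\<^sup>2 * x) (144 * R
      ^ 4 / A\<^sup>2 * y)"
proof -
  have R: "R > 0" unfolding R_def by (rule met_scale_pos[OF r])
  have 1: "(A * R ^ 4 / (R\<^sup>2 * R\<^sup>2 * R\<^sup>2 * R\<^sup>2))\<^sup>2 = A\<^sup>2 / R ^ 8"
    using R by (simp add: field_simps power_add[symmetric] power_mult_distrib power_mult[symmetric])
  have 2: "(A * R ^ 4 / (A\<^sup>2 / R ^ 4 * R\<^sup>2 * R\<^sup>2 * R\<^sup>2))\<^sup>2 = R ^ 4 / A\<^sup>2"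
    using R A by (simp add: field_simps power_add[symmetric] power_mult_distrib power_mult[symmetric])
  have "A\<^sup>2 / R ^ 4 > 0" "R\<^sup>2 > 0" using A R by simp_all
  from laplacian_inv_form[OF this metvol_inv_form[OF A r, folded R_def]] show ?thesis
    unfolding 1 2 by (simp add: power2_eq_square power3_eq_cube mult_ac)
qed

subsection \<open>The Laplacian on positive invariant forms\<close>

lemma inv_form_in_PosInv: "inv_form A x y \<in> PosInv \<longleftrightarrow> A \<noteq> 0 \<and> x\<^sup>2 + y\<^sup>2 \<noteq> 0"
  unfolding PosInv_eq mem_Collect_eq inv_form_inject by metis

lemma real_odd_power_inject: "odd n \<Longrightarrow> a ^ n = b ^ n \<Longrightarrow> a = (b::real)"
  by (metis odd_real_root_power_cancel)

lemma scaled_norm: "(c * x)\<^sup>2 + (c * y)\<^sup>2 = c\<^sup>2 * (x\<^sup>2 + y\<^sup>2)" for c x y :: real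
  by (simp add: power_mult_distrib distrib_left)

text \<open>The volume coefficient \<open>A * R ^ 4\<close> has the sign of \<open>A\<close>, and
  the new first coefficient is a positive multiple of \<open>A ^ 3\<close>. The witness below is the
  quotient of the new volume coefficient by the old one.\<close>

lemma laplacian_maps: "\<phi> \<in> PosInv \<Longrightarrow> laplacian \<phi> \<in> PosInv \<and> orient_pres \<phi>"
proof -
  assume "\<phi> \<in> PosInv"
  then obtain A x y where \<phi>: "\<phi> = inv_form A x y" and A: "A \<noteq> 0" and r: "x\<^sup>2 + y\<^sup>2 \<noteq> 0"
    unfolding PosInv_eq by blast
  define R where "R = met_scale x y"
  define A' k where "A' = 16/9 * A ^ 3 / R ^ 8" and "k = 144 * R ^ 4 / A\<^sup>2"
  have R: "R > 0" unfolding R_def by (rule met_scale_pos[OF r])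
  have L: "laplacian \<phi> = inv_form A' (k * x) (k * y)"
    unfolding \<phi> A'_def k_def R_def by (rule laplacian_inv_form_eq[OF A r])
  have A': "A' \<noteq> 0" and k: "k > 0" using A R by (simp_all add: A'_def k_def)
  have r': "(k * x)\<^sup>2 + (k * y)\<^sup>2 \<noteq> 0" unfolding scaled_norm using k r by simp
  define R' where "R' = met_scale (k * x) (k * y)"
  have R': "R' > 0" unfolding R'_def by (rule met_scale_pos[OF r'])
  have "orient_pres \<phi>"
    unfolding orient_pres_def L unfolding \<phi> metvol_inv_form[OF A r] metvol_inv_form[OF A' r'] snd_conv
        R_def[symmetric] R'_def[symmetric]
  proof (intro exI[of _ "16/9 * A\<^sup>2 / R ^ 8 * (R' ^ 4 / R ^ 4)"] conjI)
    show "16/9 * A\<^sup>2 / R ^ 8 * (R' ^ 4 / R ^ 4) > 0" using A R R' by simp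
    have "A' * R' ^ 4 = 16/9 * A\<^sup>2 / R ^ 8 * (R' ^ 4 / R ^ 4) * (A * R ^ 4)"
      using R by (simp add: A'_def power2_eq_square power3_eq_cube)
    then show "(\<lambda>xs. A' * R' ^ 4 * eform [1..<8] xs)
        = (\<lambda>xs. 16/9 * A\<^sup>2 / R ^ 8 * (R' ^ 4 / R ^ 4) * (A * R ^ 4 * eform [1..<8] xs))"
      by (simp only: mult.assoc)
  qed
  then show ?thesis unfolding L inv_form_in_PosInv using A' r' by simp
qed

text \<open>The combination \<open>A'\<^sup>4 |V'|\<^sup>6\<close> of the coefficients of the image is, up to a constant, the
  tenth power of the scale \<open>R\<close> of the source.\<close>

lemma laplacian_inj: "inj_on laplacian PosInv"
proof (rule inj_onI)
  fix \<phi> \<psi> assume "\<phi> \<in> PosInv" "\<psi> \<in> PosInv" and eq: "laplacian \<phi> = laplacian \<psi>"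
  then obtain A x y B u w where \<phi>: "\<phi> = inv_form A x y" and A: "A \<noteq> 0" and r: "x\<^sup>2 + y\<^sup>2 \<noteq> 0"
    and \<psi>: "\<psi> = inv_form B u w" and B: "B \<noteq> 0" and s: "u\<^sup>2 + w\<^sup>2 \<noteq> 0"
    unfolding PosInv_eq by blast
  define R where "R = met_scale x y"
  define S where "S = met_scale u w"
  have R: "R > 0" unfolding R_def by (rule met_scale_pos[OF r])
  have S: "S > 0" unfolding S_def by (rule met_scale_pos[OF s])
  have 1: "A ^ 3 / R ^ 8 = B ^ 3 / S ^ 8" and 2: "144 * R ^ 4 / A\<^sup>2 * x = 144 * S ^ 4 / B\<^sup>2 * u"
    and 3: "144 * R ^ 4 / A\<^sup>2 * y = 144 * S ^ 4 / B\<^sup>2 * w"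
    using eq unfolding \<phi> \<psi> laplacian_inv_form_eq[OF A r] laplacian_inv_form_eq[OF B s] inv_form_inject
        R_def[symmetric] S_def[symmetric]
    by auto
  have norm: "(c * x)\<^sup>2 + (c * y)\<^sup>2 = c\<^sup>2 * R ^ 6" "(c * u)\<^sup>2 + (c * w)\<^sup>2 = c\<^sup>2 * S ^ 6" for c
    unfolding scaled_norm R_def S_def met_scale_power by simp_all
  \<comment> \<open>Taking squared lengths of the (x, y) parts discards their directions and leaves
    an equation between the scales and first coefficients.\<close>
  have "(144 * R ^ 4 / A\<^sup>2)\<^sup>2 * R ^ 6 = (144 * S ^ 4 / B\<^sup>2)\<^sup>2 * S ^ 6"
    unfolding norm[symmetric] 2 3 ..
  moreover have "(144 * t ^ 4 / a\<^sup>2)\<^sup>2 * t ^ 6 = 144\<^sup>2 * (t ^ 14 / a ^ 4)" for t a :: real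
  proof -
    have "t ^ 14 = t ^ 8 * t ^ 6" by (simp flip: power_add)
    then show ?thesis by (simp add: power_mult_distrib power_divide flip: power_mult)
  qed
  ultimately have 4: "R ^ 14 / A ^ 4 = S ^ 14 / B ^ 4" by simp
  have inv: "t ^ 10 = (a ^ 3 / t ^ 8) ^ 4 * (t ^ 14 / a ^ 4) ^ 3" if "a \<noteq> 0" "t > 0" for a t :: real
  proof -
    have "t ^ 10 = t ^ 42 / t ^ 32" using power_diff[of t 32 42] that by simp
    then show ?thesis using that by (simp add: power_divide flip: power_mult)
  qed
  have "R ^ 10 = S ^ 10"
    unfolding inv[OF A R] inv[OF B S] 1 4 ..
  then have RS: "R = S" by (rule power_eq_imp_eq_base) (use R S in auto)
  then have "A ^ 3 = B ^ 3" using 1 R by simp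
  then have AB: "A = B" by (rule real_odd_power_inject[rotated]) simp
  have "x = u" "y = w" using 2 3 A R unfolding RS AB by simp_all
  then show "\<phi> = \<psi>" unfolding \<phi> \<psi> AB by simp
qed

lemma laplacian_surj:
  assumes "\<psi> \<in> PosInv"
  shows "\<psi> \<in> laplacian ` PosInv"
proof -
  obtain B u w where \<psi>: "\<psi> = inv_form B u w" and B: "B \<noteq> 0" and s: "u\<^sup>2 + w\<^sup>2 \<noteq> 0"
    using assms unfolding PosInv_eq by blast
  define \<rho> where "\<rho> = u\<^sup>2 + w\<^sup>2"
  have \<rho>: "\<rho> > 0" using s sum_power2_gt_zero_iff[of u w] by (auto simp: \<rho>_def)
  \<comment> \<open>The prescribed value of A^3 / R^8.\<close>
  define b where "b = 9/16 * B"
  have b: "b \<noteq> 0" using B by (simp add: b_def)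
  \<comment> \<open>Solves R^10 = (A^3 / R^8)^4 (R^14 / A^4)^3, the identity behind injectivity,
    with the prescribed values b and rho / 144^2 of the two quotients inserted.\<close>
  define R where "R = root 10 (b ^ 4 * (\<rho> / 144\<^sup>2) ^ 3)"
  have pos: "b ^ 4 * (\<rho> / 144\<^sup>2) ^ 3 > 0" using b \<rho> by (simp add: zero_less_mult_iff)
  have R: "R > 0" unfolding R_def by (rule real_root_gt_zero[OF _ pos]) simp
  have R10: "R ^ 10 = b ^ 4 * (\<rho> / 144\<^sup>2) ^ 3" unfolding R_def by (rule real_root_pow_pos[OF _ pos]) simp
  define A where "A = root 3 (b * R ^ 8)"
  have A3: "A ^ 3 = b * R ^ 8" unfolding A_def by (rule odd_real_root_pow) simp
  have A: "A \<noteq> 0" using A3 b R by auto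
  define k where "k = 144 * R ^ 4 / A\<^sup>2"
  have k: "k > 0" using A R by (simp add: k_def)
  \<comment> \<open>\<open>A\<close> is known only through its cube, so the second equation is first
    proved cubed; the odd exponent can then be removed.\<close>
  have "(\<rho> * A ^ 4) ^ 3 = (144\<^sup>2 * R ^ 14) ^ 3"
  proof -
    have "(\<rho> * A ^ 4) ^ 3 = \<rho> ^ 3 * (A ^ 3) ^ 4" by (simp add: power_mult_distrib power_mult[symmetric])
    also have "\<dots> = (144\<^sup>2) ^ 3 * (b ^ 4 * (\<rho> / 144\<^sup>2) ^ 3) * R ^ 32"
      unfolding A3 by (simp add: power_mult_distrib power_divide power_mult[symmetric])
    also have "\<dots> = (144\<^sup>2 * R ^ 14) ^ 3"
      unfolding R10[symmetric] by (simp add: power_mult_distrib power_mult[symmetric] power_add[symmetric])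
    finally show ?thesis .
  qed
  then have "\<rho> * A ^ 4 = 144\<^sup>2 * R ^ 14" by (rule real_odd_power_inject[rotated]) simp
  then have norm: "(1 / k)\<^sup>2 * \<rho> = R ^ 6"
    using A R by (simp add: k_def power_divide power_mult_distrib power_mult[symmetric] field_simps
        power_add[symmetric])
  have r: "(1 / k * u)\<^sup>2 + (1 / k * w)\<^sup>2 = R ^ 6"
    unfolding scaled_norm \<rho>_def[symmetric] by (rule norm)
  have r0: "(1 / k * u)\<^sup>2 + (1 / k * w)\<^sup>2 \<noteq> 0" unfolding r using R by simp
  have "laplacian (inv_form A (1 / k * u) (1 / k * w))
      = inv_form (16/9 * A ^ 3 / R ^ 8) (k * (1 / k * u)) (k * (1 / k * w))"
    using laplacian_inv_form_eq[OF A r0] unfolding met_scale_eqI[OF R r] k_def[symmetric] .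
  also have "\<dots> = \<psi>"
    unfolding \<psi> A3 b_def using k R by simp
  finally show ?thesis using inv_form_in_PosInv A r0 by blast
qed

lemma laplacian_fixed_points:
  "{\<phi> \<in> PosInv. laplacian \<phi> = \<phi>} = {inv_form A x y |A x y. A\<^sup>2 = 192\<^sup>2 \<and> x\<^sup>2 + y\<^sup>2 = 64\<^sup>2}"
proof -
  have "laplacian (inv_form A x y) = inv_form A x y \<longleftrightarrow> A\<^sup>2 = 192\<^sup>2 \<and> x\<^sup>2 + y\<^sup>2 = 64\<^sup>2"
    if A: "A \<noteq> 0" and r: "x\<^sup>2 + y\<^sup>2 \<noteq> 0" for A x y
  proof -
    define R where "R = met_scale x y"
    have R: "R > 0" unfolding R_def by (rule met_scale_pos[OF r])
    have xy: "x \<noteq> 0 \<or> y \<noteq> 0" using r by auto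
    have "k * x = x \<and> k * y = y \<longleftrightarrow> k = 1" for k using xy by auto
    then have "laplacian (inv_form A x y) = inv_form A x y \<longleftrightarrow> 16/9 * A ^ 3 / R ^ 8 = A
        \<and> 144 * R ^ 4 / A\<^sup>2 = 1"
      unfolding laplacian_inv_form_eq[OF A r] inv_form_inject R_def[symmetric] by (simp only:)
    also have "\<dots> \<longleftrightarrow> 16 * A\<^sup>2 = 9 * R ^ 8 \<and> A\<^sup>2 = 144 * R ^ 4"
    proof -
      have "16/9 * A ^ 3 / R ^ 8 = A * (16 * A\<^sup>2 / (9 * R ^ 8))"
          by (simp add: power2_eq_square power3_eq_cube)
      then have "16/9 * A ^ 3 / R ^ 8 = A \<longleftrightarrow> 16 * A\<^sup>2 / (9 * R ^ 8) = 1" using A by (metis mult_cancel_left1)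
      then show ?thesis using A R by (auto simp: divide_eq_1_iff)
    qed
    also have "\<dots> \<longleftrightarrow> A\<^sup>2 = 192\<^sup>2 \<and> R = 4"
    proof
      assume h: "16 * A\<^sup>2 = 9 * R ^ 8 \<and> A\<^sup>2 = 144 * R ^ 4"
      \<comment> \<open>Substituting the second equation into the first gives 16 * 144 R^4 = 9
        R^8.\<close>
      then have "R ^ 4 * 256 = R ^ 4 * R ^ 4" by (simp add: power_add[symmetric])
      moreover have "R ^ 4 \<noteq> 0" using R by simp
      ultimately have "256 = R ^ 4" using mult_left_cancel by blast
      then have "R ^ 4 = 4 ^ 4" by simp
      then have "R = 4" by (rule power_eq_imp_eq_base) (use R in auto)
      then show "A\<^sup>2 = 192\<^sup>2 \<and> R = 4" using h by simp
    next
      assume h: "A\<^sup>2 = 192\<^sup>2 \<and> R = 4"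
      show "16 * A\<^sup>2 = 9 * R ^ 8 \<and> A\<^sup>2 = 144 * R ^ 4"
        unfolding conjunct1[OF h] conjunct2[OF h] by simp
    qed
    also have "R = 4 \<longleftrightarrow> x\<^sup>2 + y\<^sup>2 = 64\<^sup>2"
      using met_scale_power[of x y] met_scale_eqI[of 4 x y] unfolding R_def by auto
    finally show ?thesis .
  qed
  note fixed = this
  show ?thesis
  proof (intro equalityI subsetI)
    fix \<phi> assume "\<phi> \<in> {\<phi> \<in> PosInv. laplacian \<phi> = \<phi>}"
    then obtain A x y where "\<phi> = inv_form A x y" "A \<noteq> 0" "x\<^sup>2 + y\<^sup>2 \<noteq> 0" "laplacian \<phi> = \<phi>"
      unfolding PosInv_eq by blast
    then show "\<phi> \<in> {inv_form A x y |A x y. A\<^sup>2 = 192\<^sup>2 \<and> x\<^sup>2 + y\<^sup>2 = 64\<^sup>2}" using fixed by blast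
  next
    fix \<phi> assume "\<phi> \<in> {inv_form A x y |A x y. A\<^sup>2 = 192\<^sup>2 \<and> x\<^sup>2 + y\<^sup>2 = 64\<^sup>2}"
    then obtain A x y where \<phi>: "\<phi> = inv_form A x y" and h: "A\<^sup>2 = 192\<^sup>2 \<and> x\<^sup>2 + y\<^sup>2 = 64\<^sup>2" by blast
    then have nz: "A \<noteq> 0" "x\<^sup>2 + y\<^sup>2 \<noteq> 0" by auto
    then show "\<phi> \<in> {\<phi> \<in> PosInv. laplacian \<phi> = \<phi>}"
      using fixed[OF nz] h unfolding \<phi> mem_Collect_eq inv_form_in_PosInv by blast
  qed
qed

lemma wedge_e1_omega: "wedge 1 2 (eform [1]) omega = e1_omega"
proof -
  have "wedge 1 2 (eform [1]) (eform [a, b]) = eform [1, a, b]" for a b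
    using wedge_eform[of "[1]" "[a, b]"] by (simp add: One_nat_def numeral_2_eq_2)
  then show ?thesis unfolding omega_def wedge_add_right e1_omega_def by simp
qed

lemma fp_form_eq: "fp_form a R \<sigma> \<alpha> = inv_form (\<sigma> ^ 3 * a ^ 3) (R ^ 3 * cos \<alpha>) (R ^ 3 * sin \<alpha>)"
  unfolding fp_form_def inv_form_def wedge_e1_omega ..

text \<open>On \<open>{-1, 1}\<close> the cube of sigma is sigma itself, so the sign selects one of
  the two circles, and alpha is the polar angle of (x, y) / 64.\<close>

lemma fixed_points_circles:
  assumes "a ^ 3 = 192" "R ^ 3 = 64"
  shows "{\<phi> \<in> PosInv. laplacian \<phi> = \<phi>} = {fp_form a R \<sigma> \<alpha> |\<sigma> \<alpha>. \<sigma> \<in> {-1, 1}}"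
  unfolding laplacian_fixed_points fp_form_eq assms
proof (intro equalityI subsetI)
  fix \<phi> assume "\<phi> \<in> {inv_form A x y |A x y. A\<^sup>2 = 192\<^sup>2 \<and> x\<^sup>2 + y\<^sup>2 = 64\<^sup>2}"
  then obtain A x y where \<phi>: "\<phi> = inv_form A x y" and A: "A\<^sup>2 = 192\<^sup>2" and r: "x\<^sup>2 + y\<^sup>2 = 64\<^sup>2" by blast
  have "(x / 64)\<^sup>2 + (y / 64)\<^sup>2 = 1" using r by (simp add: power_divide add_divide_distrib[symmetric])
  then obtain t where "x / 64 = cos t" "y / 64 = sin t" using sincos_total_2pi by metis
  then have xy: "x = 64 * cos t" "y = 64 * sin t" by auto
  have "A = 192 \<or> A = - 192" using A by (simp only: power2_eq_iff)
  then have "A = (-1) ^ 3 * 192 \<or> A = 1 ^ 3 * 192" by auto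
  then show "\<phi> \<in> {inv_form (\<sigma> ^ 3 * 192) (64 * cos \<alpha>) (64 * sin \<alpha>) |\<sigma> \<alpha>. \<sigma> \<in> {-1, 1}}"
    unfolding \<phi> xy by blast
next
  fix \<phi> assume "\<phi> \<in> {inv_form (\<sigma> ^ 3 * 192) (64 * cos \<alpha>) (64 * sin \<alpha>) |\<sigma> \<alpha>. \<sigma> \<in> {-1, 1}}"
  then obtain \<sigma> \<alpha> where \<phi>: "\<phi> = inv_form (\<sigma> ^ 3 * 192) (64 * cos \<alpha>) (64 * sin \<alpha>)"
      and \<sigma>: "\<sigma> \<in> {-1, 1 :: real}" by blast
  have "(\<sigma> ^ 3 * 192)\<^sup>2 = 192\<^sup>2" using \<sigma> by auto
  moreover have "(64 * cos \<alpha>)\<^sup>2 + (64 * sin \<alpha>)\<^sup>2 = 64\<^sup>2" unfolding scaled_norm by simp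
  ultimately show "\<phi> \<in> {inv_form A x y |A x y. A\<^sup>2 = 192\<^sup>2 \<and> x\<^sup>2 + y\<^sup>2 = 64\<^sup>2}" unfolding \<phi> by blast
qed

theorem theorem5p6:
  shows "bij_betw laplacian PosInv PosInv
       \<and> (\<forall>\<phi>\<in>PosInv. orient_pres \<phi>)
       \<and> (\<exists>!p :: real \<times> real. fst p > 0 \<and> snd p > 0 \<and>
            {\<phi>\<in>PosInv. laplacian \<phi> = \<phi>}
              = {fp_form (fst p) (snd p) \<sigma> \<alpha> | \<sigma> \<alpha>. \<sigma> \<in> {-1, 1}})"
proof (intro conjI)
  show "bij_betw laplacian PosInv PosInv"
    unfolding bij_betw_def using laplacian_inj laplacian_maps laplacian_surj by blast
  show "\<forall>\<phi>\<in>PosInv. orient_pres \<phi>" using laplacian_maps by blast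
  have a: "root 3 192 > 0" "root 3 192 ^ 3 = (192 :: real)"
    by (simp_all add: real_root_pow_pos)
  show "\<exists>!p :: real \<times> real. fst p > 0 \<and> snd p > 0 \<and>
            {\<phi>\<in>PosInv. laplacian \<phi> = \<phi>}
              = {fp_form (fst p) (snd p) \<sigma> \<alpha> | \<sigma> \<alpha>. \<sigma> \<in> {-1, 1}}"
  proof (rule ex1I[of _ "(root 3 192, 4)"])
    show "fst (root 3 192, 4::real) > 0 \<and> snd (root 3 192, 4::real) > 0 \<and>
            {\<phi>\<in>PosInv. laplacian \<phi> = \<phi>}
              = {fp_form (fst (root 3 192, 4::real)) (snd (root 3 192, 4)) \<sigma> \<alpha> | \<sigma> \<alpha>. \<sigma> \<in> {-1, 1}}"
      using a(1) fixed_points_circles[OF a(2), of 4] by simp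
    fix p :: "real \<times> real"
    assume p: "fst p > 0 \<and> snd p > 0 \<and>
            {\<phi>\<in>PosInv. laplacian \<phi> = \<phi>}
              = {fp_form (fst p) (snd p) \<sigma> \<alpha> | \<sigma> \<alpha>. \<sigma> \<in> {-1, 1}}"
    \<comment> \<open>For uniqueness, this single fixed point suffices: its coefficients give the
      squares of both cubes, and positivity excludes the negative roots.\<close>
    have "fp_form (fst p) (snd p) 1 0 \<in> {\<phi>\<in>PosInv. laplacian \<phi> = \<phi>}" using p by blast
    then have 2: "(fst p ^ 3)\<^sup>2 = 192\<^sup>2" "(snd p ^ 3)\<^sup>2 = 64\<^sup>2"
      unfolding laplacian_fixed_points fp_form_eq by (auto simp: inv_form_inject)
    have 3: "fst p ^ 3 = 192" "snd p ^ 3 = 64"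
      using power2_eq_imp_eq[OF 2(1)] power2_eq_imp_eq[OF 2(2)] p by simp_all
    have "fst p = root 3 192" by (rule real_odd_power_inject[of 3]) (simp_all add: 3 a(2))
    moreover have "snd p = 4" by (rule real_odd_power_inject[of 3]) (simp_all add: 3)
    ultimately show "p = (root 3 192, 4)" by (simp add: prod_eq_iff)
  qed
qed

end
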